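(* For every non-negative integer $m$ define $$D_m := \lim_{\deg Q \to \infty} \frac{1}{(1-q^{-1}) (\log q)^{4m}} \, \frac{1}{\phi (Q)} \, \frac{1}{(\deg Q)^{4m + 4}} \sum_{\substack{\chi \bmod Q \\ \chi \neq \chi_0}} \Big\lvert L^{(m)} \Big( \frac{1}{2} , \chi \Big) \Big\rvert^{4} ,$$ the limit being over monic prime polynomials $Q \in \mathbb{F}_q[t]$. Then $$\begin{aligned} D_m = \int_{\substack{a_1 , a_2 , a_3 , a_4 \geq 0 \\ 2a_1 + a_3 + a_4 < 1 \\ 2a_2 + a_3 + a_4 < 1}} &\Big( (a_1 + a_3 )^m (a_1 + a_4 )^m + (1- a_1 - a_3 )^m (1 - a_1 - a_4 )^m \Big) \\ &\cdot \Big( (a_2 + a_3 )^m (a_2 + a_4 )^m + (1- a_2 - a_3 )^m (1 - a_2 - a_4 )^m \Big) \, \mathrm{d} a_1 \mathrm{d} a_2 \mathrm{d} a_3 \mathrm{d} a_4 , \end{aligned}$$ and $$D_m \sim \frac{1}{16 m^4} \quad \text{as } m \to \infty .$$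
   Context: $q$ is a prime power, $\mathcal{A} = \mathbb{F}_q[t]$, and $\mathcal{M} \subset \mathcal{A}$ is the set of monic polynomials. For $A \in \mathcal{A}\setminus\{0\}$, $\lvert A \rvert := q^{\deg A}$. "Prime" means monic irreducible polynomial. $\phi(Q) = \lvert (\mathcal{A}/Q\mathcal{A})^* \rvert$. A Dirichlet character of modulus $R \in \mathcal{M}$ is a function $\chi$ from $\mathcal{A}$ to the complex numbers such that for all $A,B \in \mathcal{A}$: $\chi(A)=\chi(B)$ if $A \equiv B \pmod R$; $\chi(AB)=\chi(A)\chi(B)$; and $\chi(A)=0$ if and only if $A$ and $R$ are not coprime. The trivial character $\chi_0$ of modulus $R$ satisfies $\chi_0(A)=1$ for all $A$ coprime to $R$. A sum over $\chi \bmod Q$ runs over all Dirichlet characters of modulus $Q$. For $\Re(s)>1$, $L(s,\chi) := \sum_{A \in \mathcal{M}} \chi(A)\lvert A\rvert^{-s}$, extended analytically to $\mathbb{C}$ for $\chi \ne \chi_0$; $L^{(m)}$ is the $m$-th derivative with respect to $s$ (with $L^{(0)}=L$). $D_m \sim E_m$ means $D_m/E_m \to 1$. *)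

theory Defs
  imports
    "HOL-Complex_Analysis.Complex_Analysis"
    "HOL-Computational_Algebra.Computational_Algebra"
    "HOL-Number_Theory.Cong"
    "HOL-Algebra.QuotRing"
    "HOL-Library.Landau_Symbols"
begin

text \<open>
  The field \<open>F\<^sub>q\<close> is an arbitrary type \<open>'a\<close> of class \<^class>\<open>finite_field\<close>, so that \<open>q = CARD('a)\<close>,
  and the ring \<open>F\<^sub>q[t]\<close> is the type \<open>'a poly\<close>.
\<close>

definition monic :: "'a::finite_field poly \<Rightarrow> bool" where
  "monic A \<longleftrightarrow> lead_coeff A = 1"

definition monic_prime :: "'a::finite_field poly \<Rightarrow> bool" where
  "monic_prime Q \<longleftrightarrow> monic Q \<and> irreducible Q"

text \<open>Only meaningful for \<open>A \<noteq> 0\<close>, since \<open>degree 0 = 0\<close> here.\<close>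

definition poly_abs :: "'a::finite_field poly \<Rightarrow> real" where
  "poly_abs A = real CARD('a) ^ degree A"

definition poly_ring_rec :: "'a::finite_field poly ring" where
  "poly_ring_rec = \<lparr>carrier = UNIV, mult = (*), one = 1, zero = 0, add = (+)\<rparr>"

definition poly_phi :: "'a::finite_field poly \<Rightarrow> nat" where
  "poly_phi Q = card (Units (poly_ring_rec Quot (PIdl\<^bsub>poly_ring_rec\<^esub> Q)))"

definition dirichlet_character :: "'a::finite_field poly \<Rightarrow> ('a poly \<Rightarrow> complex) \<Rightarrow> bool" where
  "dirichlet_character R \<psi> \<longleftrightarrow>
     (\<forall>A B. [A = B] (mod R) \<longrightarrow> \<psi> A = \<psi> B) \<and>
     (\<forall>A B. \<psi> (A * B) = \<psi> A * \<psi> B) \<and>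
     (\<forall>A. \<psi> A = 0 \<longleftrightarrow> \<not> coprime A R)"

definition trivial_character :: "'a::finite_field poly \<Rightarrow> 'a poly \<Rightarrow> complex" where
  "trivial_character R A = (if coprime A R then 1 else 0)"

text \<open>
  The entire function that extends the Dirichlet series from the half-plane \<open>Re s > 1\<close>. It is
  unique by the identity theorem and exists whenever \<open>\<psi>\<close> is a nontrivial character; for a
  trivial character the value is unspecified.
\<close>

definition dirichlet_L :: "('a::finite_field poly \<Rightarrow> complex) \<Rightarrow> complex \<Rightarrow> complex" where
  "dirichlet_L \<psi> = (THE f. f holomorphic_on UNIV \<and>
     (\<forall>s. Re s > 1 \<longrightarrow>
        f s = (\<Sum>\<^sub>\<infinity>A\<in>{A. monic A}. \<psi> A * complex_of_real (poly_abs A) powr (- s))))"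

text \<open>The filter for limits over monic primes \<open>Q\<close> with \<open>deg Q \<longlongrightarrow> \<infinity>\<close>.\<close>

definition primes_at_infinity :: "'a::finite_field poly filter" where
  "primes_at_infinity = inf (filtercomap degree at_top) (principal {Q. monic_prime Q})"

definition normalised_fourth_moment :: "nat \<Rightarrow> 'a::finite_field poly \<Rightarrow> real" where
  "normalised_fourth_moment m Q =
     1 / ((1 - 1 / real CARD('a)) * ln (real CARD('a)) ^ (4 * m))
     * (1 / real (poly_phi Q)) * (1 / real (degree Q) ^ (4 * m + 4))
     * (\<Sum>\<psi> | dirichlet_character Q \<psi> \<and> \<psi> \<noteq> trivial_character Q.
          norm ((deriv ^^ m) (dirichlet_L \<psi>) (1 / 2)) ^ 4)"

definition D_lim :: "'a::finite_field itself \<Rightarrow> nat \<Rightarrow> real" where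
  "D_lim _ m = Lim (primes_at_infinity :: 'a poly filter) (normalised_fourth_moment m)"

definition integration_domain :: "(real \<times> real \<times> real \<times> real) set" where
  "integration_domain = {(a1, a2, a3, a4).
     a1 \<ge> 0 \<and> a2 \<ge> 0 \<and> a3 \<ge> 0 \<and> a4 \<ge> 0 \<and>
     2 * a1 + a3 + a4 < 1 \<and> 2 * a2 + a3 + a4 < 1}"

end

theory Submission
  imports Defs "HOL-Algebra.Multiplicative_Group" "HOL-Real_Asymp.Real_Asymp"
begin

text \<open>
  Write \<open>q\<close> for the size of the field, \<open>n = deg Q\<close>, \<open>r = sqrt q\<close>, and let \<open>\<psi>\<close> be a nontrivial character
  modulo the prime \<open>Q\<close>. The sum of \<open>\<psi>\<close> over the monic polynomials of degree \<open>k \<ge> n\<close> vanishes, so \<open>L(s, \<psi>)\<close>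
  is a polynomial in \<open>q powr -s\<close>, and the \<open>m\<close>-th derivative at \<open>1/2\<close> is \<open>(- log q)^m\<close> times \<open>S = \<Sum>k<n. k^m c(k)\<close>, where
  \<open>c(k) = lcoef \<psi> k\<close> is the sum over degree \<open>k\<close> divided by \<open>r^k\<close>. The theorem asks for the mean value
  of \<open>\<bar>S\<bar>^4\<close>, that is, for the mean square of \<open>S * cnj S\<close>.

  \<^bold>\<open>Folding.\<close> The functional equation says \<open>c(k) = W cnj (c(n - 1 - k))\<close> with \<open>\<bar>W\<bar> = 1\<close> when \<open>\<psi>\<close> is nontrivial
  on constants, and otherwise this holds up to differences \<open>\<nu>(k+1) - \<nu>(k)\<close> of a bounded sequence
  (\<open>approximate_functional_equation\<close>). Both come from a Gauss sum built with the pairing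
  \<open>(A, B) \<mapsto>\<close> coefficient of \<open>t^(n-1)\<close> in \<open>AB mod Q\<close>. Expand \<open>S * cnj S\<close> over pairs \<open>(a, b)\<close> and reflect the
  pairs with \<open>a + b \<ge> n\<close>: what results is a form \<open>\<Sum> w(a, b) c(a) cnj (c(b))\<close> over \<open>a + b < n\<close>, with the weight
  \<open>w(a, b) = a^m b^m + (n-1-a)^m (n-1-b)^m\<close> of \<open>fold_weight\<close>. A telescoping error is harmless only when
  summed over an interval, so the triangle \<open>a + b < n\<close> is replaced by a staircase of products of intervals,
  obtained by cutting \<open>{..<n}\<close> symmetrically into \<open>2K + 1\<close> blocks. The products of blocks next to the antidiagonal
  are discarded; fourth moments of block sums show that this costs \<open>O(1/K)\<close> in mean square, and the
  telescoping error costs even less (\<open>folding_mean_square\<close>).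

  \<^bold>\<open>Mean square.\<close> Orthogonality of characters turns the mean square of the folded form into a sum over
  monic \<open>A, B, C, D\<close> with \<open>AD \<equiv> BC (mod Q)\<close>, where \<open>deg A + deg B\<close> and \<open>deg C + deg D\<close> stay below \<open>n\<close> by the block
  width. The solutions with \<open>AD \<noteq> BC\<close> are counted with a divisor bound and saved by that gap
  (\<open>card_off_diagonal\<close>, \<open>divisor_bound\<close>). The solutions of \<open>AD = BC\<close> are
  \<open>A = GA', B = GB', C = HA', D = HB'\<close> with \<open>A', B'\<close> coprime; the proportion of coprime pairs among monic pairs of
  given positive degrees is exactly \<open>1 - 1/q\<close>, and only degrees \<open>(g, h, i, j)\<close> of \<open>(G, H, A', B')\<close> remain
  (\<open>diagonal_sum\<close>).

  \<^bold>\<open>Limits.\<close> Hence the moment is, up to \<open>O(1/K)\<close> and terms that vanish with \<open>n\<close>, a sum over integer points with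
  \<open>2g + i + j < n\<close> and \<open>2h + i + j < n\<close> (\<open>mean_fourth_main_term\<close>). Scaled by \<open>1/n\<close> it is a Riemann sum for the
  stated integral (\<open>main_sum_tendsto\<close>); \<open>K\<close> is arbitrary, so the limit is that integral. For large \<open>m\<close> the
  integrand lives near the origin, where after scaling by \<open>m\<close> it tends to \<open>exp (- 2 (a1 + a2 + a3 + a4))\<close>, whose
  integral over the orthant is \<open>1/16\<close> (\<open>moment_integral_asymp\<close>).
\<close>

hide_const (open) Module.smult UnivPoly.up_ring.monom UnivPoly.up_ring.coeff

section \<open>Polynomials over a finite field\<close>

lemma card_field_ge_2: "CARD('a::finite_field) \<ge> 2"
proof -
  have "card {0, 1::'a} \<le> CARD('a)" by (rule card_mono) auto
  then show ?thesis by simp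
qed

text \<open>
  Defined by coefficients, so that the zero polynomial is included whatever \<open>k\<close> is.
\<close>

definition polys_below :: "nat \<Rightarrow> 'a::finite_field poly set" where
  "polys_below k = {A. \<forall>i\<ge>k. coeff A i = 0}"

definition monics :: "nat \<Rightarrow> 'a::finite_field poly set" where
  "monics k = {A. monic A \<and> degree A = k}"

lemma polys_below_0 [simp]: "polys_below 0 = {0}"
  by (auto simp: polys_below_def poly_eq_iff)

lemma polys_below_Suc:
  "(polys_below (Suc k) :: 'a::finite_field poly set) = (\<lambda>(c, A). pCons c A) ` (UNIV \<times> polys_below k)"
proof (intro Set.set_eqI iffI)
  fix A :: "'a poly"
  assume A: "A \<in> polys_below (Suc k)"
  obtain c B where cB: "A = pCons c B" by (cases A)
  have "B \<in> polys_below k"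
    unfolding polys_below_def
  proof safe
    fix i assume "i \<ge> k"
    then have "coeff A (Suc i) = 0" using A by (auto simp: polys_below_def)
    then show "coeff B i = 0" by (simp add: cB)
  qed
  then show "A \<in> (\<lambda>(c, A). pCons c A) ` (UNIV \<times> polys_below k)" using cB by auto
next
  fix A :: "'a poly"
  assume "A \<in> (\<lambda>(c, A). pCons c A) ` (UNIV \<times> polys_below k)"
  then show "A \<in> polys_below (Suc k)"
    by (auto simp: polys_below_def coeff_pCons split: nat.splits)
qed

lemma finite_polys_below [simp, intro]: "finite (polys_below k)"
  by (induction k) (auto simp: polys_below_Suc)

lemma card_polys_below: "card (polys_below k :: 'a::finite_field poly set) = CARD('a) ^ k"
proof (induction k)
  case (Suc k)
  have "inj_on (\<lambda>(c, A). pCons c A) (UNIV \<times> (polys_below k :: 'a poly set))"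
    by (auto simp: inj_on_def)
  then show ?case
    by (simp add: polys_below_Suc card_image card_cartesian_product Suc del: UNIV_Times_UNIV)
qed simp

lemma polys_below_iff: "A \<in> polys_below k \<longleftrightarrow> A = 0 \<or> degree A < k"
proof (cases "A = 0")
  case False
  then show ?thesis
    by (auto simp: polys_below_def intro: coeff_eq_0)
       (metis leading_coeff_0_iff not_le)
qed (simp add: polys_below_def)

lemma polys_below_add: "A \<in> polys_below k \<Longrightarrow> B \<in> polys_below k \<Longrightarrow> A + B \<in> polys_below k"
  by (auto simp: polys_below_def)

lemma polys_below_diff: "A \<in> polys_below k \<Longrightarrow> B \<in> polys_below k \<Longrightarrow> A - B \<in> polys_below k"
  by (auto simp: polys_below_def)

lemma polys_below_smult: "A \<in> polys_below k \<Longrightarrow> smult c A \<in> polys_below k"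
  by (auto simp: polys_below_def)

lemma polys_below_mono: "j \<le> k \<Longrightarrow> polys_below j \<subseteq> polys_below k"
  by (auto simp: polys_below_def)

lemma mod_in_polys_below: "Q \<noteq> 0 \<Longrightarrow> A mod Q \<in> polys_below (degree Q)"
  using degree_mod_less[of Q A] by (auto simp: polys_below_iff)

lemma mod_polys_below_id: "A \<in> polys_below (degree Q) \<Longrightarrow> A mod Q = A"
  by (auto simp: polys_below_iff mod_poly_less)

lemma monics_eq_image:
  "(monics k :: 'a::finite_field poly set) = (\<lambda>A. monom 1 k + A) ` polys_below k"
proof (intro Set.set_eqI iffI)
  fix A :: "'a poly"
  assume A: "A \<in> monics k"
  then have "A - monom 1 k \<in> polys_below k"
    by (auto simp: polys_below_def monics_def monic_def coeff_eq_0)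
  then show "A \<in> (\<lambda>A. monom 1 k + A) ` polys_below k"
    by (intro image_eqI[of _ _ "A - monom 1 k"]) auto
next
  fix A :: "'a poly"
  assume "A \<in> (\<lambda>A. monom 1 k + A) ` polys_below k"
  then obtain B where B: "A = monom 1 k + B" "B \<in> polys_below k" by auto
  have 1: "coeff A k = 1" using B by (auto simp: polys_below_def)
  have 2: "degree A \<le> k" by (rule degree_le) (use B in \<open>auto simp: polys_below_def\<close>)
  have "degree A = k" using 1 2 le_degree[of A k] by fastforce
  with 1 show "A \<in> monics k" by (simp add: monics_def monic_def)
qed

lemma finite_monics [simp, intro]: "finite (monics k)"
  by (simp add: monics_eq_image)

lemma card_monics: "card (monics k :: 'a::finite_field poly set) = CARD('a) ^ k"
  by (simp add: monics_eq_image card_image card_polys_below)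

lemma monics_nonzero: "A \<in> monics k \<Longrightarrow> A \<noteq> 0"
  by (auto simp: monics_def monic_def)

lemma monics_0 [simp]: "monics 0 = {1}"
  by (auto simp: monics_eq_image)

lemma monics_mult: "A \<in> monics j \<Longrightarrow> B \<in> monics k \<Longrightarrow> A * B \<in> monics (j + k)"
  using monics_nonzero[of A j] monics_nonzero[of B k] lead_coeff_mult[of A B]
  by (auto simp: monics_def monic_def degree_mult_eq simp del: coeff_mult)

lemma monic_mult_cancel: "monic (A * B) \<Longrightarrow> monic A \<Longrightarrow> monic B"
  by (auto simp: monic_def lead_coeff_mult simp del: coeff_mult)

lemma polys_below_subset_monics: "A \<in> monics k \<Longrightarrow> k < n \<Longrightarrow> A \<in> polys_below n"
  by (auto simp: monics_def polys_below_iff)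

text \<open>
  A nonzero combination of \<open>A\<close> and \<open>B\<close> of least degree divides both of them.
\<close>

lemma bezout_poly:
  fixes A B :: "'a::field poly"
  assumes cop: "\<And>D. D dvd A \<Longrightarrow> D dvd B \<Longrightarrow> is_unit D"
  shows "\<exists>u v. u * A + v * B = 1"
proof -
  define I where "I = {D. D \<noteq> 0 \<and> (\<exists>u v. D = u * A + v * B)}"
  have ne: "I \<noteq> {}"
  proof (rule ccontr)
    assume "\<not> I \<noteq> {}"
    then have *: "u * A + v * B = 0" for u v unfolding I_def by blast
    have "A = 0" "B = 0" using *[of 1 0] *[of 0 1] by auto
    then have "is_unit (0::'a poly)" using cop[of 0] by simp
    then show False by simp
  qed
  then obtain D where D: "D \<in> I" and min: "\<And>E. E \<in> I \<Longrightarrow> degree D \<le> degree E"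
    using ex_has_least_nat[of "\<lambda>D. D \<in> I" _ degree] by (metis ex_in_conv)
  from D obtain u v where uv: "D = u * A + v * B" and D0: "D \<noteq> 0" by (auto simp: I_def)
  have dvd: "D dvd u' * A + v' * B" for u' v'
  proof -
    define E where "E = (u' * A + v' * B) mod D"
    have "E = (u' * A + v' * B) - (u' * A + v' * B) div D * D"
      by (simp add: E_def minus_div_mult_eq_mod)
    also have "\<dots> = (u' - (u' * A + v' * B) div D * u) * A + (v' - (u' * A + v' * B) div D * v) * B"
    proof -
      have "(u' * A + v' * B) - X * D = (u' - X * u) * A + (v' - X * v) * B" for X
        by (simp add: uv algebra_simps)
      then show ?thesis .
    qed
    finally have "E \<noteq> 0 \<Longrightarrow> E \<in> I" by (auto simp: I_def)
    moreover have "E \<noteq> 0 \<Longrightarrow> degree E < degree D"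
      using degree_mod_less[of D "u' * A + v' * B"] D0 by (auto simp: E_def)
    ultimately have "E = 0" using min[of E] by fastforce
    then show ?thesis by (auto simp: E_def mod_eq_0_iff_dvd)
  qed
  have "is_unit D" using dvd[of 1 0] dvd[of 0 1] by (intro cop) auto
  then obtain w where w: "1 = D * w" by (auto elim: dvdE)
  have "w * u * A + w * v * B = 1" using w uv by (simp add: algebra_simps)
  then show ?thesis by blast
qed

lemma coprime_dvd_mult_poly:
  fixes A B C :: "'a::field poly"
  assumes cop: "coprime A B" and dvd: "A dvd B * C"
  shows "A dvd C"
proof -
  obtain u v where "u * A + v * B = 1"
    using bezout_poly[of A B] cop by (auto simp: coprime_def)
  then have "C = u * C * A + v * (B * C)" by (metis mult.assoc mult.commute distrib_left mult.right_neutral)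
  then show ?thesis using dvd by (metis dvd_add dvd_mult dvd_triv_right)
qed

lemma monic_dvd_antisym: "monic A \<Longrightarrow> monic B \<Longrightarrow> A dvd B \<Longrightarrow> B dvd A \<Longrightarrow> A = B"
proof -
  assume *: "monic A" "monic B" "A dvd B" "B dvd A"
  obtain C where C: "B = A * C" using * by auto
  have "A \<noteq> 0" "B \<noteq> 0" using * by (auto simp: monic_def)
  then have "degree B = degree A" using * by (metis dvd_imp_degree_le le_antisym)
  then have "degree C = 0" using C \<open>A \<noteq> 0\<close> \<open>B \<noteq> 0\<close> by (auto simp: degree_mult_eq)
  moreover have "monic C" using * C monic_mult_cancel by metis
  ultimately have "C = 1" by (auto simp: monic_def elim!: degree_eq_zeroE simp: one_pCons)
  then show ?thesis using C by simp
qed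

lemma ex_monic_associate: "A \<noteq> 0 \<Longrightarrow> \<exists>c. c \<noteq> 0 \<and> monic (smult c A)"
  by (rule exI[of _ "inverse (lead_coeff A)"]) (auto simp: monic_def)

lemma prime_degree_pos: "monic_prime Q \<Longrightarrow> degree Q > 0"
  unfolding monic_prime_def
  by (metis degree_eq_zeroE gr0I irreducible_def is_unit_pCons_iff pCons_0_0)

lemma monic_prime_nonzero: "monic_prime Q \<Longrightarrow> Q \<noteq> 0"
  by (auto simp: monic_prime_def monic_def)

lemma coprime_prime_iff:
  assumes "monic_prime Q"
  shows "coprime A Q \<longleftrightarrow> \<not> Q dvd A"
proof
  assume "coprime A Q"
  then show "\<not> Q dvd A"
    using assms coprime_common_divisor[of A Q Q] by (auto simp: monic_prime_def irreducible_def)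
next
  assume n: "\<not> Q dvd A"
  show "coprime A Q"
  proof (rule coprimeI)
    fix D assume D: "D dvd A" "D dvd Q"
    then obtain E where E: "Q = D * E" by auto
    then have "is_unit D \<or> is_unit E" using assms by (auto simp: monic_prime_def irreducible_def)
    then show "is_unit D"
    proof
      assume "is_unit E"
      then have "Q dvd D" using E by (simp add: mult_unit_dvd_iff)
      then show ?thesis using D n dvd_trans by blast
    qed
  qed
qed

lemma prime_dvd_mult_poly:
  assumes "monic_prime Q"
  shows "Q dvd A * B \<longleftrightarrow> Q dvd A \<or> Q dvd B"
  using assms field_poly_irreducible_imp_prime[of Q] prime_elem_dvd_mult_iff
  by (auto simp: monic_prime_def)

lemma not_dvd_polys_below: "A \<in> polys_below (degree Q) \<Longrightarrow> A \<noteq> 0 \<Longrightarrow> \<not> Q dvd A"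
  using dvd_imp_degree_le[of Q A] by (auto simp: polys_below_iff)

lemma not_dvd_monics: "A \<in> monics k \<Longrightarrow> k < degree Q \<Longrightarrow> \<not> Q dvd A"
  using monics_nonzero[of A k] not_dvd_polys_below[of A Q] polys_below_subset_monics[of A k "degree Q"]
  by blast

lemma cong_iff_dvd_diff_poly: "[A = B] (mod Q) \<longleftrightarrow> Q dvd A - (B :: 'a::field poly)"
  by (simp add: cong_def mod_eq_dvd_iff)

lemma cong_polys_below:
  "A \<in> polys_below (degree Q) \<Longrightarrow> B \<in> polys_below (degree Q) \<Longrightarrow> [A = B] (mod Q) \<longleftrightarrow> A = B"
  by (auto simp: cong_def mod_polys_below_id)

section \<open>Dirichlet characters modulo a prime\<close>

lemma cring_poly_ring_rec: "cring (poly_ring_rec :: 'a::finite_field poly ring)"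
proof (intro cringI abelian_groupI comm_monoidI)
  fix x :: "'a poly"
  show "\<exists>y\<in>carrier poly_ring_rec. y \<oplus>\<^bsub>poly_ring_rec\<^esub> x = \<zero>\<^bsub>poly_ring_rec\<^esub>"
    by (rule bexI[of _ "- x"]) (auto simp: poly_ring_rec_def)
qed (auto simp: poly_ring_rec_def algebra_simps)

text \<open>
  The parameter \<open>r\<close> is the factor by which a degree is damped at the central point: a polynomial of
  degree \<open>k\<close> enters \<open>L(1/2, \<psi>)\<close> with weight \<open>1 / r^k\<close>.
\<close>

locale prime_modulus =
  fixes Q :: "'a::finite_field poly" and r :: real
  assumes prime: "monic_prime Q" and r_def: "r = sqrt (real CARD('a))"
begin

definition \<phi> :: nat where "\<phi> = CARD('a) ^ degree Q - 1"

abbreviation chars :: "('a poly \<Rightarrow> complex) set" where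
  "chars \<equiv> {\<psi>. dirichlet_character Q \<psi>}"

lemma deg_pos: "degree Q > 0" using prime by (rule prime_degree_pos)

lemma Q_nonzero: "Q \<noteq> 0" using prime by (rule monic_prime_nonzero)

lemma card_power_ge_2: "CARD('a) ^ degree Q \<ge> 2"
  using deg_pos card_field_ge_2[where 'a='a] self_le_power[of "CARD('a)" "degree Q"] by linarith

lemma phi_pos: "\<phi> > 0"
  using card_power_ge_2 by (simp add: \<phi>_def)

lemma ex_inverse_mod:
  assumes "\<not> Q dvd A"
  shows "\<exists>B. [A * B = 1] (mod Q)"
proof -
  have "coprime A Q" using assms prime by (simp add: coprime_prime_iff)
  then obtain u v where "u * A + v * Q = 1"
    using bezout_poly[of A Q] by (auto simp: coprime_def)
  then have "A * u - 1 = - v * Q" by (simp add: algebra_simps)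
  then have "Q dvd A * u - 1" by simp
  then show ?thesis by (auto simp: cong_iff_dvd_diff_poly)
qed

lemma not_dvd_1: "\<not> Q dvd 1"
  using prime by (auto simp: monic_prime_def irreducible_def)

lemma cong_dvd_iff': "[A = B] (mod Q) \<Longrightarrow> Q dvd A \<longleftrightarrow> Q dvd B"
  by (auto simp: cong_def dvd_eq_mod_eq_0)

lemma not_dvd_power: "\<not> Q dvd A \<Longrightarrow> \<not> Q dvd A ^ i"
  by (induction i) (auto simp: prime_dvd_mult_poly[OF prime] not_dvd_1)

lemma cong_mult_cancel_poly:
  assumes "[C * A = C * B] (mod Q)" "\<not> Q dvd C"
  shows "[A = B] (mod Q)"
  using assms prime_dvd_mult_poly[OF prime, of C "A - B"]
  by (simp add: cong_iff_dvd_diff_poly algebra_simps)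

abbreviation R where "R \<equiv> (poly_ring_rec :: 'a poly ring)"
abbreviation residue_class where "residue_class A \<equiv> (PIdl\<^bsub>R\<^esub> Q) +>\<^bsub>R\<^esub> A"
abbreviation FQ where "FQ \<equiv> R Quot (PIdl\<^bsub>R\<^esub> Q)"

lemma principal_ideal_eq: "PIdl\<^bsub>R\<^esub> Q = {A. Q dvd A}"
  by (auto simp: cgenideal_def poly_ring_rec_def dvd_def mult.commute)

lemma residue_class_eq: "residue_class A = {B. [B = A] (mod Q)}"
proof -
  have "residue_class A = {C + A | C. Q dvd C}"
    unfolding principal_ideal_eq by (auto simp: a_r_coset_def' poly_ring_rec_def)
  also have "\<dots> = {B. [B = A] (mod Q)}"
    unfolding cong_iff_dvd_diff_poly by (auto intro: exI[of _ "_ - A"])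
  finally show ?thesis .
qed

lemma residue_class_cong: "residue_class A = residue_class B \<longleftrightarrow> [A = B] (mod Q)"
  unfolding residue_class_eq by (auto simp: cong_def)

lemma field_FQ: "field FQ"
proof -
  interpret cring R by (rule cring_poly_ring_rec)
  have id: "ideal (PIdl\<^bsub>R\<^esub> Q) R" by (rule cgenideal_ideal) (simp add: poly_ring_rec_def)
  have "maximalideal (PIdl\<^bsub>R\<^esub> Q) R"
  proof (rule maximalidealI[OF id])
    show "carrier R \<noteq> PIdl\<^bsub>R\<^esub> Q"
      using not_dvd_1 unfolding principal_ideal_eq by (auto simp: poly_ring_rec_def)
  next
    fix J assume J: "ideal J R" "PIdl\<^bsub>R\<^esub> Q \<subseteq> J" "J \<subseteq> carrier R"
    interpret J: ideal J R by fact
    show "J = PIdl\<^bsub>R\<^esub> Q \<or> J = carrier R"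
    proof (cases "J \<subseteq> PIdl\<^bsub>R\<^esub> Q")
      case False
      then obtain A where A: "A \<in> J" "\<not> Q dvd A" by (auto simp: principal_ideal_eq)
      then obtain B where "[A * B = 1] (mod Q)" using ex_inverse_mod by blast
      then have "Q dvd A * B - 1" by (simp add: cong_iff_dvd_diff_poly)
      then have "Q dvd 1 - A * B" by (metis dvd_minus_iff minus_diff_eq)
      then have 1: "1 - A * B \<in> J" using J by (auto simp: principal_ideal_eq)
      have 2: "A * B \<in> J" using J.I_r_closed[of A B] A by (simp add: poly_ring_rec_def)
      have "(1 - A * B) + A * B \<in> J" using J.a_closed[OF 1 2] by (simp add: poly_ring_rec_def)
      then have "\<one>\<^bsub>R\<^esub> \<in> J" by (simp add: poly_ring_rec_def)
      then show ?thesis using J.one_imp_carrier by blast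
    qed (use J in blast)
  qed
  then show ?thesis by (rule maximalideal.quotient_is_field) (rule cring_poly_ring_rec)
qed

lemma carrier_FQ: "carrier FQ = residue_class ` polys_below (degree Q)"
proof -
  have "carrier FQ = residue_class ` UNIV"
    by (auto simp: FactRing_def A_RCOSETS_def' poly_ring_rec_def)
  also have "\<dots> = residue_class ` polys_below (degree Q)"
  proof -
    have "residue_class A = residue_class (A mod Q)" for A
      by (subst residue_class_cong) (simp add: cong_def)
    then show ?thesis using mod_in_polys_below[OF Q_nonzero] by blast
  qed
  finally show ?thesis .
qed

lemma finite_FQ: "finite (carrier FQ)" by (simp add: carrier_FQ)

lemma card_FQ: "card (carrier FQ) = CARD('a) ^ degree Q"
proof -
  have "inj_on residue_class (polys_below (degree Q))"
    by (intro inj_onI) (simp add: residue_class_cong cong_polys_below)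
  then show ?thesis by (simp add: carrier_FQ card_image card_polys_below)
qed

lemma poly_phi_eq: "poly_phi Q = \<phi>"
proof -
  interpret F: field FQ by (rule field_FQ)
  have "Units FQ = carrier FQ - {\<zero>\<^bsub>FQ\<^esub>}" by (rule F.field_Units)
  then show ?thesis unfolding poly_phi_def using finite_FQ card_FQ by (simp add: \<phi>_def)
qed

lemma residue_class_mult: "residue_class A \<otimes>\<^bsub>FQ\<^esub> residue_class B = residue_class (A * B)"
proof -
  interpret cring R by (rule cring_poly_ring_rec)
  have "ideal (PIdl\<^bsub>R\<^esub> Q) R" by (rule cgenideal_ideal) (simp add: poly_ring_rec_def)
  then show ?thesis
    using ideal.rcoset_mult_add[of "PIdl\<^bsub>R\<^esub> Q" R A B] by (simp add: FactRing_def poly_ring_rec_def)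
qed

lemma residue_class_pow: "residue_class A [^]\<^bsub>mult_of FQ\<^esub> (i::nat) = residue_class (A ^ i)"
proof (induction i)
  case 0
  show ?case by (simp add: FactRing_def poly_ring_rec_def)
next
  case (Suc i)
  then show ?case by (simp add: residue_class_mult mult.commute)
qed

text \<open>
  The residue ring is a finite field, so its unit group is cyclic; a generator reduces characters
  to roots of unity.
\<close>

lemma ex_generator: "\<exists>G. \<not> Q dvd G \<and> (\<forall>A. \<not> Q dvd A \<longrightarrow> (\<exists>i::nat. [A = G ^ i] (mod Q)))"
proof -
  interpret F: field FQ by (rule field_FQ)
  have zero: "\<zero>\<^bsub>FQ\<^esub> = residue_class 0"
    unfolding residue_class_eq by (auto simp: FactRing_def principal_ideal_eq cong_iff_dvd_diff_poly)
  obtain g where g: "g \<in> carrier (mult_of FQ)"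
      "carrier (mult_of FQ) = {g [^]\<^bsub>mult_of FQ\<^esub> i | i::nat. i \<in> UNIV}"
    using F.finite_field_mult_group_has_gen[OF finite_FQ] by (auto simp: nat_pow_mult_of)
  from g(1) obtain G where G: "g = residue_class G" "g \<noteq> residue_class 0"
    by (auto simp: carrier_FQ zero)
  have "\<not> Q dvd G" using G by (simp add: residue_class_cong cong_iff_dvd_diff_poly)
  moreover have "\<exists>i::nat. [A = G ^ i] (mod Q)" if A: "\<not> Q dvd A" for A
  proof -
    have "A mod Q \<in> polys_below (degree Q)" by (rule mod_in_polys_below[OF Q_nonzero])
    moreover have "residue_class A = residue_class (A mod Q)"
      by (subst residue_class_cong) (simp add: cong_def)
    ultimately have "residue_class A \<in> carrier FQ" by (auto simp: carrier_FQ)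
    moreover have "residue_class A \<noteq> residue_class 0"
      using A by (simp add: residue_class_cong cong_iff_dvd_diff_poly)
    ultimately have "residue_class A \<in> carrier (mult_of FQ)" by (simp add: zero)
    then show ?thesis unfolding g(2) G(1)
      by (auto simp: residue_class_pow residue_class_cong)
  qed
  ultimately show ?thesis by blast
qed

lemma fermat_poly:
  assumes A: "\<not> Q dvd A"
  shows "[A ^ \<phi> = 1] (mod Q)"
proof -
  define U where "U = polys_below (degree Q) - {0::'a poly}"
  have U: "finite U" "card U = \<phi>"
    by (auto simp: U_def card_polys_below \<phi>_def polys_below_iff)
  have nd: "\<not> Q dvd B" if "B \<in> U" for B using that not_dvd_polys_below by (auto simp: U_def)
  define f where "f B = (A * B) mod Q" for B
  have inj: "inj_on f U"
    by (intro inj_onI) (metis A cong_def cong_mult_cancel_poly cong_polys_below f_def DiffD1 U_def)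
  have "f B \<in> U" if "B \<in> U" for B
    using nd[OF that] A mod_in_polys_below[OF Q_nonzero]
    by (auto simp: f_def U_def mod_eq_0_iff_dvd prime_dvd_mult_poly[OF prime])
  then have bij: "f ` U = U" using inj U by (intro endo_inj_surj) auto
  have "[(\<Prod>B\<in>U. A * B) = (\<Prod>B\<in>U. f B)] (mod Q)"
    by (rule cong_prod) (simp add: f_def cong_def)
  also have "(\<Prod>B\<in>U. f B) = \<Prod>(f ` U)" by (simp add: prod.reindex[OF inj])
  also have "\<dots> = \<Prod>U" by (simp add: bij)
  finally have "[\<Prod>U * A ^ \<phi> = \<Prod>U * 1] (mod Q)" by (simp add: prod.distrib U mult.commute)
  moreover have "\<not> Q dvd \<Prod>U"
  proof -
    have "finite V \<Longrightarrow> (\<And>B. B \<in> V \<Longrightarrow> \<not> Q dvd B) \<Longrightarrow> \<not> Q dvd \<Prod>V" for V :: "'a poly set"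
      by (induction V rule: finite_induct) (auto simp: prime_dvd_mult_poly[OF prime] not_dvd_1)
    then show ?thesis using U nd by blast
  qed
  ultimately show ?thesis by (rule cong_mult_cancel_poly)
qed

lemma fermat_power_mod:
  assumes "\<not> Q dvd A"
  shows "[A ^ i = A ^ (i mod \<phi>)] (mod Q)"
proof -
  have "[(A ^ \<phi>) ^ (i div \<phi>) * A ^ (i mod \<phi>) = 1 ^ (i div \<phi>) * A ^ (i mod \<phi>)] (mod Q)"
    by (intro cong_mult cong_pow fermat_poly assms) simp
  also have "(A ^ \<phi>) ^ (i div \<phi>) * A ^ (i mod \<phi>) = A ^ i"
    by (simp flip: power_mult power_add)
  finally show ?thesis by simp
qed

definition gen :: "'a poly" where
  "gen = (SOME G. \<not> Q dvd G \<and> (\<forall>A. \<not> Q dvd A \<longrightarrow> (\<exists>i::nat. [A = G ^ i] (mod Q))))"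

lemma gen: "\<not> Q dvd gen" "\<not> Q dvd A \<Longrightarrow> \<exists>i::nat. [A = gen ^ i] (mod Q)"
  using someI_ex[OF ex_generator] unfolding gen_def by blast+

lemma gen_power_cong_iff: "[gen ^ i = gen ^ j] (mod Q) \<longleftrightarrow> i mod \<phi> = j mod \<phi>"
proof
  assume "i mod \<phi> = j mod \<phi>"
  then show "[gen ^ i = gen ^ j] (mod Q)"
    using fermat_power_mod[OF gen(1), of i] fermat_power_mod[OF gen(1), of j]
    by (metis cong_sym cong_trans)
next
  define U where "U = polys_below (degree Q) - {0::'a poly}"
  have U: "finite U" "card U = \<phi>"
    by (auto simp: U_def card_polys_below \<phi>_def polys_below_iff)
  have "U \<subseteq> (\<lambda>i. gen ^ i mod Q) ` {..<\<phi>}"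
  proof
    fix A assume A: "A \<in> U"
    then obtain k where "[A = gen ^ k] (mod Q)"
      using gen(2)[of A] not_dvd_polys_below by (auto simp: U_def)
    then have "[A = gen ^ (k mod \<phi>)] (mod Q)" using fermat_power_mod[OF gen(1)] cong_trans by blast
    moreover have "k mod \<phi> < \<phi>" using phi_pos by simp
    ultimately show "A \<in> (\<lambda>i. gen ^ i mod Q) ` {..<\<phi>}"
      using A by (auto simp: cong_def U_def mod_polys_below_id)
  qed
  then have "card U \<le> card ((\<lambda>i. gen ^ i mod Q) ` {..<\<phi>})" by (intro card_mono) auto
  moreover have "card ((\<lambda>i. gen ^ i mod Q) ` {..<\<phi>}) \<le> card {..<\<phi>}" by (rule card_image_le) simp
  ultimately have "card ((\<lambda>i. gen ^ i mod Q) ` {..<\<phi>}) = card {..<\<phi>}" using U by simp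
  then have inj: "inj_on (\<lambda>i. gen ^ i mod Q) {..<\<phi>}" by (intro eq_card_imp_inj_on) auto
  assume "[gen ^ i = gen ^ j] (mod Q)"
  then have "[gen ^ (i mod \<phi>) = gen ^ (j mod \<phi>)] (mod Q)"
    using fermat_power_mod[OF gen(1), of i] fermat_power_mod[OF gen(1), of j]
    by (meson cong_sym cong_trans)
  then show "i mod \<phi> = j mod \<phi>"
    using inj phi_pos by (auto simp: inj_on_def cong_def)
qed

definition ind :: "'a poly \<Rightarrow> nat" where "ind A = (SOME i. [A = gen ^ i] (mod Q))"

lemma ind: "\<not> Q dvd A \<Longrightarrow> [A = gen ^ ind A] (mod Q)"
  unfolding ind_def by (rule someI_ex) (rule gen(2))

lemma char_zero_iff: "\<psi> \<in> chars \<Longrightarrow> \<psi> A = 0 \<longleftrightarrow> Q dvd A"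
  by (auto simp: dirichlet_character_def coprime_prime_iff[OF prime])

lemma char_cong: "\<psi> \<in> chars \<Longrightarrow> [A = B] (mod Q) \<Longrightarrow> \<psi> A = \<psi> B"
  by (auto simp: dirichlet_character_def)

lemma char_mult: "\<psi> \<in> chars \<Longrightarrow> \<psi> (A * B) = \<psi> A * \<psi> B"
  by (auto simp: dirichlet_character_def)

lemma char_1 [simp]: "\<psi> \<in> chars \<Longrightarrow> \<psi> 1 = 1"
  using char_mult[of \<psi> 1 1] char_zero_iff[of \<psi> 1] not_dvd_1 by auto

lemma char_0 [simp]: "\<psi> \<in> chars \<Longrightarrow> \<psi> 0 = 0"
  by (simp add: char_zero_iff)

lemma char_power: "\<psi> \<in> chars \<Longrightarrow> \<psi> (A ^ i) = \<psi> A ^ i"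
  by (induction i) (auto simp: char_mult)

lemma char_mod: "\<psi> \<in> chars \<Longrightarrow> \<psi> (A mod Q) = \<psi> A"
  by (rule char_cong) (auto simp: cong_def)

lemma char_root_of_unity: "\<psi> \<in> chars \<Longrightarrow> \<not> Q dvd A \<Longrightarrow> \<psi> A ^ \<phi> = 1"
  using char_cong[of \<psi> "A ^ \<phi>" 1] fermat_poly[of A] by (simp add: char_power)

lemma norm_char: "\<psi> \<in> chars \<Longrightarrow> \<not> Q dvd A \<Longrightarrow> norm (\<psi> A) = 1"
proof -
  assume "\<psi> \<in> chars" "\<not> Q dvd A"
  then have "norm (\<psi> A) ^ \<phi> = 1"
    using char_root_of_unity[of \<psi> A] by (simp flip: norm_power)
  then show ?thesis using phi_pos power_eq_1_iff[of "norm (\<psi> A)" \<phi>] by simp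
qed

lemma char_mult_cnj: "\<psi> \<in> chars \<Longrightarrow> \<not> Q dvd A \<Longrightarrow> \<psi> A * cnj (\<psi> A) = 1"
  by (simp add: complex_norm_square[symmetric] norm_char)

lemma trivial_in_chars: "trivial_character Q \<in> chars"
  unfolding dirichlet_character_def trivial_character_def mem_Collect_eq
  by (auto simp: coprime_prime_iff[OF prime] prime_dvd_mult_poly[OF prime] cong_dvd_iff')

text \<open>
  A character is determined by its value at the generator, and the discrete logarithm \<open>ind\<close> turns every
  \<open>\<phi>\<close>-th root of unity into a character. This counts the characters.
\<close>

lemma bij_chars_roots: "bij_betw (\<lambda>\<psi>. \<psi> gen) chars {z::complex. z ^ \<phi> = 1}"
  unfolding bij_betw_def
proof
  show "inj_on (\<lambda>\<psi>. \<psi> gen) chars"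
  proof (rule inj_onI, rule ext)
    fix \<psi> \<theta> A assume *: "\<psi> \<in> chars" "\<theta> \<in> chars" "\<psi> gen = \<theta> gen"
    show "\<psi> A = \<theta> A"
    proof (cases "Q dvd A")
      case False
      then have "\<psi> A = \<psi> (gen ^ ind A)" "\<theta> A = \<theta> (gen ^ ind A)"
        using char_cong[OF *(1) ind[OF False]] char_cong[OF *(2) ind[OF False]] by simp_all
      then show ?thesis using * by (simp add: char_power)
    qed (simp add: char_zero_iff[OF *(1), THEN iffD2] char_zero_iff[OF *(2), THEN iffD2])
  qed
  show "(\<lambda>\<psi>. \<psi> gen) ` chars = {z. z ^ \<phi> = 1}"
  proof (intro equalityI subsetI)
    fix z assume "z \<in> (\<lambda>\<psi>. \<psi> gen) ` chars"
    then show "z \<in> {z. z ^ \<phi> = 1}" using char_root_of_unity gen(1) by auto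
  next
    fix z :: complex assume z: "z \<in> {z. z ^ \<phi> = 1}"
    have zmod: "z ^ i = z ^ (i mod \<phi>)" for i
    proof -
      have "z ^ i = (z ^ \<phi>) ^ (i div \<phi>) * z ^ (i mod \<phi>)" by (simp flip: power_mult power_add)
      then show ?thesis using z by simp
    qed
    define \<psi> where "\<psi> A = (if Q dvd A then 0 else z ^ ind A)" for A
    have z0: "z \<noteq> 0" using z phi_pos by (auto simp: power_0_left split: if_splits)
    have val: "\<psi> A = z ^ i" if "[A = gen ^ i] (mod Q)" for A i
    proof -
      have nd: "\<not> Q dvd A" using that not_dvd_power[OF gen(1)] cong_dvd_iff' by blast
      then have "[gen ^ ind A = gen ^ i] (mod Q)" using ind that by (meson cong_sym cong_trans)
      then have "ind A mod \<phi> = i mod \<phi>" by (simp only: gen_power_cong_iff)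
      then show ?thesis using nd zmod by (metis \<psi>_def)
    qed
    have "dirichlet_character Q \<psi>"
      unfolding dirichlet_character_def
    proof (intro conjI allI impI)
      fix A B assume AB: "[A = B] (mod Q)"
      show "\<psi> A = \<psi> B"
      proof (cases "Q dvd A")
        case False
        then have "[A = gen ^ ind A] (mod Q)" by (rule ind)
        moreover from this have "[B = gen ^ ind A] (mod Q)" using AB cong_sym cong_trans by blast
        ultimately show ?thesis using val by simp
      qed (use cong_dvd_iff'[OF AB] in \<open>simp add: \<psi>_def\<close>)
    next
      fix A B
      show "\<psi> (A * B) = \<psi> A * \<psi> B"
      proof (cases "Q dvd A \<or> Q dvd B")
        case False
        then have "[A * B = gen ^ ind A * gen ^ ind B] (mod Q)" by (intro cong_mult ind) auto
        then have "\<psi> (A * B) = z ^ (ind A + ind B)" by (intro val) (simp add: power_add)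
        then show ?thesis using False by (simp add: \<psi>_def power_add)
      qed (auto simp: \<psi>_def prime_dvd_mult_poly[OF prime])
    next
      fix A show "(\<psi> A = 0) = (\<not> coprime A Q)"
        using z0 by (auto simp: \<psi>_def coprime_prime_iff[OF prime])
    qed
    moreover have "\<psi> gen = z" using val[of gen 1] by simp
    ultimately show "z \<in> (\<lambda>\<psi>. \<psi> gen) ` chars" by auto
  qed
qed

lemma finite_chars [simp]: "finite chars"
  using bij_betw_finite[OF bij_chars_roots] finite_roots_unity[of \<phi>] phi_pos by simp

lemma card_chars: "card chars = \<phi>"
  using bij_betw_same_card[OF bij_chars_roots] card_roots_unity_eq[OF phi_pos] by simp

text \<open>
  If \<open>A\<close> is a nontrivial unit, the values \<open>\<psi> A\<close> are the powers \<open>z ^ ind A\<close> of all \<open>\<phi>\<close>-th roots of unity \<open>z\<close>,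
  and \<open>\<phi>\<close> does not divide \<open>ind A\<close>. Multiplying every \<open>z\<close> by a primitive root \<open>w\<close> permutes the terms and multiplies the
  sum by \<open>w ^ ind A \<noteq> 1\<close>.
\<close>

lemma sum_chars:
  "(\<Sum>\<psi>\<in>chars. \<psi> A) = (if [A = 1] (mod Q) then of_nat \<phi> else 0)"
proof (cases "Q dvd A")
  case True
  then have "\<not> [A = 1] (mod Q)" using cong_dvd_iff' not_dvd_1 by blast
  moreover have "(\<Sum>\<psi>\<in>chars. \<psi> A) = 0"
    by (rule sum.neutral) (simp add: char_zero_iff True)
  ultimately show ?thesis by simp
next
  case False
  show ?thesis
  proof (cases "[A = 1] (mod Q)")
    case True
    then have "(\<Sum>\<psi>\<in>chars. \<psi> A) = (\<Sum>\<psi>\<in>chars. 1)"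
      by (intro sum.cong refl) (metis char_cong char_1)
    then show ?thesis using True by (simp add: card_chars)
  next
    case A1: False
    have "ind A mod \<phi> \<noteq> 0"
    proof
      assume "ind A mod \<phi> = 0"
      then have "[gen ^ ind A = gen ^ 0] (mod Q)" by (simp only: gen_power_cong_iff mod_0)
      then show False using ind[OF False] A1 cong_trans[of A "gen ^ ind A" Q 1] by simp
    qed
    define w where "w = cis (2 * pi / real \<phi>)"
    have w: "w ^ \<phi> = 1" using phi_pos by (simp add: w_def Complex.DeMoivre)
    have wi: "w ^ ind A \<noteq> 1"
    proof
      assume h: "w ^ ind A = 1"
      have "w ^ ind A = (w ^ \<phi>) ^ (ind A div \<phi>) * w ^ (ind A mod \<phi>)"
        by (simp flip: power_mult power_add)
      with h w have h': "w ^ (ind A mod \<phi>) = 1" by simp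
      have "inj_on (\<lambda>k. cis (2 * pi * real k / real \<phi>)) {..<\<phi>}"
        using Complex.bij_betw_roots_unity[OF phi_pos] by (simp add: bij_betw_def)
      moreover have "cis (2 * pi * real (ind A mod \<phi>) / real \<phi>) = cis (2 * pi * real 0 / real \<phi>)"
        using h' by (simp add: w_def Complex.DeMoivre mult_ac)
      moreover have "ind A mod \<phi> < \<phi>" "0 < \<phi>" using phi_pos by auto
      ultimately have "ind A mod \<phi> = 0" unfolding inj_on_def by blast
      then show False using \<open>ind A mod \<phi> \<noteq> 0\<close> by simp
    qed
    have fin: "finite {z::complex. z ^ \<phi> = 1}" using finite_roots_unity[of \<phi>] phi_pos by simp
    have "(\<Sum>\<psi>\<in>chars. \<psi> A) = (\<Sum>\<psi>\<in>chars. (\<psi> gen) ^ ind A)"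
      using char_cong[OF _ ind[OF False]] by (intro sum.cong refl) (simp add: char_power)
    also have "\<dots> = (\<Sum>z | z ^ \<phi> = 1. z ^ ind A)"
      by (rule sum.reindex_bij_betw[OF bij_chars_roots, of "\<lambda>z. z ^ ind A"])
    finally have S: "(\<Sum>\<psi>\<in>chars. \<psi> A) = (\<Sum>z | z ^ \<phi> = 1. z ^ ind A)" .
    have w0: "w \<noteq> 0" by (simp add: w_def)
    have "(\<Sum>z | z ^ \<phi> = 1. z ^ ind A) = (\<Sum>z | z ^ \<phi> = 1. (w * z) ^ ind A)"
      by (rule sum.reindex_bij_witness[of _ "\<lambda>z. w * z" "\<lambda>z. z / w"])
         (use w w0 in \<open>auto simp: power_mult_distrib power_divide\<close>)
    also have "\<dots> = w ^ ind A * (\<Sum>z | z ^ \<phi> = 1. z ^ ind A)"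
      by (simp add: power_mult_distrib sum_distrib_left)
    finally have "(\<Sum>z::complex | z ^ \<phi> = 1. z ^ ind A) = 0" using wi by simp
    then show ?thesis using S A1 by simp
  qed
qed

lemma sum_chars_cnj:
  assumes B: "\<not> Q dvd B"
  shows "(\<Sum>\<psi>\<in>chars. \<psi> A * cnj (\<psi> B)) = (if [A = B] (mod Q) then of_nat \<phi> else 0)"
proof -
  obtain C where C: "[B * C = 1] (mod Q)" using ex_inverse_mod[OF B] by blast
  have "cnj (\<psi> B) = \<psi> C" if "\<psi> \<in> chars" for \<psi>
  proof -
    have "\<psi> B * \<psi> C = \<psi> B * cnj (\<psi> B)"
      using char_cong[OF that C] that B by (simp add: char_mult char_mult_cnj)
    moreover have "\<psi> B \<noteq> 0" using that B char_zero_iff by blast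
    ultimately show ?thesis by simp
  qed
  then have "(\<Sum>\<psi>\<in>chars. \<psi> A * cnj (\<psi> B)) = (\<Sum>\<psi>\<in>chars. \<psi> (A * C))"
    by (intro sum.cong refl) (simp add: char_mult)
  also have "\<dots> = (if [A * C = 1] (mod Q) then of_nat \<phi> else 0)" by (rule sum_chars)
  also have "[A * C = 1] (mod Q) \<longleftrightarrow> [A = B] (mod Q)"
  proof
    assume "[A = B] (mod Q)"
    then have "[A * C = B * C] (mod Q)" by (simp add: cong_mult)
    then show "[A * C = 1] (mod Q)" using C cong_trans by blast
  next
    assume "[A * C = 1] (mod Q)"
    then have "[C * A = C * B] (mod Q)" using C by (metis cong_sym cong_trans mult.commute)
    moreover have "\<not> Q dvd C"
      using C not_dvd_1 cong_dvd_iff'[OF C] by (auto simp: prime_dvd_mult_poly[OF prime])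
    ultimately show "[A = B] (mod Q)" by (rule cong_mult_cancel_poly)
  qed
  finally show ?thesis .
qed

lemma nontrivial_char_ex:
  assumes "\<psi> \<in> chars" "\<psi> \<noteq> trivial_character Q"
  obtains C where "\<not> Q dvd C" "\<psi> C \<noteq> 1"
proof -
  have "\<exists>C. \<not> Q dvd C \<and> \<psi> C \<noteq> 1"
  proof (rule ccontr)
    assume "\<not> ?thesis"
    then have "\<psi> = trivial_character Q"
      using assms(1) by (auto simp: fun_eq_iff trivial_character_def coprime_prime_iff[OF prime] char_zero_iff)
    then show False using assms(2) by simp
  qed
  then show ?thesis using that by blast
qed

end


section \<open>Functional equations\<close>

lemma sum_polys_below_Suc:
  fixes f :: "'a::finite_field poly \<Rightarrow> 'b::comm_monoid_add"
  shows "(\<Sum>B\<in>polys_below (Suc j). f B) =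
    (\<Sum>B\<in>polys_below j. f B) + (\<Sum>c\<in>UNIV - {0}. \<Sum>B\<in>monics j. f (smult c B))"
proof -
  have eq: "(polys_below (Suc j) :: 'a poly set) = polys_below j \<union> (\<lambda>(c, B). smult c B) ` ((UNIV - {0}) \<times> monics j)"
    (is "?L = ?M \<union> ?N")
  proof (intro equalityI subsetI)
    fix A :: "'a poly" assume A: "A \<in> ?L"
    show "A \<in> ?M \<union> ?N"
    proof (cases "A \<in> ?M")
      case False
      with A have d: "A \<noteq> 0" "degree A = j" by (auto simp: polys_below_iff)
      have lc: "lead_coeff A \<noteq> 0" using d(1) by simp
      have "A = smult (lead_coeff A) (smult (inverse (lead_coeff A)) A)"
        using lc by simp
      moreover have "smult (inverse (lead_coeff A)) A \<in> monics j"
        using d lc by (simp add: monics_def monic_def)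
      moreover have "lead_coeff A \<in> UNIV - {0}" using lc by simp
      ultimately show ?thesis by (metis (no_types, lifting) SigmaI UnI2 case_prod_conv image_eqI)
    qed simp
  next
    fix A :: "'a poly" assume "A \<in> ?M \<union> ?N"
    then consider "A \<in> ?M" | c B where "A = smult c B" "c \<noteq> 0" "B \<in> monics j" by auto
    then show "A \<in> ?L"
    proof cases
      case 1
      then show ?thesis using polys_below_mono[of j "Suc j"] by auto
    next
      case (2 c B)
      then have "degree A = j" by (simp add: monics_def)
      then show ?thesis by (simp add: polys_below_iff)
    qed
  qed
  have disj: "?M \<inter> ?N = {}"
  proof -
    have "A \<notin> ?M" if "A \<in> ?N" for A
    proof -
      from that obtain c B where B: "A = smult c B" "c \<noteq> 0" "B \<in> monics j" by auto
      then have "degree A = j" "A \<noteq> 0" using monics_nonzero[OF B(3)] by (simp_all add: monics_def)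
      then show ?thesis by (simp add: polys_below_iff)
    qed
    then show ?thesis by blast
  qed
  have inj: "inj_on (\<lambda>(c, B). smult c B) ((UNIV - {0}) \<times> (monics j :: 'a poly set))"
  proof (rule inj_onI)
    fix x y :: "'a \<times> 'a poly"
    assume *: "x \<in> (UNIV - {0}) \<times> monics j" "y \<in> (UNIV - {0}) \<times> monics j"
      "(\<lambda>(c, B). smult c B) x = (\<lambda>(c, B). smult c B) y"
    obtain c A d B where xy: "x = (c, A)" "y = (d, B)" by (cases x, cases y) auto
    have "coeff A j = 1" "coeff B j = 1" "c \<noteq> 0" using * xy by (auto simp: monics_def monic_def)
    moreover have eq: "smult c A = smult d B" using * xy by simp
    then have "coeff (smult c A) j = coeff (smult d B) j" by (simp only:)
    ultimately have "c = d" by simp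
    then show "x = y" using xy eq \<open>c \<noteq> 0\<close> smult_cancel[of c A B] by blast
  qed
  have "(\<Sum>B\<in>?L. f B) = (\<Sum>B\<in>?M. f B) + (\<Sum>B\<in>?N. f B)"
    unfolding eq by (rule sum.union_disjoint) (use disj in auto)
  also have "(\<Sum>B\<in>?N. f B) = (\<Sum>(c, B)\<in>(UNIV - {0}) \<times> monics j. f (smult c B))"
    by (subst sum.reindex[OF inj]) (simp add: case_prod_unfold)
  finally show ?thesis by (simp add: sum.cartesian_product)
qed

text \<open>
  The linear form \<open>l\<close> is not zero on \<open>polys_below k\<close>, so translations by multiples of \<open>A0\<close> show that it takes
  every value equally often.
\<close>

lemma sum_equidistributed:
  fixes \<kappa> :: "'a::finite_field \<Rightarrow> complex" and l :: "'a poly \<Rightarrow> 'a"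
  assumes add: "\<And>A B. l (A + B) = l A + l B" and smult: "\<And>c A. l (smult c A) = c * l A"
    and A0: "A0 \<in> polys_below k" "l A0 \<noteq> 0" and \<kappa>: "(\<Sum>x\<in>UNIV. \<kappa> x) = 0"
  shows "(\<Sum>A\<in>polys_below k. \<kappa> (c + l A)) = 0"
proof -
  have shift: "(\<Sum>A\<in>polys_below k. \<kappa> (c + l A)) = (\<Sum>A\<in>polys_below k. \<kappa> ((c + l A) + x))" for x
  proof -
    define A1 where "A1 = smult (x / l A0) A0"
    have A1: "A1 \<in> polys_below k" "l A1 = x"
      using A0 by (simp_all add: A1_def polys_below_smult smult)
    have lA1: "(c + l (A - A1)) + x = c + l A" for A
      using add[of "A - A1" A1] A1(2) by (simp add: add.assoc)
    show ?thesis
      by (rule sum.reindex_bij_witness[of _ "\<lambda>A. A + A1" "\<lambda>A. A - A1"])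
         (use A1(1) in \<open>simp_all add: lA1 polys_below_add polys_below_diff\<close>)
  qed
  have "of_nat CARD('a) * (\<Sum>A\<in>polys_below k. \<kappa> (c + l A)) =
      (\<Sum>x\<in>(UNIV::'a set). \<Sum>A\<in>polys_below k. \<kappa> ((c + l A) + x))"
    by (simp flip: shift)
  also have "\<dots> = (\<Sum>A\<in>polys_below k. \<Sum>x\<in>UNIV. \<kappa> ((c + l A) + x))" by (rule sum.swap)
  also have "\<dots> = (\<Sum>A\<in>(polys_below k :: 'a poly set). \<Sum>x\<in>UNIV. \<kappa> x)"
  proof (rule sum.cong[OF refl])
    fix A
    show "(\<Sum>x\<in>UNIV. \<kappa> ((c + l A) + x)) = (\<Sum>x\<in>UNIV. \<kappa> x)"
      by (rule sum.reindex_bij_witness[of _ "\<lambda>x. x - (c + l A)" "\<lambda>x. (c + l A) + x"]) auto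
  qed
  finally show ?thesis using \<kappa> by simp
qed

definition charsum :: "('a::finite_field poly \<Rightarrow> complex) \<Rightarrow> nat \<Rightarrow> complex" where
  "charsum \<psi> k = (\<Sum>A\<in>monics k. \<psi> A)"

context prime_modulus begin

text \<open>
  This bilinear form plays the role of the residue pairing behind additive characters modulo \<open>Q\<close>.
  Its key property is that the polynomials of degree below \<open>k\<close> and those of degree below \<open>degree Q - k\<close>
  are orthogonal complements; this is what reflects degrees in the functional equation.
\<close>

definition pair :: "'a poly \<Rightarrow> 'a poly \<Rightarrow> 'a" where
  "pair A B = coeff ((A * B) mod Q) (degree Q - 1)"

lemma pair_add_left: "pair (A + A') B = pair A B + pair A' B"
  by (simp add: pair_def distrib_right poly_mod_add_left)

lemma pair_smult_left: "pair (smult c A) B = c * pair A B"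
  by (simp add: pair_def mod_smult_left)

lemma pair_orthogonal:
  assumes "A \<in> polys_below k" "B \<in> polys_below (degree Q - k)" "k \<le> degree Q"
  shows "pair A B = 0"
proof (cases "A = 0 \<or> B = 0")
  case False
  then have "degree (A * B) < degree Q - 1" "degree (A * B) < degree Q"
    using assms by (auto simp: polys_below_iff degree_mult_eq)
  then show ?thesis unfolding pair_def by (simp add: mod_poly_less coeff_eq_0)
qed (auto simp: pair_def)

lemma pair_nondegenerate:
  assumes B: "B \<in> polys_below (degree Q)" "B \<notin> polys_below (degree Q - k)"
  shows "\<exists>A\<in>polys_below k. pair A B \<noteq> 0"
proof -
  have d: "B \<noteq> 0" "degree B < degree Q" "degree B \<ge> degree Q - k"
    using B by (auto simp: polys_below_iff)
  define A where "A = monom (1::'a) (degree Q - 1 - degree B)"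
  have A0: "A \<noteq> 0" by (simp add: A_def monom_eq_0_iff)
  have dA: "degree A = degree Q - 1 - degree B" by (simp add: A_def degree_monom_eq)
  have "degree (A * B) = degree Q - 1" using A0 d dA by (simp add: degree_mult_eq)
  moreover have "lead_coeff A = 1" unfolding dA by (simp add: A_def)
  then have "lead_coeff (A * B) = lead_coeff B" by (simp add: lead_coeff_mult)
  ultimately have "pair A B = lead_coeff B"
    using deg_pos by (simp add: pair_def mod_poly_less)
  moreover have "A \<in> polys_below k" using d dA by (auto simp: polys_below_iff)
  ultimately show ?thesis using d by (intro bexI[of _ A]) auto
qed

lemma pair_monom:
  assumes B: "B \<in> polys_below (degree Q - k)" and k: "k < degree Q"
  shows "pair (monom 1 k) B = coeff B (degree Q - 1 - k)"
proof -
  have "monom 1 k * B \<in> polys_below (degree Q)"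
    using B k by (auto simp: polys_below_def coeff_monom_mult)
  then show ?thesis using k by (simp add: pair_def mod_polys_below_id coeff_monom_mult)
qed

text \<open>
  In place of an additive character any function \<open>\<kappa>\<close> with sum zero on the field may be used. Choosing \<open>\<kappa>\<close> to
  match the restriction of \<open>\<psi>\<close> to constants gives the functional equations without additional averaging.
\<close>

definition gauss :: "('a poly \<Rightarrow> complex) \<Rightarrow> ('a \<Rightarrow> complex) \<Rightarrow> 'a poly \<Rightarrow> complex" where
  "gauss \<psi> \<kappa> A = (\<Sum>B\<in>polys_below (degree Q). cnj (\<psi> B) * \<kappa> (pair A B))"

lemma sum_residues_mult:
  assumes "\<not> Q dvd A"
  shows "(\<Sum>B\<in>polys_below (degree Q). f ((A * B) mod Q)) = (\<Sum>B\<in>polys_below (degree Q). f B)"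
proof (rule sum.reindex_bij_betw)
  have inj: "inj_on (\<lambda>B. (A * B) mod Q) (polys_below (degree Q))"
    by (intro inj_onI) (metis assms cong_def cong_mult_cancel_poly cong_polys_below)
  moreover have "(\<lambda>B. (A * B) mod Q) ` polys_below (degree Q) = polys_below (degree Q)"
    using inj mod_in_polys_below[OF Q_nonzero] by (intro endo_inj_surj) auto
  ultimately show "bij_betw (\<lambda>B. (A * B) mod Q) (polys_below (degree Q)) (polys_below (degree Q))"
    by (simp add: bij_betw_def)
qed

lemma sum_char_residues:
  assumes "\<psi> \<in> chars" "\<psi> \<noteq> trivial_character Q"
  shows "(\<Sum>B\<in>polys_below (degree Q). \<psi> B) = 0"
proof -
  obtain C where C: "\<not> Q dvd C" "\<psi> C \<noteq> 1" using nontrivial_char_ex[OF assms] .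
  have "(\<Sum>B\<in>polys_below (degree Q). \<psi> B) = (\<Sum>B\<in>polys_below (degree Q). \<psi> ((C * B) mod Q))"
    by (rule sum_residues_mult[OF C(1), symmetric])
  also have "\<dots> = \<psi> C * (\<Sum>B\<in>polys_below (degree Q). \<psi> B)"
    using assms(1) by (simp add: char_mod char_mult sum_distrib_left)
  finally show ?thesis using C by simp
qed

text \<open>
  For \<open>A\<close> prime to \<open>Q\<close> substitute \<open>AB\<close> for \<open>B\<close>; for \<open>Q dvd A\<close> the pairing vanishes and the sum of a nontrivial
  character over all residues is zero.
\<close>

lemma gauss_twist:
  assumes \<psi>: "\<psi> \<in> chars" "\<psi> \<noteq> trivial_character Q"
  shows "gauss \<psi> \<kappa> A = \<psi> A * gauss \<psi> \<kappa> 1"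
proof (cases "Q dvd A")
  case True
  then have "pair A B = 0" for B by (simp add: pair_def mod_eq_0_iff_dvd[THEN iffD2])
  then have "gauss \<psi> \<kappa> A = cnj (\<Sum>B\<in>polys_below (degree Q). \<psi> B) * \<kappa> 0"
    by (simp add: gauss_def sum_distrib_right)
  also have "(\<Sum>B\<in>polys_below (degree Q). \<psi> B) = 0" by (rule sum_char_residues[OF \<psi>])
  finally show ?thesis using True \<psi> by (simp add: char_zero_iff[THEN iffD2])
next
  case False
  have "gauss \<psi> \<kappa> 1 = (\<Sum>B\<in>polys_below (degree Q). cnj (\<psi> ((A * B) mod Q)) * \<kappa> (pair 1 ((A * B) mod Q)))"
    unfolding gauss_def by (rule sum_residues_mult[OF False, symmetric])
  also have "\<dots> = cnj (\<psi> A) * gauss \<psi> \<kappa> A"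
    using \<psi> by (simp add: gauss_def char_mod char_mult sum_distrib_left pair_def mult_ac)
  finally show ?thesis using char_mult_cnj[OF \<psi>(1) False] by (simp flip: mult.assoc)
qed

text \<open>
  Sum \<open>gauss_twist\<close> over monic \<open>A\<close> of degree \<open>k\<close>. For fixed \<open>B\<close> the value \<open>pair A B\<close> is equidistributed, and \<open>\<kappa>\<close>
  cancels, unless \<open>B\<close> has degree below \<open>degree Q - k\<close>; then it is the constant top coefficient of \<open>B\<close>.
\<close>

lemma gauss_monics:
  assumes \<psi>: "\<psi> \<in> chars" "\<psi> \<noteq> trivial_character Q" and \<kappa>: "(\<Sum>x\<in>UNIV. \<kappa> x) = 0"
    and k: "k < degree Q"
  shows "charsum \<psi> k * gauss \<psi> \<kappa> 1 = of_nat (CARD('a) ^ k) *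
    (\<Sum>B\<in>polys_below (degree Q - k). cnj (\<psi> B) * \<kappa> (coeff B (degree Q - 1 - k)))"
proof -
  have inner: "(\<Sum>A\<in>monics k. \<kappa> (pair A B)) =
     (if B \<in> polys_below (degree Q - k) then of_nat (CARD('a) ^ k) * \<kappa> (coeff B (degree Q - 1 - k)) else 0)"
    if B: "B \<in> polys_below (degree Q)" for B
  proof -
    have eq: "(\<Sum>A\<in>monics k. \<kappa> (pair A B)) = (\<Sum>A\<in>polys_below k. \<kappa> (pair (monom 1 k) B + pair A B))"
      unfolding monics_eq_image by (subst sum.reindex) (auto simp: pair_add_left)
    show ?thesis
    proof (cases "B \<in> polys_below (degree Q - k)")
      case True
      then show ?thesis unfolding eq using k by (simp add: pair_orthogonal pair_monom card_polys_below)
    next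
      case False
      then obtain A0 where "A0 \<in> polys_below k" "pair A0 B \<noteq> 0" using pair_nondegenerate[OF B] by blast
      then have "(\<Sum>A\<in>polys_below k. \<kappa> (pair (monom 1 k) B + pair A B)) = 0"
        by (intro sum_equidistributed[where l = "\<lambda>A. pair A B"]) (auto simp: pair_add_left pair_smult_left \<kappa>)
      then show ?thesis using False eq by simp
    qed
  qed
  have "charsum \<psi> k * gauss \<psi> \<kappa> 1 = (\<Sum>A\<in>monics k. gauss \<psi> \<kappa> A)"
    unfolding charsum_def sum_distrib_right by (rule sum.cong[OF refl]) (rule gauss_twist[OF \<psi>, symmetric])
  also have "\<dots> = (\<Sum>B\<in>polys_below (degree Q). \<Sum>A\<in>monics k. cnj (\<psi> B) * \<kappa> (pair A B))"
    unfolding gauss_def by (rule sum.swap)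
  also have "\<dots> = (\<Sum>B\<in>polys_below (degree Q). if B \<in> polys_below (degree Q - k)
      then of_nat (CARD('a) ^ k) * (cnj (\<psi> B) * \<kappa> (coeff B (degree Q - 1 - k))) else 0)"
    by (rule sum.cong[OF refl]) (simp add: inner flip: sum_distrib_left)
  also have "\<dots> = (\<Sum>B\<in>polys_below (degree Q - k). of_nat (CARD('a) ^ k) * (cnj (\<psi> B) * \<kappa> (coeff B (degree Q - 1 - k))))"
    using polys_below_mono[of "degree Q - k" "degree Q"]
    by (intro sum.mono_neutral_cong_right) auto
  finally show ?thesis by (simp add: sum_distrib_left)
qed

text \<open>
  The same with \<open>A\<close> running over a whole vector space, where the remaining \<open>B\<close> pair to zero.
\<close>

lemma gauss_below:
  assumes \<psi>: "\<psi> \<in> chars" "\<psi> \<noteq> trivial_character Q" and \<kappa>: "(\<Sum>x\<in>UNIV. \<kappa> x) = 0"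
    and k: "k \<le> degree Q"
  shows "(\<Sum>A\<in>polys_below k. \<psi> A) * gauss \<psi> \<kappa> 1 = of_nat (CARD('a) ^ k) *
    \<kappa> 0 * cnj (\<Sum>B\<in>polys_below (degree Q - k). \<psi> B)"
proof -
  have inner: "(\<Sum>A\<in>polys_below k. \<kappa> (pair A B)) =
     (if B \<in> polys_below (degree Q - k) then of_nat (CARD('a) ^ k) * \<kappa> 0 else 0)"
    if B: "B \<in> polys_below (degree Q)" for B
  proof (cases "B \<in> polys_below (degree Q - k)")
    case True
    then show ?thesis using k by (simp add: pair_orthogonal card_polys_below)
  next
    case False
    then obtain A0 where "A0 \<in> polys_below k" "pair A0 B \<noteq> 0" using pair_nondegenerate[OF B] by blast
    then have "(\<Sum>A\<in>polys_below k. \<kappa> (0 + pair A B)) = 0"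
      by (intro sum_equidistributed[where l = "\<lambda>A. pair A B"]) (auto simp: pair_add_left pair_smult_left \<kappa>)
    then show ?thesis using False by simp
  qed
  have "(\<Sum>A\<in>polys_below k. \<psi> A) * gauss \<psi> \<kappa> 1 = (\<Sum>A\<in>polys_below k. gauss \<psi> \<kappa> A)"
    unfolding sum_distrib_right by (rule sum.cong[OF refl]) (rule gauss_twist[OF \<psi>, symmetric])
  also have "\<dots> = (\<Sum>B\<in>polys_below (degree Q). \<Sum>A\<in>polys_below k. cnj (\<psi> B) * \<kappa> (pair A B))"
    unfolding gauss_def by (rule sum.swap)
  also have "\<dots> = (\<Sum>B\<in>polys_below (degree Q). if B \<in> polys_below (degree Q - k)
      then of_nat (CARD('a) ^ k) * \<kappa> 0 * cnj (\<psi> B) else 0)"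
    by (rule sum.cong[OF refl]) (simp add: inner flip: sum_distrib_left)
  also have "\<dots> = (\<Sum>B\<in>polys_below (degree Q - k). of_nat (CARD('a) ^ k) * \<kappa> 0 * cnj (\<psi> B))"
    using polys_below_mono[of "degree Q - k" "degree Q"]
    by (intro sum.mono_neutral_cong_right) auto
  finally show ?thesis by (simp add: sum_distrib_left)
qed

lemma char_smult: "\<psi> \<in> chars \<Longrightarrow> \<psi> (smult c A) = \<psi> [:c:] * \<psi> A"
  using char_mult[of \<psi> "[:c:]" A] by simp

lemma not_dvd_const: "c \<noteq> 0 \<Longrightarrow> \<not> Q dvd [:c:]"
  using deg_pos by (intro not_dvd_polys_below) (auto simp: polys_below_iff)

lemma charsum_0 [simp]: "\<psi> \<in> chars \<Longrightarrow> charsum \<psi> 0 = 1"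
  by (simp add: charsum_def)

lemma div_in_monics:
  assumes A: "A \<in> monics k" and k: "k \<ge> degree Q"
  shows "A div Q \<in> monics (k - degree Q)"
proof -
  have div: "A div Q * Q + A mod Q = A" for A :: "'a poly" by simp
  have mQ: "Q \<in> monics (degree Q)" using prime by (auto simp: monics_def monic_prime_def)
  have dA: "degree A = k" "coeff A k = 1" using A by (auto simp: monics_def monic_def)
  have B: "A mod Q \<in> polys_below (degree Q)" by (rule mod_in_polys_below[OF Q_nonzero])
  have C0: "A div Q \<noteq> 0"
  proof
    assume "A div Q = 0"
    then have "A mod Q = A" using div[of A] by (metis add_0 mult_zero_left)
    then show False using B dA(1) k monics_nonzero[OF A] by (simp add: polys_below_iff)
  qed
  have degM: "degree (A div Q * Q) = degree (A div Q) + degree Q"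
    using C0 Q_nonzero by (simp add: degree_mult_eq)
  have lt: "A mod Q = 0 \<or> degree (A mod Q) < degree (A div Q * Q)"
    using B degM by (auto simp: polys_below_iff)
  have "degree A = degree (A div Q * Q) \<and> lead_coeff A = lead_coeff (A div Q * Q)"
    using lt
  proof
    assume "A mod Q = 0"
    then have "A div Q * Q = A" using div[of A] by (metis add_0_right)
    then show ?thesis by simp
  next
    assume lt: "degree (A mod Q) < degree (A div Q * Q)"
    have "degree A = degree (A div Q * Q)"
      using degree_add_eq_left[OF lt] unfolding div .
    moreover have "coeff A (degree (A div Q * Q)) = lead_coeff (A div Q * Q)"
      by (subst (1) div[of A, symmetric]) (simp only: coeff_add coeff_eq_0[OF lt] add_0_right)
    ultimately show ?thesis by simp
  qed
  then show "A div Q \<in> monics (k - degree Q)"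
    using dA degM mQ monic_mult_cancel[of Q "A div Q"] by (simp add: monics_def monic_def mult.commute)
qed

text \<open>
  Division with remainder splits the monic polynomials of degree \<open>k\<close> into complete residue systems.
\<close>

lemma charsum_ge_degree:
  assumes \<psi>: "\<psi> \<in> chars" "\<psi> \<noteq> trivial_character Q" and k: "k \<ge> degree Q"
  shows "charsum \<psi> k = 0"
proof -
  have mQ: "Q \<in> monics (degree Q)" using prime by (auto simp: monics_def monic_prime_def)
  have "charsum \<psi> k = (\<Sum>p\<in>(monics (k - degree Q) :: 'a poly set) \<times> polys_below (degree Q). \<psi> (snd p))"
    unfolding charsum_def
  proof (rule sum.reindex_bij_witness[of _ "\<lambda>p. fst p * Q + snd p" "\<lambda>A. (A div Q, A mod Q)"])
    fix A :: "'a poly" assume A: "A \<in> monics k"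
    have B: "A mod Q \<in> polys_below (degree Q)" by (rule mod_in_polys_below[OF Q_nonzero])
    have "A div Q \<in> monics (k - degree Q)" using A k by (rule div_in_monics)
    then show "(A div Q, A mod Q) \<in> monics (k - degree Q) \<times> polys_below (degree Q)" using B by simp
    show "\<psi> (snd (A div Q, A mod Q)) = \<psi> A" using \<psi> by (simp add: char_mod)
    show "fst (A div Q, A mod Q) * Q + snd (A div Q, A mod Q) = A" by simp
  next
    fix p :: "'a poly \<times> 'a poly" assume p: "p \<in> monics (k - degree Q) \<times> polys_below (degree Q)"
    then obtain C B where CB: "p = (C, B)" "C \<in> monics (k - degree Q)" "B \<in> polys_below (degree Q)" by auto
    have "B div Q = 0" using CB by (auto simp: polys_below_iff div_poly_less)
    then show "((fst p * Q + snd p) div Q, (fst p * Q + snd p) mod Q) = p"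
      using CB Q_nonzero by (simp add: mod_polys_below_id)
    have CQ: "C * Q \<in> monics k" using monics_mult[OF CB(2) mQ] k by simp
    obtain D where D: "C * Q = monom 1 k + D" "D \<in> polys_below k" using CQ by (auto simp: monics_eq_image)
    have "B \<in> polys_below k" using CB(3) polys_below_mono[OF k] by blast
    then have "D + B \<in> polys_below k" using D by (intro polys_below_add)
    then show "(fst p * Q + snd p) \<in> monics k"
      using D(1) CB(1) by (auto simp: monics_eq_image add.assoc)
  qed
  also have "\<dots> = (\<Sum>C\<in>(monics (k - degree Q) :: 'a poly set). \<Sum>B\<in>polys_below (degree Q). \<psi> B)"
    unfolding sum.cartesian_product by (simp add: case_prod_unfold)
  also have "\<dots> = 0" using sum_char_residues[OF \<psi>] by simp
  finally show ?thesis .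
qed


end

text \<open>
  The coefficients of \<open>L(s, \<psi>)\<close> normalised at the central point \<open>s = 1/2\<close>.
\<close>

definition lcoef :: "('a::finite_field poly \<Rightarrow> complex) \<Rightarrow> nat \<Rightarrow> complex" where
  "lcoef \<psi> k = charsum \<psi> k / of_real (sqrt (real CARD('a)) ^ k)"

context prime_modulus begin

lemma r_gt_1: "r > 1" using card_field_ge_2[where 'a='a] by (simp add: r_def)

lemma r_pos [simp]: "r > 0" "r \<noteq> 0" using r_gt_1 by auto

lemma r_mult_r: "r * r = real CARD('a)" by (simp add: r_def)

lemma lcoef_eq: "lcoef (\<psi> :: 'a poly \<Rightarrow> complex) k = charsum \<psi> k / of_real (r ^ k)"
  by (simp add: lcoef_def r_def)

lemma charsum_lcoef: "charsum (\<psi> :: 'a poly \<Rightarrow> complex) k = of_real (r ^ k) * lcoef \<psi> k"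
  by (simp add: lcoef_eq)

lemma of_nat_card_power: "(of_nat (CARD('a) ^ k) :: complex) = of_real (r ^ k) * of_real (r ^ k)"
proof -
  have "r ^ k * r ^ k = real (CARD('a) ^ k)"
    by (simp add: r_mult_r flip: power_mult_distrib)
  then show ?thesis by (metis of_real_mult of_real_of_nat_eq)
qed

text \<open>
  Use the Gauss sum with \<open>\<kappa> c = \<psi> [:c:]\<close>: a sum over all \<open>B\<close> of degree at most \<open>j\<close> against \<open>\<kappa>\<close> of the top
  coefficient is then \<open>q - 1\<close> times the conjugate of the sum over monic \<open>B\<close> of degree \<open>j\<close>.
\<close>

lemma odd_functional_equation:
  assumes \<psi>: "\<psi> \<in> chars" "\<psi> \<noteq> trivial_character Q" and odd: "c0 \<noteq> 0" "\<psi> [:c0:] \<noteq> 1"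
  shows "\<exists>W. norm W = 1 \<and> (\<forall>k<degree Q. lcoef \<psi> k = W * cnj (lcoef \<psi> (degree Q - 1 - k)))"
proof -
  define \<kappa> where "\<kappa> c = \<psi> [:c:]" for c
  define g where "g = gauss \<psi> \<kappa> 1"
  define u where "u = (of_nat (CARD('a) - 1) :: complex)"
  have \<kappa>0: "\<kappa> 0 = 0" using \<psi> by (simp add: \<kappa>_def)
  have sum0: "(\<Sum>x\<in>UNIV. \<kappa> x) = 0"
  proof -
    have "(\<Sum>x\<in>UNIV. \<kappa> x) = (\<Sum>x\<in>UNIV. \<kappa> (c0 * x))"
      by (rule sum.reindex_bij_witness[of _ "\<lambda>x. c0 * x" "\<lambda>x. x / c0"]) (use odd in auto)
    also have "\<dots> = \<psi> [:c0:] * (\<Sum>x\<in>UNIV. \<kappa> x)"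
      using char_smult[OF \<psi>(1), of c0 "[:_:]"] by (simp add: \<kappa>_def sum_distrib_left)
    finally show ?thesis using odd by simp
  qed
  have FE: "charsum \<psi> k * g = of_nat (CARD('a) ^ k) * u * cnj (charsum \<psi> (degree Q - 1 - k))"
    if k: "k < degree Q" for k
  proof -
    define j where "j = degree Q - 1 - k"
    have j: "degree Q - k = Suc j" using k by (simp add: j_def)
    have "(\<Sum>B\<in>polys_below (Suc j). cnj (\<psi> B) * \<kappa> (coeff B j)) =
      (\<Sum>c\<in>UNIV - {0}. \<Sum>B\<in>monics j. cnj (\<psi> (smult c B)) * \<kappa> (coeff (smult c B) j))"
      unfolding sum_polys_below_Suc by (simp add: polys_below_def \<kappa>0)
    also have "\<dots> = (\<Sum>c\<in>UNIV - {0::'a}. \<Sum>B\<in>monics j. cnj (\<psi> B))"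
    proof (intro sum.cong refl)
      fix c :: 'a and B :: "'a poly" assume c: "c \<in> UNIV - {0}" and B: "B \<in> monics j"
      have "coeff B j = 1" using B by (auto simp: monics_def monic_def)
      then have "cnj (\<psi> (smult c B)) * \<kappa> (coeff (smult c B) j) = (\<psi> [:c:] * cnj (\<psi> [:c:])) * cnj (\<psi> B)"
        by (simp add: char_smult[OF \<psi>(1)] \<kappa>_def)
      also have "\<dots> = cnj (\<psi> B)" using c by (simp add: char_mult_cnj[OF \<psi>(1)] not_dvd_const)
      finally show "cnj (\<psi> (smult c B)) * \<kappa> (coeff (smult c B) j) = cnj (\<psi> B)" .
    qed
    also have "\<dots> = u * cnj (charsum \<psi> j)" by (simp add: u_def charsum_def card_Diff_singleton)
    finally have eq: "(\<Sum>B\<in>polys_below (Suc j). cnj (\<psi> B) * \<kappa> (coeff B j)) = u * cnj (charsum \<psi> j)" .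
    show ?thesis
      using gauss_monics[OF \<psi> sum0 k] unfolding g_def[symmetric] j j_def[symmetric] eq
      by (simp only: mult.assoc)
  qed
  have u: "u = of_real (real CARD('a) - 1)" using card_field_ge_2[where 'a='a] by (simp add: u_def of_nat_diff)
  have u0: "real CARD('a) - 1 > 0" using card_field_ge_2[where 'a='a] by simp
  define N where "N = degree Q - 1"
  have N: "N < degree Q" using deg_pos by (simp add: N_def)
  (* The two extreme cases of FE evaluate g and relate it to its conjugate; this gives its modulus. *)
  have g1: "g = u * cnj (charsum \<psi> N)" using FE[of 0] \<psi> deg_pos by (simp add: N_def)
  have g2: "charsum \<psi> N * g = of_nat (CARD('a) ^ N) * u"
    using FE[OF N] \<psi> by (simp add: N_def)
  have "of_real ((norm g)\<^sup>2) = g * cnj g" by (rule complex_norm_square)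
  also have "\<dots> = u * (charsum \<psi> N * g)" by (subst (2) g1) (simp add: u)
  also have "\<dots> = of_real (((real CARD('a) - 1) * r ^ N)\<^sup>2)"
    unfolding g2 of_nat_card_power by (simp add: u power2_eq_square mult_ac)
  finally have "(norm g)\<^sup>2 = ((real CARD('a) - 1) * r ^ N)\<^sup>2" by (simp only: of_real_eq_iff)
  then have ng: "norm g = (real CARD('a) - 1) * r ^ N"
    using u0 r_gt_1 by (simp add: power2_eq_iff_nonneg)
  have g0: "g \<noteq> 0" using ng u0 r_gt_1 by auto
  define W where "W = u * of_real (r ^ N) / g"
  have "norm u = real CARD('a) - 1" unfolding u norm_of_real using u0 by simp
  then have "norm W = 1" using ng g0 u0 r_gt_1 by (simp add: W_def norm_divide norm_mult norm_power)
  moreover have "lcoef \<psi> k = W * cnj (lcoef \<psi> (degree Q - 1 - k))" if k: "k < degree Q" for k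
  proof -
    have e: "degree Q - 1 - k = N - k" "k \<le> N" using k by (auto simp: N_def)
    have "of_real (r ^ k) * lcoef \<psi> k * g = of_nat (CARD('a) ^ k) * u * (of_real (r ^ (N - k)) * cnj (lcoef \<psi> (N - k)))"
      using FE[OF k] unfolding e charsum_lcoef by simp
    also have "\<dots> = of_real (r ^ k) * (u * of_real (r ^ k * r ^ (N - k)) * cnj (lcoef \<psi> (N - k)))"
      unfolding of_nat_card_power by simp
    also have "r ^ k * r ^ (N - k) = r ^ N" using e by (simp flip: power_add)
    finally have "lcoef \<psi> k * g = u * of_real (r ^ N) * cnj (lcoef \<psi> (N - k))" using r_gt_1 by simp
    then show ?thesis unfolding e(1) using g0 by (simp add: W_def field_simps)
  qed
  ultimately show ?thesis by blast
qed

lemma sum_below_even: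
  assumes \<psi>: "\<psi> \<in> chars" and even: "\<And>c. c \<noteq> 0 \<Longrightarrow> \<psi> [:c:] = 1"
  shows "(\<Sum>A\<in>polys_below j. \<psi> A) = of_nat (CARD('a) - 1) * (\<Sum>i<j. charsum \<psi> i)"
proof (induction j)
  case 0
  show ?case using \<psi> by simp
next
  case (Suc j)
  have "(\<Sum>c\<in>UNIV - {0}. \<Sum>B\<in>monics j. \<psi> (smult c B)) = (\<Sum>c\<in>UNIV - {0::'a}. charsum \<psi> j)"
    by (intro sum.cong refl) (simp add: charsum_def char_smult[OF \<psi>] even)
  then show ?case unfolding sum_polys_below_Suc Suc.IH by (simp add: card_Diff_singleton algebra_simps)
qed

text \<open>
  When \<open>\<psi>\<close> is trivial on constants, sums over all polynomials of degree below \<open>j\<close> reduce to the partial sums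
  of \<open>charsum \<psi>\<close>. It is these partial sums, normalised, that obey an exact reflection; the Gauss sum is
  taken with the function \<open>\<kappa>\<close> that is \<open>-1\<close> off zero and has sum zero.
\<close>

lemma even_functional_equation:
  assumes \<psi>: "\<psi> \<in> chars" "\<psi> \<noteq> trivial_character Q" and even: "\<And>c. c \<noteq> 0 \<Longrightarrow> \<psi> [:c:] = 1"
  defines "m \<equiv> (\<lambda>j. (\<Sum>i<j. charsum \<psi> i) / of_real (r ^ j))"
  shows "\<exists>W. norm W = 1 \<and> (\<forall>j\<le>degree Q. m j = W * cnj (m (degree Q - j)))"
proof -
  define \<kappa> :: "'a \<Rightarrow> complex" where "\<kappa> c = (if c = 0 then of_nat (CARD('a) - 1) else - 1)" for c
  define g where "g = gauss \<psi> \<kappa> 1"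
  define u where "u = (of_nat (CARD('a) - 1) :: complex)"
  define M where "M j = (\<Sum>i<j. charsum \<psi> i)" for j
  have sum0: "(\<Sum>x\<in>UNIV. \<kappa> x) = 0"
  proof -
    have "(\<Sum>x\<in>UNIV. \<kappa> x) = \<kappa> 0 + (\<Sum>x\<in>UNIV - {0}. \<kappa> x)" by (rule sum.remove) auto
    also have "(\<Sum>x\<in>UNIV - {0}. \<kappa> x) = (\<Sum>x\<in>UNIV - {0::'a}. - 1)" by (rule sum.cong) (auto simp: \<kappa>_def)
    finally show ?thesis by (simp add: \<kappa>_def card_Diff_singleton)
  qed
  have u: "u = of_real (real CARD('a) - 1)" using card_field_ge_2[where 'a='a] by (simp add: u_def of_nat_diff)
  have u0: "real CARD('a) - 1 > 0" using card_field_ge_2[where 'a='a] by simp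
  have u0': "u \<noteq> 0" using u0 unfolding u by (metis of_real_eq_0_iff less_irrefl)
  have S: "(\<Sum>A\<in>polys_below i. \<psi> A) = u * M i" for i
    using sum_below_even[OF \<psi>(1) even] by (simp add: u_def M_def)
  have FE: "M j * g = of_nat (CARD('a) ^ j) * u * cnj (M (degree Q - j))" if j: "j \<le> degree Q" for j
  proof -
    have "u * (M j * g) = u * (of_nat (CARD('a) ^ j) * u * cnj (M (degree Q - j)))"
    proof -
      have "\<kappa> 0 = u" by (simp add: \<kappa>_def u_def)
      moreover have "cnj u = u" by (simp add: u)
      ultimately show ?thesis
        using gauss_below[OF \<psi> sum0 j] unfolding S g_def[symmetric] by (simp add: mult_ac)
    qed
    then show ?thesis using u0' by simp
  qed
  have M1: "M 1 = 1" using \<psi> by (simp add: M_def)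
  define N where "N = degree Q"
  have "u * M N = 0"
    using sum_char_residues[OF \<psi>] S[of N] by (simp add: N_def)
  then have MN: "M N = 0" using u0' by simp
  (* There are no nontrivial even characters modulo a prime of degree one. *)
  have N2: "N \<ge> 2"
  proof -
    have "N \<noteq> 1" using M1 MN by auto
    then show ?thesis using deg_pos by (simp add: N_def)
  qed
  have g1: "g = of_nat CARD('a) * u * cnj (M (N - 1))" using FE[of 1] M1 N2 by (simp add: N_def)
  have g2: "M (N - 1) * g = of_nat (CARD('a) ^ (N - 1)) * u"
    using FE[of "N - 1"] M1 N2 by (simp add: N_def)
  have "of_real ((norm g)\<^sup>2) = g * cnj g" by (rule complex_norm_square)
  also have "\<dots> = of_nat CARD('a) * u * (M (N - 1) * g)" by (subst (2) g1) (simp add: u)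
  also have "\<dots> = u * u * of_nat (CARD('a) * CARD('a) ^ (N - 1))" unfolding g2 by (simp add: mult_ac)
  also have "CARD('a) * CARD('a) ^ (N - 1) = CARD('a) ^ N" using N2 by (cases N) auto
  also have "u * u * of_nat (CARD('a) ^ N) = of_real (((real CARD('a) - 1) * r ^ N)\<^sup>2)"
    unfolding of_nat_card_power by (simp add: u power2_eq_square mult_ac)
  finally have "(norm g)\<^sup>2 = ((real CARD('a) - 1) * r ^ N)\<^sup>2" by (simp only: of_real_eq_iff)
  then have ng: "norm g = (real CARD('a) - 1) * r ^ N"
    using u0 r_gt_1 by (simp add: power2_eq_iff_nonneg)
  have g0: "g \<noteq> 0" using ng u0 r_gt_1 by auto
  define W where "W = u * of_real (r ^ N) / g"
  have "norm u = real CARD('a) - 1" unfolding u norm_of_real using u0 by simp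
  then have "norm W = 1" using ng g0 u0 r_gt_1 by (simp add: W_def norm_divide norm_mult norm_power)
  moreover have "m j = W * cnj (m (degree Q - j))" if j: "j \<le> degree Q" for j
  proof -
    have mM: "M i = of_real (r ^ i) * m i" for i using r_gt_1 by (simp add: m_def M_def)
    have "of_real (r ^ j) * m j * g = of_nat (CARD('a) ^ j) * u * (of_real (r ^ (N - j)) * cnj (m (N - j)))"
      using FE[OF j] unfolding mM N_def by simp
    also have "\<dots> = of_real (r ^ j) * (u * of_real (r ^ j * r ^ (N - j)) * cnj (m (N - j)))"
      unfolding of_nat_card_power by simp
    also have "r ^ j * r ^ (N - j) = r ^ N" using j by (simp add: N_def flip: power_add)
    finally have "m j * g = u * of_real (r ^ N) * cnj (m (N - j))" using r_gt_1 by simp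
    then show ?thesis using g0 by (simp add: W_def N_def field_simps)
  qed
  ultimately show ?thesis by blast
qed

text \<open>
  For odd characters, those nontrivial on constants, \<open>\<nu> = 0\<close>. For the others let \<open>m j\<close> be the normalised partial sums; since
  \<open>lcoef \<psi> k = r * m (k+1) - m k\<close>, the reflection of \<open>m\<close> makes the error telescope with \<open>\<nu> = (r + 1) * m\<close>.
  The bound on \<open>\<nu>\<close> uses the coefficients of degree below \<open>degree Q / 2\<close> only: up to the middle, \<open>m\<close> is
  dominated by a geometric series, and beyond it the reflection applies. This matters because moments of the
  short coefficients are easily computed.
\<close>

lemma approximate_functional_equation:
  assumes \<psi>: "\<psi> \<in> chars" "\<psi> \<noteq> trivial_character Q"
  obtains W \<nu> where "norm W = 1"
    "\<And>k. k < degree Q \<Longrightarrow> lcoef \<psi> k - W * cnj (lcoef \<psi> (degree Q - 1 - k)) = \<nu> (Suc k) - \<nu> k"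
    "\<And>V j. (\<And>i. 2 * i < degree Q \<Longrightarrow> norm (lcoef \<psi> i) \<le> V) \<Longrightarrow> j \<le> degree Q \<Longrightarrow>
      norm (\<nu> j) \<le> (r + 1) / (r - 1) * V"
proof (cases "\<exists>c. c \<noteq> 0 \<and> \<psi> [:c:] \<noteq> 1")
  case True
  then obtain c0 where c0: "c0 \<noteq> 0" "\<psi> [:c0:] \<noteq> 1" by auto
  from odd_functional_equation[OF \<psi> c0] obtain W where W: "norm W = 1"
    "\<forall>k<degree Q. lcoef \<psi> k = W * cnj (lcoef \<psi> (degree Q - 1 - k))" by (elim exE conjE)
  show ?thesis
  proof (rule that[of W "\<lambda>_. 0"])
    fix V j assume V: "\<And>i. 2 * i < degree Q \<Longrightarrow> norm (lcoef \<psi> i) \<le> V" 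
    have "0 \<le> norm (lcoef \<psi> 0)" by simp
    also have "\<dots> \<le> V" using deg_pos by (intro V) simp
    finally show "norm (0::complex) \<le> (r + 1) / (r - 1) * V" using r_gt_1 by simp
  next
    fix k assume "k < degree Q"
    then have eq: "lcoef \<psi> k = W * cnj (lcoef \<psi> (degree Q - 1 - k))" using W(2) by blast
    show "lcoef \<psi> k - W * cnj (lcoef \<psi> (degree Q - 1 - k)) = 0 - 0" by (subst eq) simp
  qed (rule W(1))
next
  case False
  define m where "m j = (\<Sum>i<j. charsum \<psi> i) / of_real (r ^ j)" for j
  obtain W where W: "norm W = 1" "\<And>j. j \<le> degree Q \<Longrightarrow> m j = W * cnj (m (degree Q - j))"
  proof -
    have "\<exists>W. norm W = 1 \<and> (\<forall>j\<le>degree Q. m j = W * cnj (m (degree Q - j)))"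
      unfolding m_def by (rule even_functional_equation[OF \<psi>]) (use False in blast)
    then obtain W where W: "norm W = 1" "\<forall>j\<le>degree Q. m j = W * cnj (m (degree Q - j))"
      by (elim exE conjE)
    show ?thesis by (rule that[of W]) (use W in blast)+
  qed
  have lm: "lcoef \<psi> k = of_real r * m (Suc k) - m k" for k
    using r_gt_1 by (simp add: lcoef_eq m_def field_simps)
  show ?thesis
  proof (rule that[of W "\<lambda>j. of_real (r + 1) * m j"])
    fix k assume k: "k < degree Q"
    have "W * cnj (lcoef \<psi> (degree Q - 1 - k)) =
        of_real r * (W * cnj (m (degree Q - k))) - W * cnj (m (degree Q - Suc k))"
      using k by (simp add: lm Suc_diff_Suc algebra_simps)
    also have "\<dots> = of_real r * m k - m (Suc k)" using W(2)[of k] W(2)[of "Suc k"] k by simp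
    finally show "lcoef \<psi> k - W * cnj (lcoef \<psi> (degree Q - 1 - k)) =
        of_real (r + 1) * m (Suc k) - of_real (r + 1) * m k"
      by (simp add: lm algebra_simps)
  next
    fix V j assume V: "\<And>i. 2 * i < degree Q \<Longrightarrow> norm (lcoef \<psi> i) \<le> V" and j: "j \<le> degree Q"
    have "0 \<le> norm (lcoef \<psi> 0)" by simp
    also have "\<dots> \<le> V" using deg_pos by (intro V) simp
    finally have V0: "V \<ge> 0" .
    have bound: "norm (m i) \<le> V / (r - 1)" if i: "2 * i \<le> degree Q" for i
    proof -
      have "norm (\<Sum>l<i. charsum \<psi> l) \<le> (\<Sum>l<i. r ^ l * V)"
      proof (rule sum_norm_le)
        fix l assume "l \<in> {..<i}"
        then have "norm (lcoef \<psi> l) \<le> V" using i by (intro V) auto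
        then show "norm (charsum \<psi> l) \<le> r ^ l * V"
          unfolding charsum_lcoef using r_gt_1 by (simp add: norm_mult norm_power mult_left_mono)
      qed
      also have "\<dots> = V * ((r ^ i - 1) / (r - 1))"
        using r_gt_1 by (simp add: geometric_sum sum_distrib_left flip: sum_distrib_right)
      also have "\<dots> \<le> V * (r ^ i / (r - 1))"
        using V0 r_gt_1 by (intro mult_left_mono divide_right_mono) auto
      finally show ?thesis using r_gt_1
        by (simp add: m_def norm_divide norm_power divide_le_eq field_simps)
    qed
    have "norm (m j) \<le> V / (r - 1)"
    proof (cases "2 * j \<le> degree Q")
      case False
      then have "norm (m (degree Q - j)) \<le> V / (r - 1)" by (intro bound) auto
      then show ?thesis using W(1) by (simp add: W(2)[OF j] norm_mult)
    qed (rule bound)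
    then have "(r + 1) * norm (m j) \<le> (r + 1) * (V / (r - 1))" using r_gt_1 by (intro mult_left_mono) auto
    moreover have "norm (of_real (r + 1) * m j) = (r + 1) * norm (m j)"
      unfolding norm_mult norm_of_real using r_gt_1 by simp
    ultimately show "norm (of_real (r + 1) * m j) \<le> (r + 1) / (r - 1) * V" by simp
  qed (rule W(1))
qed

end

section \<open>Counting divisors\<close>

definition monic_divisors :: "'a::finite_field poly \<Rightarrow> 'a poly set" where
  "monic_divisors N = {D. monic D \<and> D dvd N}"

lemma finite_monic_divisors [simp]: "N \<noteq> 0 \<Longrightarrow> finite (monic_divisors N)"
proof -
  assume N: "N \<noteq> 0"
  have "monic_divisors N \<subseteq> polys_below (Suc (degree N))"
    using dvd_imp_degree_le[OF _ N] by (auto simp: monic_divisors_def polys_below_iff less_Suc_eq_le)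
  then show ?thesis by (rule finite_subset) simp
qed

lemma ex_prime_divisor:
  fixes N :: "'a::finite_field poly"
  assumes "degree N > 0"
  shows "\<exists>P. monic_prime P \<and> P dvd N"
proof -
  have N0: "N \<noteq> 0" using assms by auto
  have "\<exists>D. (D dvd N \<and> degree D > 0) \<and> (\<forall>E. E dvd N \<and> degree E > 0 \<longrightarrow> degree D \<le> degree E)"
    by (rule ex_has_least_nat[of _ N]) (use assms in simp)
  then obtain D where D: "D dvd N" "degree D > 0"
    and min: "\<And>E. E dvd N \<Longrightarrow> degree E > 0 \<Longrightarrow> degree D \<le> degree E" by (elim exE conjE) simp
  have D0: "D \<noteq> 0" using D by auto
  define P where "P = smult (inverse (lead_coeff D)) D"
  have lc: "lead_coeff D \<noteq> 0" using D0 by simp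
  have P: "monic P" "degree P = degree D" "P dvd N" "P \<noteq> 0"
    using lc D D0 by (auto simp: P_def monic_def smult_dvd_iff)
  have "irreducible P"
  proof (rule irreducibleI)
    show "P \<noteq> 0" by (rule P)
    show "\<not> P dvd 1" using P(2) D(2) by (simp add: is_unit_iff_degree[OF P(4)])
    fix A B assume AB: "P = A * B"
    have AB0: "A \<noteq> 0" "B \<noteq> 0" using AB P(4) by auto
    have AN: "A dvd N" using AB P(3) dvd_trans dvd_triv_left by metis
    have deg: "degree A + degree B = degree D" using AB AB0 P(2) by (simp add: degree_mult_eq)
    show "A dvd 1 \<or> B dvd 1"
    proof (cases "degree A = 0")
      case False
      then have "degree D \<le> degree A" using min[OF AN] by simp
      then have "degree B = 0" using deg by simp
      then show ?thesis using is_unit_iff_degree[OF AB0(2)] by simp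
    qed (simp add: is_unit_iff_degree[OF AB0(1)])
  qed
  then show ?thesis using P by (auto simp: monic_prime_def)
qed

lemma monic_divisors_power:
  assumes P: "monic_prime P" and M: "M \<noteq> 0"
  shows "monic_divisors (P ^ e * M) \<subseteq> (\<Union>i\<le>e. (\<lambda>D. P ^ i * D) ` monic_divisors M)"
proof (induction e)
  case 0
  then show ?case by simp
next
  case (Suc e)
  show ?case
  proof
    fix D assume "D \<in> monic_divisors (P ^ Suc e * M)"
    then have D: "monic D" "D dvd P * (P ^ e * M)" by (simp_all add: monic_divisors_def mult.assoc)
    show "D \<in> (\<Union>i\<le>Suc e. (\<lambda>D. P ^ i * D) ` monic_divisors M)"
    proof (cases "P dvd D")
      case True
      then obtain E where E: "D = P * E" by auto
      have "E dvd P ^ e * M" using D(2) E monic_prime_nonzero[OF P] by simp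
      moreover have "monic E" using D(1) E P monic_mult_cancel by (auto simp: monic_prime_def)
      ultimately have "E \<in> monic_divisors (P ^ e * M)" by (simp add: monic_divisors_def)
      then obtain i F where "i \<le> e" "F \<in> monic_divisors M" "E = P ^ i * F" using Suc.IH by blast
      then have "Suc i \<le> Suc e" "D = P ^ Suc i * F" using E by (auto simp: mult.assoc)
      then show ?thesis using \<open>F \<in> monic_divisors M\<close> by blast
    next
      case False
      then have "coprime D P" using coprime_prime_iff[OF P] by simp
      then have "D dvd P ^ e * M" using D(2) by (rule coprime_dvd_mult_poly)
      then have "D \<in> monic_divisors (P ^ e * M)" using D(1) by (simp add: monic_divisors_def)
      then have "D \<in> (\<Union>i\<le>e. (\<lambda>D. P ^ i * D) ` monic_divisors M)" using Suc.IH by blast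
      then show ?thesis by (rule rev_subsetD) (intro UN_mono, auto)
    qed
  qed
qed

lemma card_monic_divisors_power:
  assumes P: "monic_prime P" and M: "M \<noteq> 0"
  shows "card (monic_divisors (P ^ e * M)) \<le> (e + 1) * card (monic_divisors M)"
proof -
  have "card (monic_divisors (P ^ e * M)) \<le> card (\<Union>i\<le>e. (\<lambda>D. P ^ i * D) ` monic_divisors M)"
    using monic_divisors_power[OF assms] M by (intro card_mono) auto
  also have "\<dots> \<le> (\<Sum>i\<le>e. card ((\<lambda>D. P ^ i * D) ` monic_divisors M))" by (rule card_UN_le) simp
  also have "\<dots> \<le> (\<Sum>i\<le>e. card (monic_divisors M))" using M by (intro sum_mono card_image_le) auto
  finally show ?thesis by simp
qed

text \<open>
  Such an \<open>N\<close> has at most \<open>degree N div T\<close> prime factors, counted with multiplicity, and each of them at most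
  doubles the number of divisors.
\<close>

lemma card_monic_divisors_large:
  fixes N :: "'a::finite_field poly"
  assumes "N \<noteq> 0" "T > 0" "\<And>P. monic_prime P \<Longrightarrow> P dvd N \<Longrightarrow> degree P \<ge> T"
  shows "card (monic_divisors N) \<le> 2 ^ (degree N div T)"
  using assms
proof (induction "degree N" arbitrary: N rule: less_induct)
  case less
  show ?case
  proof (cases "degree N = 0")
    case True
    have "monic_divisors N \<subseteq> {1}"
    proof
      fix D assume "D \<in> monic_divisors N"
      then have D: "monic D" "D dvd N" by (auto simp: monic_divisors_def)
      then have "degree D = 0" using dvd_imp_degree_le[OF D(2) less.prems(1)] True by simp
      then show "D \<in> {1}" using D(1) by (auto simp: monic_def one_pCons elim!: degree_eq_zeroE)
    qed
    then have "card (monic_divisors N) \<le> card {1 :: 'a poly}" by (intro card_mono) auto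
    then show ?thesis by (simp add: True)
  next
    case False
    then obtain P where P: "monic_prime P" "P dvd N" using ex_prime_divisor[of N] by auto
    then obtain M where M: "N = P * M" by auto
    have M0: "M \<noteq> 0" using M less.prems(1) by auto
    have deg: "degree N = degree P + degree M"
      using M M0 monic_prime_nonzero[OF P(1)] by (simp add: degree_mult_eq)
    have dP: "degree P \<ge> T" using less.prems(3) P by blast
    have "card (monic_divisors M) \<le> 2 ^ (degree M div T)"
    proof (rule less.hyps)
      show "degree M < degree N" using deg dP less.prems(2) by simp
      show "degree R \<ge> T" if "monic_prime R" "R dvd M" for R
        using less.prems(3)[of R] that M by auto
    qed (use M0 less.prems in auto)
    then have "card (monic_divisors N) \<le> 2 * 2 ^ (degree M div T)"
      using card_monic_divisors_power[OF P(1) M0, of 1] M by simp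
    also have "\<dots> = 2 ^ Suc (degree M div T)" by simp
    also have "\<dots> \<le> 2 ^ (degree N div T)"
    proof (rule power_increasing)
      have "Suc (degree M div T) = (degree M + T) div T" using less.prems(2) by simp
      also have "\<dots> \<le> degree N div T" using deg dP by (intro div_le_mono) simp
      finally show "Suc (degree M div T) \<le> degree N div T" .
    qed simp
    finally show ?thesis .
  qed
qed

lemma extract_prime_power:
  fixes N :: "'a::finite_field poly"
  assumes "N \<noteq> 0" and P: "monic_prime P"
  shows "\<exists>e M. N = P ^ e * M \<and> \<not> P dvd M"
  using assms(1)
proof (induction "degree N" arbitrary: N rule: less_induct)
  case less
  show ?case
  proof (cases "P dvd N")
    case True
    then obtain M where M: "N = P * M" by auto
    have M0: "M \<noteq> 0" using M less.prems by auto
    have "degree M < degree N"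
      using M M0 monic_prime_nonzero[OF P] prime_degree_pos[OF P] by (simp add: degree_mult_eq)
    then obtain e M' where "M = P ^ e * M'" "\<not> P dvd M'" using less.hyps M0 by blast
    then have "N = P ^ Suc e * M'" using M by (simp add: mult.assoc)
    then show ?thesis using \<open>\<not> P dvd M'\<close> by blast
  next
    case False
    then show ?thesis by (intro exI[of _ 0] exI[of _ N]) simp
  qed
qed

lemma card_monic_divisors_finite_exceptions:
  fixes N :: "'a::finite_field poly"
  assumes "finite S" "T > 0" "N \<noteq> 0" "degree N \<le> D"
    "\<And>P. monic_prime P \<Longrightarrow> P dvd N \<Longrightarrow> degree P < T \<Longrightarrow> P \<in> S" "\<And>P. P \<in> S \<Longrightarrow> monic_prime P"
  shows "card (monic_divisors N) \<le> (D + 1) ^ card S * 2 ^ (D div T)"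
  using assms
proof (induction S arbitrary: N rule: finite_induct)
  case empty
  have "card (monic_divisors N) \<le> 2 ^ (degree N div T)"
    by (rule card_monic_divisors_large) (use empty in \<open>auto simp: not_less[symmetric]\<close>)
  also have "\<dots> \<le> 2 ^ (D div T)" using empty by (intro power_increasing div_le_mono) auto
  finally show ?case by simp
next
  case (insert P S)
  have P: "monic_prime P" using insert by auto
  obtain e M where eM: "N = P ^ e * M" "\<not> P dvd M" using extract_prime_power[OF insert.prems(2) P] by blast
  have M0: "M \<noteq> 0" using eM insert by auto
  have deg: "degree N = e * degree P + degree M"
    using eM M0 monic_prime_nonzero[OF P] by (simp add: degree_mult_eq degree_power_eq)
  have e: "e \<le> D"
    using deg insert.prems(3) prime_degree_pos[OF P]
    by (metis One_nat_def Suc_leI add_leD1 le_trans mult.right_neutral mult_le_mono2)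
  have "card (monic_divisors M) \<le> (D + 1) ^ card S * 2 ^ (D div T)"
  proof (rule insert.IH)
    show "degree M \<le> D" using deg insert.prems(3) by simp
    show "R \<in> S" if "monic_prime R" "R dvd M" "degree R < T" for R
      using insert.prems(4)[of R] that eM by auto
  qed (use insert M0 in auto)
  then have "(e + 1) * card (monic_divisors M) \<le> (D + 1) * ((D + 1) ^ card S * 2 ^ (D div T))"
    using e by (intro mult_le_mono) auto
  then have "card (monic_divisors N) \<le> (D + 1) * ((D + 1) ^ card S * 2 ^ (D div T))"
    using card_monic_divisors_power[OF P M0, of e] eM(1) by (meson le_trans)
  then show ?case using insert.hyps by (simp add: algebra_simps)
qed

text \<open>
  Only finitely many primes have degree below \<open>T\<close>; each contributes at most a factor \<open>D + 1\<close>, and the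
  other primes contribute \<open>2 ^ (D div T)\<close> in total. As \<open>T\<close> is arbitrary, the number of divisors grows more
  slowly than any exponential in the degree.
\<close>

lemma divisor_bound:
  assumes "T > 0"
  obtains s where "\<And>(N :: 'a::finite_field poly) D. N \<noteq> 0 \<Longrightarrow> degree N \<le> D \<Longrightarrow>
    card (monic_divisors N) \<le> (D + 1) ^ s * 2 ^ (D div T)"
proof -
  define S where "S = {P :: 'a poly. monic_prime P \<and> degree P < T}"
  have "S \<subseteq> polys_below T" by (auto simp: S_def polys_below_iff)
  then have "finite S" by (rule finite_subset) simp
  then have "card (monic_divisors N) \<le> (D + 1) ^ card S * 2 ^ (D div T)"
    if "N \<noteq> 0" "degree N \<le> D" for N :: "'a poly" and D
    by (rule card_monic_divisors_finite_exceptions) (use assms that in \<open>auto simp: S_def\<close>)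
  then show ?thesis using that by blast
qed

section \<open>Coprime pairs of monic polynomials\<close>

definition coprime_pairs :: "nat \<Rightarrow> nat \<Rightarrow> ('a::finite_field poly \<times> 'a poly) set" where
  "coprime_pairs i j = {(A, B). A \<in> monics i \<and> B \<in> monics j \<and> coprime A B}"

lemma finite_coprime_pairs [simp]: "finite (coprime_pairs i j)"
proof -
  have "coprime_pairs i j \<subseteq> (monics i :: 'a poly set) \<times> monics j" by (auto simp: coprime_pairs_def)
  then show ?thesis by (rule finite_subset) auto
qed

lemma ex_monic_gcd:
  fixes A B :: "'a::finite_field poly"
  assumes "monic A" "monic B"
  shows "\<exists>G A' B'. monic G \<and> monic A' \<and> monic B' \<and> A = G * A' \<and> B = G * B' \<and> coprime A' B'"
proof -
  have A0: "A \<noteq> 0" "B \<noteq> 0" using assms by (auto simp: monic_def)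
  define S where "S = {G. monic G \<and> G dvd A \<and> G dvd B}"
  have "1 \<in> S" by (simp add: S_def monic_def)
  moreover have "\<forall>G. G \<in> S \<longrightarrow> degree G < Suc (degree A)"
    using dvd_imp_degree_le[OF _ A0(1)] by (auto simp: S_def less_Suc_eq_le)
  ultimately have "\<exists>G. G \<in> S \<and> (\<forall>H. H \<in> S \<longrightarrow> degree H \<le> degree G)"
    by (rule ex_has_greatest_nat)
  then obtain G where G: "G \<in> S" "\<And>H. H \<in> S \<Longrightarrow> degree H \<le> degree G" by blast
  obtain A' B' where AB: "A = G * A'" "B = G * B'" using G(1) by (auto simp: S_def elim!: dvdE)
  have mG: "monic G" using G by (simp add: S_def)
  have mAB: "monic A'" "monic B'" using assms AB mG monic_mult_cancel by metis+
  have "coprime A' B'"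
  proof (rule coprimeI)
    fix D assume D: "D dvd A'" "D dvd B'"
    have D0: "D \<noteq> 0" using D(1) mAB(1) by (auto simp: monic_def)
    then obtain c where c: "c \<noteq> 0" "monic (smult c D)" using ex_monic_associate by blast
    have "monic (G * smult c D)" using mG c(2) unfolding monic_def lead_coeff_mult by simp
    moreover have "G * smult c D dvd A" "G * smult c D dvd B"
      using D c unfolding AB by (simp_all only: mult_dvd_mono dvd_refl smult_dvd_iff if_False)
    ultimately have "G * smult c D \<in> S" by (simp add: S_def)
    then have "degree (G * smult c D) \<le> degree G" by (rule G(2))
    moreover have "G \<noteq> 0" using mG by (auto simp: monic_def)
    ultimately have "degree D = 0" using D0 c by (simp add: degree_mult_eq)
    then show "is_unit D" using is_unit_iff_degree[OF D0] by simp
  qed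
  then show ?thesis using AB mG mAB by blast
qed

lemma monic_gcd_unique:
  fixes A B :: "'a::finite_field poly"
  assumes "monic G" "monic H" "coprime A B" "coprime C D" "G * A = H * C" "G * B = H * D"
  shows "G = H"
proof -
  have *: "G dvd H" if cop: "coprime C D" and eq: "G * A = H * C" "G * B = H * D" for G H A B C D :: "'a poly"
  proof -
    have "\<exists>u v. u * C + v * D = 1" using cop by (intro bezout_poly) (auto simp: coprime_def)
    then obtain u v where "u * C + v * D = 1" by blast
    then have "H = u * (H * C) + v * (H * D)" by (metis distrib_left mult.left_commute mult.right_neutral)
    also have "\<dots> = G * (u * A + v * B)" using eq[symmetric] by (simp add: algebra_simps)
    finally show ?thesis by simp
  qed
  show ?thesis using assms *[of C D G A H B] *[of A B H C G D] by (intro monic_dvd_antisym) auto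
qed

lemma monics_factor:
  assumes "G * A \<in> monics k" "monic G" "monic A"
  shows "G \<in> monics (degree G)" "A \<in> monics (k - degree G)" "degree G \<le> k"
proof -
  have "G \<noteq> 0" "A \<noteq> 0" using assms by (auto simp: monic_def)
  then show "G \<in> monics (degree G)" "A \<in> monics (k - degree G)" "degree G \<le> k"
    using assms by (auto simp: monics_def degree_mult_eq)
qed

text \<open>
  Here \<open>G\<close> is the monic gcd of the pair and \<open>g\<close> its degree.
\<close>

lemma bij_monic_gcd:
  "bij_betw (\<lambda>(g, G, A, B). (G * A, G * B))
    (SIGMA g:{..min a b}. monics g \<times> coprime_pairs (a - g) (b - g))
    ((monics a :: 'a::finite_field poly set) \<times> monics b)"
  unfolding bij_betw_def
proof (intro conjI)
  show "inj_on (\<lambda>(g, G, A, B). (G * A, G * B))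
    (SIGMA g:{..min a b}. (monics g :: 'a poly set) \<times> coprime_pairs (a - g) (b - g))"
  proof (rule inj_onI)
    fix x y :: "nat \<times> 'a poly \<times> 'a poly \<times> 'a poly"
    assume x: "x \<in> (SIGMA g:{..min a b}. monics g \<times> coprime_pairs (a - g) (b - g))"
      and y: "y \<in> (SIGMA g:{..min a b}. monics g \<times> coprime_pairs (a - g) (b - g))"
      and eq: "(\<lambda>(g, G, A, B). (G * A, G * B)) x = (\<lambda>(g, G, A, B). (G * A, G * B)) y"
    obtain g G A B h H C D where xy: "x = (g, G, A, B)" "y = (h, H, C, D)" by (cases x, cases y) auto
    have *: "monic G" "monic H" "coprime A B" "coprime C D" "G * A = H * C" "G * B = H * D"
      "degree G = g" "degree H = h"
      using x y eq unfolding xy by (auto simp: coprime_pairs_def monics_def)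
    have GH: "G = H" by (rule monic_gcd_unique[OF *(1-6)])
    have "G \<noteq> 0" using *(1) by (auto simp: monic_def)
    then have "A = C" "B = D" using *(5,6) GH by simp_all
    then show "x = y" using *(7,8) GH by (simp add: xy)
  qed
  show "(\<lambda>(g, G, A, B). (G * A, G * B)) ` (SIGMA g:{..min a b}. monics g \<times> coprime_pairs (a - g) (b - g))
    = (monics a :: 'a poly set) \<times> monics b"
  proof (rule equalityI; rule subsetI)
    fix x assume "x \<in> (\<lambda>(g, G, A, B). (G * A, G * B)) ` (SIGMA g:{..min a b}. (monics g :: 'a poly set) \<times> coprime_pairs (a - g) (b - g))"
    then obtain g G A B where x: "x = (G * A, G * B)" "g \<le> a" "g \<le> b" "G \<in> monics g"
       "A \<in> monics (a - g)" "B \<in> monics (b - g)"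
      by (auto simp: coprime_pairs_def)
    then show "x \<in> monics a \<times> monics b"
      using monics_mult[of G g A "a - g"] monics_mult[of G g B "b - g"] by simp
  next
    fix x :: "'a poly \<times> 'a poly" assume "x \<in> monics a \<times> monics b"
    then obtain A B where x: "x = (A, B)" "A \<in> monics a" "B \<in> monics b" by auto
    then have "monic A" "monic B" by (auto simp: monics_def)
    then obtain G A' B' where G: "monic G" "monic A'" "monic B'" "A = G * A'" "B = G * B'" "coprime A' B'"
      using ex_monic_gcd by metis
    have GA: "G \<in> monics (degree G)" "A' \<in> monics (a - degree G)" "degree G \<le> a"
      using monics_factor[of G A' a] G x by auto
    have GB: "B' \<in> monics (b - degree G)" "degree G \<le> b"
      using monics_factor[of G B' b] G x by auto
    have "(degree G, G, A', B') \<in> (SIGMA g:{..min a b}. monics g \<times> coprime_pairs (a - g) (b - g))"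
      using GA GB G by (auto simp: coprime_pairs_def)
    then show "x \<in> (\<lambda>(g, G, A, B). (G * A, G * B)) ` (SIGMA g:{..min a b}. monics g \<times> coprime_pairs (a - g) (b - g))"
      using x G by force
  qed
qed

lemma card_monic_pairs_gcd:
  "CARD('a::finite_field) ^ (a + b) =
    (\<Sum>g\<le>min a b. CARD('a) ^ g * card (coprime_pairs (a - g) (b - g) :: ('a poly \<times> 'a poly) set))"
proof -
  have "card (SIGMA g:{..min a b}. (monics g :: 'a poly set) \<times> (coprime_pairs (a - g) (b - g) :: ('a poly \<times> 'a poly) set)) =
      card ((monics a :: 'a poly set) \<times> (monics b :: 'a poly set))"
    by (rule bij_betw_same_card[OF bij_monic_gcd])
  then show ?thesis by (simp add: card_cartesian_product card_monics power_add)
qed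

text \<open>
  Sort all monic pairs by the degree of the gcd, once for \<open>(i + 1, j + 1)\<close> and once for \<open>(i, j)\<close>: the terms of
  positive gcd degree in the first count are \<open>q\<close> times the second count.
\<close>

lemma card_coprime_pairs_Suc:
  "card (coprime_pairs (Suc i) (Suc j) :: ('a::finite_field poly \<times> 'a poly) set) + CARD('a) ^ Suc (i + j)
    = CARD('a) ^ (Suc i + Suc j)"
proof -
  have "CARD('a) ^ (Suc i + Suc j) =
      (\<Sum>g\<le>Suc (min i j). CARD('a) ^ g * card (coprime_pairs (Suc i - g) (Suc j - g) :: ('a poly \<times> 'a poly) set))"
    using card_monic_pairs_gcd[of "Suc i" "Suc j", where 'a='a] by (simp only: min_Suc_Suc)
  also have "\<dots> = card (coprime_pairs (Suc i) (Suc j) :: ('a poly \<times> 'a poly) set) +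
      (\<Sum>g\<le>min i j. CARD('a) ^ Suc g * card (coprime_pairs (i - g) (j - g) :: ('a poly \<times> 'a poly) set))"
    by (subst sum.atMost_Suc_shift) simp
  also have "(\<Sum>g\<le>min i j. CARD('a) ^ Suc g * card (coprime_pairs (i - g) (j - g) :: ('a poly \<times> 'a poly) set)) =
      CARD('a) * CARD('a) ^ (i + j)"
    by (subst card_monic_pairs_gcd) (simp add: sum_distrib_left mult.assoc)
  finally show ?thesis by simp
qed

text \<open>
  Positive degrees give \<open>1 - 1/q\<close>, but the density is \<open>1\<close> as soon as one degree is zero.
\<close>

definition coprime_density :: "'a::finite_field itself \<Rightarrow> nat \<Rightarrow> nat \<Rightarrow> real" where
  "coprime_density _ i j = real (card (coprime_pairs i j :: ('a poly \<times> 'a poly) set)) / real CARD('a) ^ (i + j)"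

lemma coprime_density_pos:
  assumes "i > 0" "j > 0"
  shows "coprime_density TYPE('a::finite_field) i j = 1 - 1 / real CARD('a)"
proof -
  obtain i' j' where ij: "i = Suc i'" "j = Suc j'" using assms by (metis gr0_implies_Suc)
  have "real (card (coprime_pairs i j :: ('a poly \<times> 'a poly) set)) + real CARD('a) ^ Suc (i' + j') =
      real CARD('a) * real CARD('a) ^ Suc (i' + j')"
    using arg_cong[OF card_coprime_pairs_Suc[of i' j', where 'a='a], of real] by (simp add: ij)
  then show ?thesis
    by (simp add: coprime_density_def ij field_simps)
qed

lemma coprime_density_bounds: "0 \<le> coprime_density TYPE('a::finite_field) i j" "coprime_density TYPE('a) i j \<le> 1"
proof -
  have "card (coprime_pairs i j :: ('a poly \<times> 'a poly) set) \<le> card ((monics i :: 'a poly set) \<times> (monics j :: 'a poly set))"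
    by (rule card_mono) (auto simp: coprime_pairs_def)
  then have "real (card (coprime_pairs i j :: ('a poly \<times> 'a poly) set)) \<le> real CARD('a) ^ (i + j)"
    by (simp add: card_cartesian_product card_monics power_add flip: of_nat_power of_nat_mult)
  then show "coprime_density TYPE('a) i j \<le> 1" by (simp add: coprime_density_def)
  show "0 \<le> coprime_density TYPE('a) i j" by (simp add: coprime_density_def)
qed

section \<open>The equation AD = BC\<close>

definition pairs_over :: "(nat \<times> nat) set \<Rightarrow> ('a::finite_field poly \<times> 'a poly) set" where
  "pairs_over R = {(A, B). monic A \<and> monic B \<and> (degree A, degree B) \<in> R}"

definition pair_weight :: "(nat \<Rightarrow> nat \<Rightarrow> real) \<Rightarrow> 'a::finite_field poly \<times> 'a poly \<Rightarrow> real" where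
  "pair_weight F = (\<lambda>(A, B). F (degree A) (degree B) / sqrt (real CARD('a)) ^ (degree A + degree B))"

text \<open>
  Here \<open>R\<close> is the set of allowed pairs of degrees, and the entries are the degrees of \<open>G\<close>, \<open>H\<close>, \<open>A\<close> and \<open>B\<close> in
  \<open>diagonal_param_bij\<close>.
\<close>

definition diagonal_index :: "(nat \<times> nat) set \<Rightarrow> (nat \<times> nat \<times> nat \<times> nat) set" where
  "diagonal_index R = {(g, h, i, j). (g + i, g + j) \<in> R \<and> (h + i, h + j) \<in> R}"

lemma finite_pairs_over [simp]: "finite R \<Longrightarrow> finite (pairs_over R)"
proof -
  assume R: "finite R"
  have "pairs_over R = (\<Union>(a, b)\<in>R. (monics a :: 'a poly set) \<times> monics b)"
    by (auto simp: pairs_over_def monics_def)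
  then show ?thesis using R by auto
qed

lemma finite_diagonal_index [simp]: "finite R \<Longrightarrow> finite (diagonal_index R)"
proof -
  assume R: "finite R"
  define f where "f p = fst p + snd p" for p :: "nat \<times> nat"
  have "a + b \<le> Max (f ` R)" if "(a, b) \<in> R" for a b
    using that R by (intro Max_ge) (auto simp: f_def intro: image_eqI[of _ _ "(a, b)"])
  then have "diagonal_index R \<subseteq> {..Max (f ` R)} \<times> {..Max (f ` R)} \<times> {..Max (f ` R)} \<times> {..Max (f ` R)}"
    by (fastforce simp: diagonal_index_def)
  then show ?thesis by (rule finite_subset) auto
qed

text \<open>
  In \<open>A D = B C\<close> divide each of the pairs \<open>(A, B)\<close> and \<open>(C, D)\<close> by its gcd: the two quotient pairs are
  proportional, monic and coprime, hence equal.
\<close>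

lemma diagonal_param_bij:
  "bij_betw (\<lambda>(_, G, H, A, B). ((G * A, G * B), (H * A, H * B)))
    (SIGMA (g, h, i, j):diagonal_index R. monics g \<times> monics h \<times> coprime_pairs i j)
    {((A, B), (C, D)). (A, B) \<in> pairs_over R \<and> (C, D) \<in> pairs_over R \<and> A * D = B * (C :: 'a::finite_field poly)}"
    (is "bij_betw ?f ?S ?T")
  unfolding bij_betw_def
proof (intro conjI)
  show "inj_on ?f ?S"
  proof (rule inj_onI)
    fix x y assume x: "x \<in> ?S" and y: "y \<in> ?S" and eq: "?f x = ?f y"
    obtain g h i j G H A B where xx: "x = ((g, h, i, j), G, H, A, B)" by (metis prod.exhaust)
    obtain g' h' i' j' G' H' A' B' where yy: "y = ((g', h', i', j'), G', H', A', B')" by (metis prod.exhaust)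
    have mx: "G \<in> monics g" "H \<in> monics h" "A \<in> monics i" "B \<in> monics j" "coprime A B"
      using x unfolding xx by (auto simp: coprime_pairs_def)
    have my: "G' \<in> monics g'" "H' \<in> monics h'" "A' \<in> monics i'" "B' \<in> monics j'" "coprime A' B'"
      using y unfolding yy by (auto simp: coprime_pairs_def)
    have e: "G * A = G' * A'" "G * B = G' * B'" "H * A = H' * A'"
      using eq unfolding xx yy by auto
    have "monic G" "monic G'" using mx(1) my(1) by (simp_all add: monics_def)
    then have GG: "G = G'" using mx(5) my(5) e(1,2) by (rule monic_gcd_unique)
    have AA: "A = A'" "B = B'" using e GG monics_nonzero[OF mx(1)] by simp_all
    have HH: "H = H'" using e AA monics_nonzero[OF mx(3)] by simp
    show "x = y" using mx(1-4) my(1-4) unfolding xx yy GG AA HH by (simp add: monics_def)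
  qed
  show "?f ` ?S = ?T"
  proof (rule equalityI; rule subsetI)
    fix y assume "y \<in> ?f ` ?S"
    then obtain x where x: "x \<in> ?S" "y = ?f x" by blast
    obtain g h i j G H A B where xx: "x = ((g, h, i, j), G, H, A, B)" by (metis prod.exhaust)
    have mx: "G \<in> monics g" "H \<in> monics h" "A \<in> monics i" "B \<in> monics j"
      and I: "(g + i, g + j) \<in> R" "(h + i, h + j) \<in> R"
      using x unfolding xx by (auto simp: coprime_pairs_def diagonal_index_def)
    have "(G * A, G * B) \<in> pairs_over R" "(H * A, H * B) \<in> pairs_over R"
      using monics_mult[OF mx(1,3)] monics_mult[OF mx(1,4)] monics_mult[OF mx(2,3)] monics_mult[OF mx(2,4)] I
      by (simp_all add: pairs_over_def monics_def)
    then show "y \<in> ?T" using x(2) unfolding xx by (simp add: mult_ac)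
  next
    fix y assume y: "y \<in> ?T"
    obtain A B C D where yy: "y = ((A, B), (C, D))" by (metis prod.exhaust)
    have p: "monic A" "monic B" "monic C" "monic D" "(degree A, degree B) \<in> R" "(degree C, degree D) \<in> R" "A * D = B * C"
      using y unfolding yy by (auto simp: pairs_over_def)
    obtain G A' B' where G: "monic G" "monic A'" "monic B'" "A = G * A'" "B = G * B'" "coprime A' B'"
      using ex_monic_gcd[OF p(1,2)] by metis
    have G0: "G \<noteq> 0" "A' \<noteq> 0" "B' \<noteq> 0" using G by (auto simp: monic_def)
    have "G * (A' * D) = G * (B' * C)" using p(7) G by (simp add: mult_ac)
    then have ADBC: "A' * D = B' * C" using G0 by simp
    then have "A' dvd B' * C" by (metis dvd_triv_left)
    then have "A' dvd C" by (rule coprime_dvd_mult_poly[OF G(6)])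
    then obtain H where H: "C = A' * H" by auto
    have "A' * D = A' * (B' * H)" using ADBC H by (simp add: mult_ac)
    then have HD: "D = H * B'" using G0 by (simp add: mult_ac)
    have mH: "monic H" using p(3) G(2) H monic_mult_cancel by metis
    have H0: "H \<noteq> 0" using mH by (auto simp: monic_def)
    define x where "x = ((degree G, degree H, degree A', degree B'), G, H, A', B')"
    have "x \<in> ?S"
      using G mH p(5,6) H HD G0 H0
      by (simp add: x_def diagonal_index_def monics_def coprime_pairs_def degree_mult_eq add.commute)
    moreover have "?f x = y" using G H HD unfolding yy by (simp add: x_def mult_ac)
    ultimately show "y \<in> ?f ` ?S" by blast
  qed
qed

text \<open>
  The weights \<open>r^(-degree)\<close> cancel the numbers of monic polynomials exactly, so every quadruple of degrees
  counts with the coprime density alone.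
\<close>

lemma diagonal_sum:
  assumes R: "finite R"
  shows "(\<Sum>(x, y) | x \<in> pairs_over R \<and> y \<in> pairs_over R \<and> fst x * snd y = snd x * (fst y :: 'a::finite_field poly).
      pair_weight F x * pair_weight F y) =
    (\<Sum>(g, h, i, j)\<in>diagonal_index R. F (g + i) (g + j) * F (h + i) (h + j) * coprime_density TYPE('a) i j)"
proof -
  define q where "q = real CARD('a)"
  have q: "q > 0" "sqrt q > 0" using card_field_ge_2[where 'a='a] by (auto simp: q_def)
  define f :: "(nat \<times> nat \<times> nat \<times> nat) \<times> 'a poly \<times> 'a poly \<times> 'a poly \<times> 'a poly \<Rightarrow> ('a poly \<times> 'a poly) \<times> ('a poly \<times> 'a poly)"
    where "f = (\<lambda>(_, G, H, A, B). ((G * A, G * B), (H * A, H * B)))"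
  define S where "S = (SIGMA (g, h, i, j):diagonal_index R. (monics g :: 'a poly set) \<times> (monics h :: 'a poly set) \<times> (coprime_pairs i j :: ('a poly \<times> 'a poly) set))"
  have set_eq: "{(x, y). x \<in> pairs_over R \<and> y \<in> pairs_over R \<and> fst x * snd y = snd x * (fst y :: 'a poly)} =
      {((A, B), (C, D)). (A, B) \<in> pairs_over R \<and> (C, D) \<in> pairs_over R \<and> A * D = B * (C :: 'a poly)}"
    by auto
  have "(\<Sum>(x, y) | x \<in> pairs_over R \<and> y \<in> pairs_over R \<and> fst x * snd y = snd x * (fst y :: 'a poly).
      pair_weight F x * pair_weight F y) = (\<Sum>z\<in>S. (\<lambda>(x, y). pair_weight F x * pair_weight F y) (f z))"
    unfolding set_eq S_def f_def by (rule sum.reindex_bij_betw[OF diagonal_param_bij, symmetric])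
  also have "\<dots> = (\<Sum>z\<in>S. (\<lambda>(g, h, i, j). F (g + i) (g + j) * F (h + i) (h + j) / q ^ (g + h + i + j)) (fst z))"
  proof (rule sum.cong[OF refl])
    fix z assume z: "z \<in> S"
    obtain g h i j G H A B where zz: "z = ((g, h, i, j), G, H, A, B)" by (metis prod.exhaust)
    have mx: "G \<in> monics g" "H \<in> monics h" "A \<in> monics i" "B \<in> monics j"
      using z unfolding zz S_def by (auto simp: coprime_pairs_def)
    have d: "degree (G * A) = g + i" "degree (G * B) = g + j" "degree (H * A) = h + i" "degree (H * B) = h + j"
      using monics_mult[OF mx(1,3)] monics_mult[OF mx(1,4)] monics_mult[OF mx(2,3)] monics_mult[OF mx(2,4)]
      by (simp_all add: monics_def)
    have "sqrt q ^ (h + i + (h + j)) * sqrt q ^ (g + i + (g + j)) = sqrt q ^ (2 * (g + h + i + j))"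
      by (simp add: mult_2 add_ac flip: power_add)
    also have "\<dots> = q ^ (g + h + i + j)" using q by (simp only: power_mult real_sqrt_pow2 less_imp_le)
    finally show "(\<lambda>(x, y). pair_weight F x * pair_weight F y) (f z) =
        (\<lambda>(g, h, i, j). F (g + i) (g + j) * F (h + i) (h + j) / q ^ (g + h + i + j)) (fst z)"
      by (simp add: zz f_def pair_weight_def d q_def)
  qed
  also have "\<dots> = (\<Sum>p\<in>diagonal_index R. \<Sum>w\<in>(case p of (g, h, i, j) \<Rightarrow> (monics g :: 'a poly set) \<times> (monics h :: 'a poly set) \<times> (coprime_pairs i j :: ('a poly \<times> 'a poly) set)).
      (\<lambda>(g, h, i, j). F (g + i) (g + j) * F (h + i) (h + j) / q ^ (g + h + i + j)) p)"
    unfolding S_def using R by (subst sum.Sigma) (auto simp: case_prod_unfold split: prod.splits)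
  also have "\<dots> = (\<Sum>(g, h, i, j)\<in>diagonal_index R. F (g + i) (g + j) * F (h + i) (h + j) * coprime_density TYPE('a) i j)"
  proof (rule sum.cong[OF refl])
    fix p :: "nat \<times> nat \<times> nat \<times> nat"
    obtain g h i j where p: "p = (g, h, i, j)" by (metis prod.exhaust)
    show "(\<Sum>w\<in>(case p of (g, h, i, j) \<Rightarrow> (monics g :: 'a poly set) \<times> (monics h :: 'a poly set) \<times> (coprime_pairs i j :: ('a poly \<times> 'a poly) set)).
        (\<lambda>(g, h, i, j). F (g + i) (g + j) * F (h + i) (h + j) / q ^ (g + h + i + j)) p) =
      (case p of (g, h, i, j) \<Rightarrow> F (g + i) (g + j) * F (h + i) (h + j) * coprime_density TYPE('a) i j)"
      using q unfolding p by (simp add: card_cartesian_product card_monics coprime_density_def q_def[symmetric] power_add field_simps)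
  qed
  finally show ?thesis .
qed

section \<open>Mean squares of bilinear forms\<close>

context prime_modulus begin

lemma card_cong_monics:
  assumes k: "k \<ge> degree Q"
  shows "card {N \<in> monics k. [N = M] (mod Q)} \<le> CARD('a) ^ (k - degree Q)"
proof -
  have "inj_on (\<lambda>N. N div Q) {N \<in> monics k. [N = M] (mod Q)}"
  proof (rule inj_onI)
    fix A B :: "'a poly"
    assume "A \<in> {N \<in> monics k. [N = M] (mod Q)}" "B \<in> {N \<in> monics k. [N = M] (mod Q)}" "A div Q = B div Q"
    then have "A div Q * Q + A mod Q = B div Q * Q + B mod Q" by (simp add: cong_def del: div_mult_mod_eq)
    then show "A = B" by simp
  qed
  moreover have "(\<lambda>N. N div Q) ` {N \<in> monics k. [N = M] (mod Q)} \<subseteq> monics (k - degree Q)"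
    using div_in_monics k by auto
  ultimately have "card {N \<in> monics k. [N = M] (mod Q)} \<le> card (monics (k - degree Q) :: 'a poly set)"
    by (intro card_inj_on_le) auto
  then show ?thesis by (simp add: card_monics)
qed

definition off_diagonal :: "nat \<Rightarrow> nat \<Rightarrow> nat \<Rightarrow> nat \<Rightarrow> (('a poly \<times> 'a poly) \<times> ('a poly \<times> 'a poly)) set" where
  "off_diagonal a b c d = {((A, B), (C, D)). A \<in> monics a \<and> B \<in> monics b \<and> C \<in> monics c \<and> D \<in> monics d \<and>
     [A * D = B * C] (mod Q) \<and> A * D \<noteq> B * C}"

text \<open>
  One of \<open>N\<close>, \<open>M\<close> has degree at least \<open>degree Q\<close>, since otherwise \<open>N - M\<close> would be too small to be a nonzero
  multiple of \<open>Q\<close>. Fixing the other one leaves a single residue class.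
\<close>

lemma card_cong_pairs:
  defines "P \<equiv> (\<lambda>k l. {(N, M). N \<in> monics k \<and> M \<in> monics l \<and> [N = M] (mod Q) \<and> N \<noteq> M})"
  shows "finite (P k l)" "real (card (P k l)) \<le> real CARD('a) ^ (k + l) / real CARD('a) ^ degree Q"
proof -
  have sub: "P k l \<subseteq> monics k \<times> monics l" by (auto simp: P_def)
  then show fin: "finite (P k l)" by (rule finite_subset) auto
  have q: "real CARD('a) > 0" by simp
  have *: "real (card X) \<le> real CARD('a) ^ (k + l) / real CARD('a) ^ degree Q"
    if "card X \<le> CARD('a) ^ (k' - degree Q) * CARD('a) ^ l'" "k' \<ge> degree Q" "k' + l' = k + l" for X :: "('a poly \<times> 'a poly) set" and k' l'
  proof -
    have "real (card X) \<le> real (CARD('a) ^ (k' - degree Q) * CARD('a) ^ l')" using that(1) by (rule of_nat_mono)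
    also have "\<dots> = real CARD('a) ^ (k' - degree Q + l')" by (simp add: power_add)
    also have "k' - degree Q + l' = k + l - degree Q" using that by simp
    also have "real CARD('a) ^ (k + l - degree Q) = real CARD('a) ^ (k + l) / real CARD('a) ^ degree Q"
      using that by (intro power_diff) auto
    finally show ?thesis .
  qed
  consider "k \<ge> degree Q" | "l \<ge> degree Q" | "k < degree Q" "l < degree Q" by linarith
  then show "real (card (P k l)) \<le> real CARD('a) ^ (k + l) / real CARD('a) ^ degree Q"
  proof cases
    case 1
    have "P k l \<subseteq> (\<lambda>(M, N). (N, M)) ` (SIGMA M:monics l. {N \<in> monics k. [N = M] (mod Q)})"
      by (auto simp: P_def image_iff)
    then have "card (P k l) \<le> card (SIGMA M:monics l. {N \<in> monics k. [N = M] (mod Q)})"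
      by (rule surj_card_le[rotated]) auto
    also have "\<dots> = (\<Sum>M\<in>monics l. card {N \<in> monics k. [N = M] (mod Q)})" by simp
    also have "\<dots> \<le> (\<Sum>M\<in>(monics l :: 'a poly set). CARD('a) ^ (k - degree Q))"
      using card_cong_monics[OF 1] by (intro sum_mono) auto
    finally show ?thesis using 1 by (intro *[where k'=k and l'=l]) (simp_all add: card_monics mult.commute)
  next
    case 2
    have "P k l \<subseteq> (SIGMA N:monics k. {M \<in> monics l. [M = N] (mod Q)})"
      by (auto simp: P_def cong_sym)
    then have "card (P k l) \<le> card (SIGMA N:monics k. {M \<in> monics l. [M = N] (mod Q)})"
      by (rule card_mono[rotated]) auto
    also have "\<dots> = (\<Sum>N\<in>monics k. card {M \<in> monics l. [M = N] (mod Q)})" by simp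
    also have "\<dots> \<le> (\<Sum>N\<in>(monics k :: 'a poly set). CARD('a) ^ (l - degree Q))"
      using card_cong_monics[OF 2] by (intro sum_mono) auto
    finally show ?thesis using 2 by (intro *[where k'=l and l'=k]) (simp_all add: card_monics mult.commute)
  next
    case 3
    then have "P k l = {}"
      using cong_polys_below polys_below_subset_monics unfolding P_def by blast
    then show ?thesis by simp
  qed
qed

text \<open>
  The products \<open>A D\<close> and \<open>B C\<close> form a pair as in \<open>card_cong_pairs\<close>, and each product factors in at most \<open>T\<close> ways.
\<close>

lemma card_off_diagonal:
  assumes T: "\<And>N :: 'a poly. N \<noteq> 0 \<Longrightarrow> degree N \<le> D \<Longrightarrow> card (monic_divisors N) \<le> T"
    and "a + d \<le> D" "b + c \<le> D"
  shows "real (card (off_diagonal a b c d)) \<le> real T ^ 2 * (real CARD('a) ^ (a + b + c + d) / real CARD('a) ^ degree Q)"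
proof -
  define P where "P = {(N, M). N \<in> monics (a + d) \<and> M \<in> monics (b + c) \<and> [N = M] (mod Q) \<and> N \<noteq> M}"
  have P: "finite P" "real (card P) \<le> real CARD('a) ^ (a + d + (b + c)) / real CARD('a) ^ degree Q"
    unfolding P_def by (rule card_cong_pairs)+
  have P0: "N \<noteq> 0" "M \<noteq> 0" "degree N \<le> D" "degree M \<le> D" if "(N, M) \<in> P" for N M
    using that monics_nonzero assms(2,3) by (auto simp: P_def monics_def monic_def)
  define S where "S = (SIGMA p:P. monic_divisors (fst p) \<times> monic_divisors (snd p))"
  have finS: "finite S" unfolding S_def using P P0 by auto
  define f :: "('a poly \<times> 'a poly) \<times> ('a poly \<times> 'a poly) \<Rightarrow> ('a poly \<times> 'a poly) \<times> ('a poly \<times> 'a poly)"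
    where "f = (\<lambda>((A, B), (C, D)). ((A * D, B * C), (A, B)))"
  have "inj_on f (off_diagonal a b c d)"
  proof (rule inj_onI)
    fix x y assume "x \<in> off_diagonal a b c d" "y \<in> off_diagonal a b c d" "f x = f y"
    then show "x = y" using monics_nonzero by (fastforce simp: f_def off_diagonal_def)
  qed
  moreover have "f ` off_diagonal a b c d \<subseteq> S"
  proof
    fix z assume "z \<in> f ` off_diagonal a b c d"
    then obtain A B C D where z: "z = ((A * D, B * C), (A, B))" "A \<in> monics a" "B \<in> monics b" "C \<in> monics c" "D \<in> monics d"
      "[A * D = B * C] (mod Q)" "A * D \<noteq> B * C"
      by (auto simp: f_def off_diagonal_def)
    then show "z \<in> S"
      using monics_mult[of A a D d] monics_mult[of B b C c]
      by (simp add: S_def P_def monic_divisors_def) (simp add: monics_def)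
  qed
  ultimately have "card (off_diagonal a b c d) \<le> card S" using finS by (rule card_inj_on_le)
  also have "card S = (\<Sum>p\<in>P. card (monic_divisors (fst p)) * card (monic_divisors (snd p)))"
    unfolding S_def using P P0 by (subst card_SigmaI) (auto simp: card_cartesian_product)
  also have "\<dots> \<le> (\<Sum>p\<in>P. T * T)"
    using P0 by (intro sum_mono mult_le_mono T) auto
  finally have "card (off_diagonal a b c d) \<le> card P * (T * T)" by simp
  then have "real (card (off_diagonal a b c d)) \<le> real (card P * (T * T))" by (rule of_nat_mono)
  also have "\<dots> = real T ^ 2 * real (card P)" by (simp add: power2_eq_square)
  also have "\<dots> \<le> real T ^ 2 * (real CARD('a) ^ (a + d + (b + c)) / real CARD('a) ^ degree Q)"
    by (intro mult_left_mono P) auto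
  finally show ?thesis by (simp add: add_ac)
qed

definition bilinear_form :: "(nat \<Rightarrow> nat \<Rightarrow> real) \<Rightarrow> (nat \<times> nat) set \<Rightarrow> ('a poly \<Rightarrow> complex) \<Rightarrow> complex" where
  "bilinear_form F I \<psi> = (\<Sum>(a, b)\<in>I. of_real (F a b) * lcoef \<psi> a * cnj (lcoef \<psi> b))"

lemma sum_pairs_over:
  fixes f :: "'a poly \<times> 'a poly \<Rightarrow> 'b::comm_monoid_add"
  assumes "finite I"
  shows "(\<Sum>x\<in>pairs_over I. f x) = (\<Sum>(a, b)\<in>I. \<Sum>A\<in>monics a. \<Sum>B\<in>monics b. f (A, B))"
proof -
  have "(\<Sum>(a, b)\<in>I. \<Sum>A\<in>monics a. \<Sum>B\<in>monics b. f (A, B)) =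
      (\<Sum>p\<in>I. \<Sum>x\<in>monics (fst p) \<times> monics (snd p). f x)"
    by (simp add: case_prod_unfold sum.cartesian_product)
  also have "\<dots> = (\<Sum>z\<in>(SIGMA p:I. monics (fst p) \<times> monics (snd p)). f (snd z))"
    using assms by (subst sum.Sigma) (auto simp: case_prod_unfold)
  also have "\<dots> = (\<Sum>x\<in>pairs_over I. f x)"
    by (rule sum.reindex_bij_witness[of _ "\<lambda>x. ((degree (fst x), degree (snd x)), x)" snd])
       (auto simp: pairs_over_def monics_def)
  finally show ?thesis ..
qed

lemma bilinear_form_eq:
  assumes I: "finite I"
  shows "bilinear_form F I \<psi> = (\<Sum>x\<in>pairs_over I. of_real (pair_weight F x) * (\<psi> (fst x) * cnj (\<psi> (snd x))))"
  unfolding sum_pairs_over[OF I] bilinear_form_def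
proof (rule sum.cong[OF refl], clarify)
  fix a b
  have "(\<Sum>A\<in>monics a. \<Sum>B\<in>monics b. of_real (pair_weight F (A, B)) * (\<psi> (fst (A, B)) * cnj (\<psi> (snd (A, B))))) =
    (\<Sum>A\<in>monics a. \<Sum>B\<in>monics b. of_real (F a b / r ^ (a + b)) * (\<psi> A * cnj (\<psi> B)))"
    by (intro sum.cong refl) (simp add: pair_weight_def monics_def r_def)
  also have "\<dots> = of_real (F a b / r ^ (a + b)) * (charsum \<psi> a * cnj (charsum \<psi> b))"
    unfolding charsum_def cnj_sum sum_product by (simp add: sum_distrib_left)
  also have "\<dots> = of_real (F a b) * lcoef \<psi> a * cnj (lcoef \<psi> b)"
    by (simp add: lcoef_eq power_add)
  finally show "of_real (F a b) * lcoef \<psi> a * cnj (lcoef \<psi> b) =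
     (\<Sum>A\<in>monics a. \<Sum>B\<in>monics b. of_real (pair_weight F (A, B)) * (\<psi> (fst (A, B)) * cnj (\<psi> (snd (A, B)))))" ..
qed

text \<open>
  Orthogonality of characters; all polynomials involved have degree below \<open>degree Q\<close> and are thus prime to \<open>Q\<close>.
\<close>

lemma mean_square_bilinear_form:
  assumes I: "I \<subseteq> {..<degree Q} \<times> {..<degree Q}"
  shows "(\<Sum>\<psi>\<in>chars. (norm (bilinear_form F I \<psi>))\<^sup>2) =
    real \<phi> * (\<Sum>(x, y) | x \<in> pairs_over I \<and> y \<in> pairs_over I \<and> [fst x * snd y = snd x * fst y] (mod Q).
      pair_weight F x * pair_weight F y)"
proof -
  have fin: "finite I" using I by (rule finite_subset) auto
  define P :: "('a poly \<times> 'a poly) set" where "P = pairs_over I"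
  have finP: "finite P" using fin by (simp add: P_def)
  define w :: "'a poly \<times> 'a poly \<Rightarrow> complex" where "w x = of_real (pair_weight F x)" for x
  have nd: "\<not> Q dvd snd x * fst y" if "x \<in> P" "y \<in> P" for x y
  proof -
    have "snd x \<in> monics (degree (snd x))" "fst y \<in> monics (degree (fst y))"
      "degree (snd x) < degree Q" "degree (fst y) < degree Q"
      using that I by (auto simp: P_def pairs_over_def monics_def)
    then have "\<not> Q dvd snd x" "\<not> Q dvd fst y" using not_dvd_monics by blast+
    then show ?thesis by (simp add: prime_dvd_mult_poly[OF prime])
  qed
  have sq: "of_real ((norm (bilinear_form F I \<psi>))\<^sup>2) =
      (\<Sum>x\<in>P. \<Sum>y\<in>P. w x * w y * (\<psi> (fst x * snd y) * cnj (\<psi> (snd x * fst y))))"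
    if \<psi>: "\<psi> \<in> chars" for \<psi>
  proof -
    have "of_real ((norm (bilinear_form F I \<psi>))\<^sup>2) = bilinear_form F I \<psi> * cnj (bilinear_form F I \<psi>)"
      by (rule complex_norm_square)
    also have "\<dots> = (\<Sum>x\<in>P. w x * (\<psi> (fst x) * cnj (\<psi> (snd x)))) * (\<Sum>y\<in>P. w y * (cnj (\<psi> (fst y)) * \<psi> (snd y)))"
      unfolding bilinear_form_eq[OF fin] by (simp add: P_def w_def)
    also have "\<dots> = (\<Sum>x\<in>P. \<Sum>y\<in>P. w x * w y * (\<psi> (fst x * snd y) * cnj (\<psi> (snd x * fst y))))"
      unfolding sum_product using \<psi> by (intro sum.cong refl) (simp add: char_mult mult_ac)
    finally show ?thesis .
  qed
  have "of_real (\<Sum>\<psi>\<in>chars. (norm (bilinear_form F I \<psi>))\<^sup>2) =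
      (\<Sum>\<psi>\<in>chars. \<Sum>x\<in>P. \<Sum>y\<in>P. w x * w y * (\<psi> (fst x * snd y) * cnj (\<psi> (snd x * fst y))))"
    unfolding of_real_sum by (rule sum.cong[OF refl]) (rule sq)
  also have "\<dots> = (\<Sum>x\<in>P. \<Sum>\<psi>\<in>chars. \<Sum>y\<in>P. w x * w y * (\<psi> (fst x * snd y) * cnj (\<psi> (snd x * fst y))))"
    by (rule sum.swap)
  also have "\<dots> = (\<Sum>x\<in>P. \<Sum>y\<in>P. \<Sum>\<psi>\<in>chars. w x * w y * (\<psi> (fst x * snd y) * cnj (\<psi> (snd x * fst y))))"
    by (intro sum.cong refl sum.swap)
  also have "\<dots> = (\<Sum>x\<in>P. \<Sum>y\<in>P. if [fst x * snd y = snd x * fst y] (mod Q) then of_nat \<phi> * (w x * w y) else 0)"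
    by (intro sum.cong refl) (simp add: sum_chars_cnj[OF nd] flip: sum_distrib_left)
  also have "\<dots> = (\<Sum>z\<in>P \<times> P. if [fst (fst z) * snd (snd z) = snd (fst z) * fst (snd z)] (mod Q) then of_nat \<phi> * (w (fst z) * w (snd z)) else 0)"
    by (simp add: sum.cartesian_product case_prod_unfold)
  also have "\<dots> = (\<Sum>z | z \<in> P \<times> P \<and> [fst (fst z) * snd (snd z) = snd (fst z) * fst (snd z)] (mod Q). of_nat \<phi> * (w (fst z) * w (snd z)))"
    using finP by (intro sum.inter_filter[symmetric]) auto
  also have "\<dots> = (\<Sum>(x, y) | x \<in> P \<and> y \<in> P \<and> [fst x * snd y = snd x * fst y] (mod Q). of_nat \<phi> * (w x * w y))"
    by (rule sum.cong) (auto simp: case_prod_unfold)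
  also have "\<dots> = of_real (real \<phi> * (\<Sum>(x, y) | x \<in> P \<and> y \<in> P \<and> [fst x * snd y = snd x * fst y] (mod Q).
      pair_weight F x * pair_weight F y))"
    by (simp add: w_def case_prod_unfold sum_distrib_left)
  finally show ?thesis unfolding P_def of_real_eq_iff .
qed

lemma mean_square_split:
  assumes I: "I \<subseteq> {..<degree Q} \<times> {..<degree Q}"
  defines "E \<equiv> {(x, y). x \<in> pairs_over I \<and> y \<in> pairs_over I \<and> [fst x * snd y = snd x * fst y] (mod Q)
      \<and> fst x * snd y \<noteq> snd x * fst y}"
  shows "(\<Sum>\<psi>\<in>chars. (norm (bilinear_form F I \<psi>))\<^sup>2) =
    real \<phi> * ((\<Sum>(g, h, i, j)\<in>diagonal_index I. F (g + i) (g + j) * F (h + i) (h + j) * coprime_density TYPE('a) i j) +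
      (\<Sum>(x, y)\<in>E. pair_weight F x * pair_weight F y))"
proof -
  have fin: "finite I" using I by (rule finite_subset) auto
  define D where "D = {(x, y). x \<in> pairs_over I \<and> y \<in> pairs_over I \<and> fst x * snd y = snd x * (fst y :: 'a poly)}"
  have sub: "D \<subseteq> pairs_over I \<times> pairs_over I" "E \<subseteq> pairs_over I \<times> pairs_over I" by (auto simp: D_def E_def)
  have fDE: "finite D" "finite E" using sub fin by (auto intro: finite_subset)
  have "{(x, y). x \<in> pairs_over I \<and> y \<in> pairs_over I \<and> [fst x * snd y = snd x * fst y] (mod Q)} = D \<union> E"
    by (auto simp: D_def E_def)
  moreover have "D \<inter> E = {}" by (auto simp: D_def E_def)
  ultimately have "(\<Sum>(x, y) | x \<in> pairs_over I \<and> y \<in> pairs_over I \<and> [fst x * snd y = snd x * fst y] (mod Q).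
      pair_weight F x * pair_weight F y) = (\<Sum>(x, y)\<in>D. pair_weight F x * pair_weight F y) + (\<Sum>(x, y)\<in>E. pair_weight F x * pair_weight F y)"
    using fDE by (simp add: sum.union_disjoint)
  also have "(\<Sum>(x, y)\<in>D. pair_weight F x * pair_weight F y) = (\<Sum>(g, h, i, j)\<in>diagonal_index I. F (g + i) (g + j) * F (h + i) (h + j) * coprime_density TYPE('a) i j)"
    unfolding D_def by (rule diagonal_sum[OF fin])
  finally show ?thesis unfolding mean_square_bilinear_form[OF I] by simp
qed

text \<open>
  The degrees of \<open>A D\<close> and \<open>B C\<close> are below \<open>degree Q\<close>, so congruence forces equality and there is no
  off-diagonal part.
\<close>

lemma mean_square_short:
  assumes I: "I \<subseteq> {..<degree Q} \<times> {..<degree Q}" and short: "\<And>a b. (a, b) \<in> I \<Longrightarrow> 2 * a < degree Q \<and> 2 * b < degree Q"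
  shows "(\<Sum>\<psi>\<in>chars. (norm (bilinear_form F I \<psi>))\<^sup>2) =
    real \<phi> * (\<Sum>(g, h, i, j)\<in>diagonal_index I. F (g + i) (g + j) * F (h + i) (h + j) * coprime_density TYPE('a) i j)"
proof -
  have empty: "{(x, y). x \<in> pairs_over I \<and> y \<in> pairs_over I \<and> [fst x * snd y = snd x * fst y] (mod Q)
      \<and> fst x * snd y \<noteq> snd x * (fst y :: 'a poly)} = {}"
  proof -
    have contra: False if "x \<in> pairs_over I" "y \<in> pairs_over I" "[fst x * snd y = snd x * fst y] (mod Q)"
      "fst x * snd y \<noteq> snd x * (fst y :: 'a poly)" for x y :: "'a poly \<times> 'a poly"
    proof -
      have m: "monic (fst x)" "monic (snd x)" "monic (fst y)" "monic (snd y)"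
         "(degree (fst x), degree (snd x)) \<in> I" "(degree (fst y), degree (snd y)) \<in> I"
        using that by (auto simp: pairs_over_def)
      then have "fst x * snd y \<in> monics (degree (fst x) + degree (snd y))" "snd x * fst y \<in> monics (degree (snd x) + degree (fst y))"
        by (intro monics_mult; simp add: monics_def)+
      moreover have "degree (fst x) + degree (snd y) < degree Q" "degree (snd x) + degree (fst y) < degree Q"
        using short[OF m(5)] short[OF m(6)] by auto
      ultimately show False using that(3,4) cong_polys_below polys_below_subset_monics by blast
    qed
    show ?thesis
    proof (rule equals0I)
      fix z assume "z \<in> {(x, y). x \<in> pairs_over I \<and> y \<in> pairs_over I \<and> [fst x * snd y = snd x * fst y] (mod Q)
        \<and> fst x * snd y \<noteq> snd x * (fst y :: 'a poly)}"
      then show False using contra[of "fst z" "snd z"] by (simp add: case_prod_unfold)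
    qed
  qed
  show ?thesis unfolding mean_square_split[OF I] empty by simp
qed

text \<open>
  By \<open>card_off_diagonal\<close> the degrees \<open>(a, b, c, d)\<close> contribute at most \<open>M^2 T^2 r^(a+b+c+d) / q^(degree Q)\<close>. Each of
  \<open>a + b\<close> and \<open>c + d\<close> stays below \<open>degree Q\<close> by \<open>gap\<close>, which saves \<open>q^gap\<close>.
\<close>

lemma off_diagonal_bound:
  assumes I: "\<And>a b. (a, b) \<in> I \<Longrightarrow> a + b + gap \<le> degree Q" and RQ: "I \<subseteq> {..<degree Q} \<times> {..<degree Q}"
    and F: "\<And>a b. (a, b) \<in> I \<Longrightarrow> \<bar>F a b\<bar> \<le> M"
    and T: "\<And>N :: 'a poly. N \<noteq> 0 \<Longrightarrow> degree N \<le> 2 * degree Q \<Longrightarrow> card (monic_divisors N) \<le> T"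
  defines "E \<equiv> {(x, y). x \<in> pairs_over I \<and> y \<in> pairs_over I \<and> [fst x * snd y = snd x * fst y] (mod Q)
      \<and> fst x * snd y \<noteq> snd x * fst y}"
  shows "\<bar>\<Sum>(x, y)\<in>E. pair_weight F x * pair_weight F y\<bar> \<le> M\<^sup>2 * real (degree Q) ^ 4 * (real T)\<^sup>2 / real CARD('a) ^ gap"
proof -
  have fin: "finite I" using RQ by (rule finite_subset) auto
  have q0: "real CARD('a) > 0" by simp
  define S where "S = (SIGMA p:I \<times> I. off_diagonal (fst (fst p)) (snd (fst p)) (fst (snd p)) (snd (snd p)))"
  have finO: "finite (off_diagonal a b c d)" for a b c d
  proof -
    have "off_diagonal a b c d \<subseteq> (monics a \<times> monics b) \<times> (monics c \<times> monics d)" by (auto simp: off_diagonal_def)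
    then show ?thesis by (rule finite_subset) auto
  qed
  have "\<bar>\<Sum>(x, y)\<in>E. pair_weight F x * pair_weight F y\<bar> \<le> (\<Sum>z\<in>E. \<bar>pair_weight F (fst z) * pair_weight F (snd z)\<bar>)"
    by (simp add: case_prod_unfold)
  also have "\<dots> = (\<Sum>z\<in>S. \<bar>pair_weight F (fst (snd z)) * pair_weight F (snd (snd z))\<bar>)"
    by (rule sum.reindex_bij_witness[of _ snd
        "\<lambda>z. (((degree (fst (fst z)), degree (snd (fst z))), (degree (fst (snd z)), degree (snd (snd z)))), z)"])
       (auto simp: E_def S_def pairs_over_def off_diagonal_def monics_def)
  also have "\<dots> = (\<Sum>p\<in>I \<times> I. \<Sum>z\<in>off_diagonal (fst (fst p)) (snd (fst p)) (fst (snd p)) (snd (snd p)). \<bar>pair_weight F (fst z) * pair_weight F (snd z)\<bar>)"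
    unfolding S_def using fin finO by (subst sum.Sigma) (auto simp: case_prod_unfold)
  also have "\<dots> \<le> (\<Sum>p\<in>I \<times> I. M\<^sup>2 * (real T)\<^sup>2 / real CARD('a) ^ gap)"
  proof (rule sum_mono)
    fix p assume p: "p \<in> I \<times> I"
    obtain a b c d where pp: "p = ((a, b), (c, d))" by (metis prod.exhaust)
    have ab: "(a, b) \<in> I" "(c, d) \<in> I" using p pp by auto
    have lt: "a < degree Q" "b < degree Q" "c < degree Q" "d < degree Q" using ab RQ by auto
    have M0: "M \<ge> 0" using F[OF ab(1)] by linarith
    define s where "s = a + b + c + d"
    have s: "s + 2 * gap \<le> 2 * degree Q" using I[OF ab(1)] I[OF ab(2)] by (simp add: s_def)
    have "(\<Sum>z\<in>off_diagonal a b c d. \<bar>pair_weight F (fst z) * pair_weight F (snd z)\<bar>) \<le> (\<Sum>z\<in>off_diagonal a b c d. M\<^sup>2 / r ^ s)"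
    proof (rule sum_mono)
      fix z assume "z \<in> off_diagonal a b c d"
      then have "pair_weight F (fst z) * pair_weight F (snd z) = (F a b * F c d) / r ^ s"
        by (auto simp: off_diagonal_def pair_weight_def monics_def r_def s_def power_add)
      then have "\<bar>pair_weight F (fst z) * pair_weight F (snd z)\<bar> = \<bar>F a b\<bar> * \<bar>F c d\<bar> / r ^ s"
        using r_gt_1 by (simp add: abs_mult)
      also have "\<dots> \<le> M * M / r ^ s"
        using F[OF ab(1)] F[OF ab(2)] M0 r_gt_1 by (intro divide_right_mono mult_mono) auto
      finally show "\<bar>pair_weight F (fst z) * pair_weight F (snd z)\<bar> \<le> M\<^sup>2 / r ^ s" by (simp add: power2_eq_square)
    qed
    also have "\<dots> = real (card (off_diagonal a b c d)) * (M\<^sup>2 / r ^ s)" by simp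
    also have "\<dots> \<le> (real T ^ 2 * (real CARD('a) ^ s / real CARD('a) ^ degree Q)) * (M\<^sup>2 / r ^ s)"
    proof (intro mult_right_mono)
      show "real (card (off_diagonal a b c d)) \<le> real T ^ 2 * (real CARD('a) ^ s / real CARD('a) ^ degree Q)"
        unfolding s_def by (rule card_off_diagonal[OF T]) (use lt in auto)
      show "0 \<le> M\<^sup>2 / r ^ s" using r_gt_1 by simp
    qed
    also have "\<dots> = M\<^sup>2 * real T ^ 2 * (real CARD('a) ^ s / (real CARD('a) ^ degree Q * r ^ s))" by simp
    also have "\<dots> \<le> M\<^sup>2 * real T ^ 2 * (1 / real CARD('a) ^ gap)"
    proof (rule mult_left_mono)
      have "r ^ s * real CARD('a) ^ gap = r ^ (s + 2 * gap)"
        by (simp add: power_add power_mult power2_eq_square r_mult_r)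
      also have "\<dots> \<le> r ^ (2 * degree Q)" using s r_gt_1 by (intro power_increasing) auto
      also have "\<dots> = real CARD('a) ^ degree Q" by (simp add: power_mult power2_eq_square r_mult_r)
      finally have *: "r ^ s * real CARD('a) ^ gap \<le> real CARD('a) ^ degree Q" .
      have "real CARD('a) ^ s = r ^ s * r ^ s" by (simp add: r_mult_r flip: power_mult_distrib)
      then have "real CARD('a) ^ s / (real CARD('a) ^ degree Q * r ^ s) = r ^ s / real CARD('a) ^ degree Q" by simp
      also have "\<dots> \<le> 1 / real CARD('a) ^ gap" using * by (simp add: field_simps)
      finally show "real CARD('a) ^ s / (real CARD('a) ^ degree Q * r ^ s) \<le> 1 / real CARD('a) ^ gap" .
    qed simp
    finally show "(\<Sum>z\<in>off_diagonal (fst (fst p)) (snd (fst p)) (fst (snd p)) (snd (snd p)). \<bar>pair_weight F (fst z) * pair_weight F (snd z)\<bar>)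
      \<le> M\<^sup>2 * (real T)\<^sup>2 / real CARD('a) ^ gap" by (simp add: pp)
  qed
  also have "\<dots> = real (card (I \<times> I)) * (M\<^sup>2 * (real T)\<^sup>2 / real CARD('a) ^ gap)" by simp
  also have "\<dots> \<le> real (degree Q) ^ 4 * (M\<^sup>2 * (real T)\<^sup>2 / real CARD('a) ^ gap)"
  proof (rule mult_right_mono)
    have "card I \<le> card ({..<degree Q} \<times> {..<degree Q})" using RQ by (intro card_mono) auto
    then have "card I \<le> degree Q * degree Q" by (simp add: card_cartesian_product)
    then have "card I * card I \<le> (degree Q * degree Q) * (degree Q * degree Q)" by (intro mult_le_mono)
    then have "real (card I * card I) \<le> real ((degree Q * degree Q) * (degree Q * degree Q))" by (rule of_nat_mono)
    then show "real (card (I \<times> I)) \<le> real (degree Q) ^ 4"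
      by (simp add: card_cartesian_product power4_eq_xxxx mult.assoc)
  qed simp
  finally show ?thesis by (simp add: mult_ac)
qed

end

section \<open>Symmetric blocks of exponents\<close>

text \<open>
  The points \<open>0 = cut_point n K 0 \<le> \<dots> \<le> cut_point n K (2 * K + 1) = n\<close> are symmetric under \<open>k \<mapsto> n - k\<close>. The \<open>K\<close> lower
  blocks divide \<open>{..<n div 2}\<close> evenly up to rounding; the middle block is empty or a single point, according to the
  parity of \<open>n\<close>.
\<close>

definition cut_point :: "nat \<Rightarrow> nat \<Rightarrow> nat \<Rightarrow> nat" where
  "cut_point n K \<beta> = (if \<beta> \<le> K then \<beta> * (n div 2) div K else n - (2 * K + 1 - \<beta>) * (n div 2) div K)"

definition block :: "nat \<Rightarrow> nat \<Rightarrow> nat \<Rightarrow> nat set" where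
  "block n K \<beta> = {cut_point n K \<beta>..<cut_point n K (Suc \<beta>)}"

definition block_width :: "nat \<Rightarrow> nat \<Rightarrow> nat" where
  "block_width n K = n div 2 div K"

lemma lower_cut_le: "\<beta> \<le> K \<Longrightarrow> \<beta> * (n div 2) div K \<le> n div (2 :: nat)" for K n :: nat
proof (cases "K = 0")
  case False
  assume "\<beta> \<le> K"
  then have "\<beta> * (n div 2) div K \<le> K * (n div 2) div K" by (intro div_le_mono mult_le_mono1)
  then show ?thesis using False by simp
qed simp

lemma cut_0: "cut_point n K 0 = 0" by (simp add: cut_point_def)

lemma cut_last: "cut_point n K (Suc (2 * K)) = n" by (simp add: cut_point_def)

lemma cut_reflect:
  assumes "\<beta> \<le> 2 * K + 1"
  shows "cut_point n K (2 * K + 1 - \<beta>) = n - cut_point n K \<beta>"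
proof (cases "\<beta> \<le> K")
  case True
  then show ?thesis by (simp add: cut_point_def)
next
  case False
  then have "2 * K + 1 - \<beta> \<le> K" by simp
  moreover from lower_cut_le[OF this, of n] have "(2 * K + 1 - \<beta>) * (n div 2) div K \<le> n" by linarith
  ultimately show ?thesis using False assms by (simp add: cut_point_def)
qed

lemma lower_step:
  fixes H K :: nat assumes "K > 0"
  shows "\<beta> * H div K + H div K \<le> Suc \<beta> * H div K" "Suc \<beta> * H div K \<le> \<beta> * H div K + H div K + 1"
proof -
  have e: "Suc \<beta> * H = \<beta> * H + H" by simp
  show "\<beta> * H div K + H div K \<le> Suc \<beta> * H div K"
    unfolding e using assms
    by (metis add_leD1 div_add1_eq le_add1)
  have "\<beta> * H mod K + H mod K < 2 * K"
    using assms mod_less_divisor[of K "\<beta> * H"] mod_less_divisor[of K H] by linarith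
  then have "(\<beta> * H mod K + H mod K) div K < 2" using assms by (simp add: div_less_iff_less_mult)
  then show "Suc \<beta> * H div K \<le> \<beta> * H div K + H div K + 1"
    unfolding e by (subst div_add1_eq) simp
qed

lemma cut_step:
  assumes K: "K > 0" and \<beta>: "\<beta> \<le> 2 * K"
  shows "cut_point n K \<beta> \<le> cut_point n K (Suc \<beta>)" "cut_point n K (Suc \<beta>) \<le> cut_point n K \<beta> + block_width n K + 1"
    "\<beta> \<noteq> K \<Longrightarrow> cut_point n K \<beta> + block_width n K \<le> cut_point n K (Suc \<beta>)"
proof -
  define H where "H = n div 2"
  have *: "cut_point n K \<beta> \<le> cut_point n K (Suc \<beta>) \<and> cut_point n K (Suc \<beta>) \<le> cut_point n K \<beta> + block_width n K + 1
      \<and> (\<beta> \<noteq> K \<longrightarrow> cut_point n K \<beta> + block_width n K \<le> cut_point n K (Suc \<beta>))"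
  proof -
    consider "\<beta> < K" | "\<beta> = K" | "\<beta> > K" by linarith
    then show ?thesis
    proof cases
      case 1
      then show ?thesis using lower_step[OF K, of \<beta> H]
        by (simp add: cut_point_def block_width_def H_def[symmetric] del: mult_Suc)
    next
      case 2
      then show ?thesis using K by (simp add: cut_point_def) linarith
    next
      case 3
      define j where "j = 2 * K - \<beta>"
      have j: "2 * K + 1 - \<beta> = Suc j" "2 * K + 1 - Suc \<beta> = j" "j < K" using 3 \<beta> by (auto simp: j_def)
      have le: "Suc j * H div K \<le> n" using lower_cut_le[of "Suc j" K n] j(3) unfolding H_def by linarith
      show ?thesis using 3 lower_step[OF K, of j H] le unfolding cut_point_def block_width_def j H_def[symmetric]
        by (simp del: mult_Suc) linarith
    qed
  qed
  then show "cut_point n K \<beta> \<le> cut_point n K (Suc \<beta>)" "cut_point n K (Suc \<beta>) \<le> cut_point n K \<beta> + block_width n K + 1"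
    "\<beta> \<noteq> K \<Longrightarrow> cut_point n K \<beta> + block_width n K \<le> cut_point n K (Suc \<beta>)" by auto
qed

lemma cut_mono:
  assumes K: "K > 0" and "\<beta> \<le> \<gamma>" "\<gamma> \<le> 2 * K + 1"
  shows "cut_point n K \<beta> \<le> cut_point n K \<gamma>"
  using assms(2,3)
proof (induction \<gamma> rule: dec_induct)
  case (step \<gamma>)
  then show ?case using cut_step(1)[OF K, of \<gamma> n] by simp
qed simp

lemma cut_two_steps:
  assumes K: "K > 0" and "\<beta> + 2 \<le> 2 * K + 1"
  shows "cut_point n K \<beta> + block_width n K \<le> cut_point n K (\<beta> + 2)"
proof (cases "\<beta> = K")
  case True
  then show ?thesis using cut_step(1)[OF K, of \<beta> n] cut_step(3)[OF K, of "Suc \<beta>" n] assms by simp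
next
  case False
  then show ?thesis using cut_step(3)[OF K, of \<beta> n] cut_step(1)[OF K, of "Suc \<beta>" n] assms by simp
qed

lemma cut_steps_upper:
  assumes K: "K > 0" and "\<beta> + j \<le> 2 * K + 1"
  shows "cut_point n K (\<beta> + j) \<le> cut_point n K \<beta> + j * (block_width n K + 1)"
  using assms(2)
proof (induction j)
  case (Suc j)
  then show ?case using cut_step(2)[OF K, of "\<beta> + j" n] by simp
qed simp

lemma finite_block [simp]: "finite (block n K \<beta>)" by (simp add: block_def)

lemma card_block: "K > 0 \<Longrightarrow> \<beta> \<le> 2 * K \<Longrightarrow> card (block n K \<beta>) \<le> block_width n K + 1"
  using cut_step(2)[of K \<beta> n] by (simp add: block_def)

lemma block_subset: "K > 0 \<Longrightarrow> \<beta> \<le> 2 * K \<Longrightarrow> block n K \<beta> \<subseteq> {..<n}"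
  using cut_mono[of K "Suc \<beta>" "2 * K + 1" n] by (auto simp: block_def cut_last)

lemma block_lower: "K > 0 \<Longrightarrow> \<beta> \<le> K \<Longrightarrow> k \<in> block n K \<beta> \<Longrightarrow> 2 * k < n"
proof -
  assume K: "K > 0" "\<beta> \<le> K" "k \<in> block n K \<beta>"
  then have "k < cut_point n K (K + 1)" using cut_mono[of K "Suc \<beta>" "K + 1" n] by (auto simp: block_def)
  also have "cut_point n K (K + 1) = n - n div 2" using K by (simp add: cut_point_def)
  finally show "2 * k < n" by linarith
qed

lemma in_some_block:
  assumes K: "K > 0" and k: "k < n"
  obtains \<beta> where "\<beta> \<le> 2 * K" "k \<in> block n K \<beta>"
proof -
  have "\<exists>\<beta>\<le>2 * K. k \<in> block n K \<beta>"
  proof (rule ccontr)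
    assume no: "\<not> ?thesis"
    have "\<beta> \<le> 2 * K + 1 \<Longrightarrow> cut_point n K \<beta> \<le> k" for \<beta>
    proof (induction \<beta>)
      case (Suc \<beta>)
      then show ?case using no by (auto simp: block_def not_less)
    qed (simp add: cut_0)
    from this[of "2 * K + 1"] show False using k by (simp add: cut_last)
  qed
  then show ?thesis using that by blast
qed

lemma block_disjoint:
  assumes K: "K > 0" and "\<beta> \<le> 2 * K" "\<gamma> \<le> 2 * K" "k \<in> block n K \<beta>" "k \<in> block n K \<gamma>"
  shows "\<beta> = \<gamma>"
proof (rule ccontr)
  assume "\<beta> \<noteq> \<gamma>"
  then have "Suc \<beta> \<le> \<gamma> \<or> Suc \<gamma> \<le> \<beta>" by linarith
  then show False
    using assms cut_mono[OF K, of "Suc \<beta>" \<gamma> n] cut_mono[OF K, of "Suc \<gamma>" \<beta> n] by (auto simp: block_def)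
qed

lemma sum_blocks:
  fixes f :: "nat \<Rightarrow> 'b::comm_monoid_add"
  assumes K: "K > 0"
  shows "(\<Sum>k<n. f k) = (\<Sum>\<beta>\<le>2 * K. \<Sum>k\<in>block n K \<beta>. f k)"
proof -
  have "(\<Sum>k\<in>(\<Union>\<beta>\<in>{..2 * K}. block n K \<beta>). f k) = (\<Sum>\<beta>\<le>2 * K. \<Sum>k\<in>block n K \<beta>. f k)"
  proof (rule sum.UNION_disjoint)
    show "\<forall>i\<in>{..2 * K}. \<forall>j\<in>{..2 * K}. i \<noteq> j \<longrightarrow> block n K i \<inter> block n K j = {}"
      using block_disjoint[OF K] by blast
  qed auto
  moreover have "(\<Union>\<beta>\<in>{..2 * K}. block n K \<beta>) = {..<n}"
  proof (intro equalityI subsetI)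
    fix k assume "k \<in> {..<n}"
    then obtain \<beta> where "\<beta> \<le> 2 * K" "k \<in> block n K \<beta>" using in_some_block[OF K, of k n] by auto
    then show "k \<in> (\<Union>\<beta>\<in>{..2 * K}. block n K \<beta>)" by auto
  qed (use block_subset[OF K] in blast)
  ultimately show ?thesis by simp
qed

text \<open>
  A union of products of blocks inside the triangle \<open>a + b < n\<close>. The offset \<open>3\<close> keeps it away from the
  antidiagonal by at least a block width even when one of the blocks between is the degenerate middle one
  (\<open>below_antidiagonal_gap\<close>), while it still contains all pairs that are further away than three widths
  (\<open>not_below_antidiagonal\<close>).
\<close>

definition below_antidiagonal :: "nat \<Rightarrow> nat \<Rightarrow> (nat \<times> nat) set" where
  "below_antidiagonal n K = (\<Union>(\<beta>, \<gamma>)\<in>{(\<beta>, \<gamma>). \<beta> + \<gamma> + 3 \<le> 2 * K}. block n K \<beta> \<times> block n K \<gamma>)"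

lemma finite_index_pairs [simp]: "finite {(\<beta>, \<gamma>). \<beta> + \<gamma> + 3 \<le> 2 * (K :: nat)}"
  by (rule finite_subset[of _ "{..2 * K} \<times> {..2 * K}"]) auto

lemma below_antidiagonal_subset: "K > 0 \<Longrightarrow> below_antidiagonal n K \<subseteq> {..<n} \<times> {..<n}"
proof -
  assume K: "K > 0"
  have "block n K \<beta> \<times> block n K \<gamma> \<subseteq> {..<n} \<times> {..<n}" if "\<beta> + \<gamma> + 3 \<le> 2 * K" for \<beta> \<gamma>
    using that by (intro Sigma_mono block_subset[OF K]) auto
  then show ?thesis unfolding below_antidiagonal_def by blast
qed

lemma below_antidiagonal_gap:
  assumes K: "K > 0" and "(a, b) \<in> below_antidiagonal n K"
  shows "a + b + block_width n K \<le> n"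
proof -
  obtain \<beta> \<gamma> where *: "\<beta> + \<gamma> + 3 \<le> 2 * K" "a \<in> block n K \<beta>" "b \<in> block n K \<gamma>"
    using assms(2) by (auto simp: below_antidiagonal_def)
  have "cut_point n K (2 * K + 1 - Suc \<gamma>) = n - cut_point n K (Suc \<gamma>)" using * by (intro cut_reflect) simp
  moreover have "cut_point n K (\<beta> + 3) \<le> cut_point n K (2 * K + 1 - Suc \<gamma>)" using * by (intro cut_mono[OF K]) auto
  moreover have "cut_point n K (Suc \<beta>) + block_width n K \<le> cut_point n K (\<beta> + 3)"
    using cut_two_steps[OF K, of "Suc \<beta>" n] * by (simp add: eval_nat_numeral)
  moreover have "cut_point n K (Suc \<gamma>) \<le> n" using cut_mono[OF K, of "Suc \<gamma>" "2 * K + 1" n] * by (simp add: cut_last)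
  moreover have "a < cut_point n K (Suc \<beta>)" "b < cut_point n K (Suc \<gamma>)" using * by (auto simp: block_def)
  ultimately show ?thesis by linarith
qed

lemma not_below_antidiagonal:
  assumes K: "K > 0" and "a < n" "b < n" "(a, b) \<notin> below_antidiagonal n K"
  shows "n \<le> a + b + 3 * (block_width n K + 1)"
proof -
  obtain \<beta> where \<beta>: "\<beta> \<le> 2 * K" "a \<in> block n K \<beta>" using in_some_block[OF K assms(2)] .
  obtain \<gamma> where \<gamma>: "\<gamma> \<le> 2 * K" "b \<in> block n K \<gamma>" using in_some_block[OF K assms(3)] .
  have le: "2 * K + 1 - \<gamma> \<le> \<beta> + 3"
  proof (rule ccontr)
    assume "\<not> ?thesis"
    then have "\<beta> + \<gamma> + 3 \<le> 2 * K" by linarith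
    then have "(a, b) \<in> below_antidiagonal n K" using \<beta> \<gamma> by (auto simp: below_antidiagonal_def)
    then show False using assms(4) by simp
  qed
  have refl: "cut_point n K (2 * K + 1 - \<gamma>) = n - cut_point n K \<gamma>" using \<gamma> by (intro cut_reflect) simp
  have "cut_point n K (2 * K + 1 - \<gamma>) \<le> cut_point n K \<beta> + 3 * (block_width n K + 1)"
  proof (cases "2 * K + 1 - \<gamma> \<le> \<beta>")
    case True
    then show ?thesis using cut_mono[OF K True, of n] \<beta> by simp
  next
    case False
    define j where "j = 2 * K + 1 - \<gamma> - \<beta>"
    have j: "2 * K + 1 - \<gamma> = \<beta> + j" "j \<le> 3" using le False by (auto simp: j_def)
    have "cut_point n K (\<beta> + j) \<le> cut_point n K \<beta> + j * (block_width n K + 1)"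
      using j(1) by (intro cut_steps_upper[OF K]) simp
    also have "\<dots> \<le> cut_point n K \<beta> + 3 * (block_width n K + 1)" using j(2) by (intro add_left_mono mult_le_mono1)
    finally show ?thesis unfolding j(1) .
  qed
  moreover have "cut_point n K \<beta> \<le> a" "cut_point n K \<gamma> \<le> b" using \<beta> \<gamma> by (auto simp: block_def)
  ultimately show ?thesis using refl by linarith
qed

lemma sum_below_antidiagonal:
  fixes f :: "nat \<Rightarrow> nat \<Rightarrow> 'b::comm_monoid_add"
  assumes K: "K > 0"
  shows "(\<Sum>(a, b)\<in>below_antidiagonal n K. f a b) =
    (\<Sum>(\<beta>, \<gamma>) | \<beta> + \<gamma> + 3 \<le> 2 * K. \<Sum>a\<in>block n K \<beta>. \<Sum>b\<in>block n K \<gamma>. f a b)"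
proof -
  define I where "I = {(\<beta>, \<gamma>). \<beta> + \<gamma> + 3 \<le> 2 * K}"
  have disj: "p = p'" if "p \<in> I" "p' \<in> I" "x \<in> block n K (fst p) \<times> block n K (snd p)"
    "x \<in> block n K (fst p') \<times> block n K (snd p')" for p p' x
  proof -
    have "fst p = fst p'" "snd p = snd p'"
      using that by (intro block_disjoint[OF K, of _ _ "fst x"] block_disjoint[OF K, of _ _ "snd x"]; force simp: I_def)+
    then show ?thesis by (simp add: prod_eq_iff)
  qed
  have "(\<Sum>x\<in>(\<Union>p\<in>I. block n K (fst p) \<times> block n K (snd p)). f (fst x) (snd x)) =
    (\<Sum>p\<in>I. \<Sum>x\<in>block n K (fst p) \<times> block n K (snd p). f (fst x) (snd x))"
  proof (rule sum.UNION_disjoint)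
    show "\<forall>i\<in>I. \<forall>j\<in>I. i \<noteq> j \<longrightarrow>
        (block n K (fst i) \<times> block n K (snd i)) \<inter> (block n K (fst j) \<times> block n K (snd j)) = {}"
      using disj by blast
  qed (auto simp: I_def)
  then show ?thesis
    by (simp add: below_antidiagonal_def I_def case_prod_unfold sum.cartesian_product)
qed

section \<open>Folding a square along the antidiagonal\<close>

text \<open>
  Read \<open>P \<beta>\<close> as the sum over block \<open>\<beta>\<close> and \<open>P'\<close> as its dual, so that the hypothesis is the functional equation for
  blocks. Expand the square into products \<open>P \<beta> * cnj (P \<gamma>)\<close>. Those far above the antidiagonal are replaced, by two uses
  of the hypothesis, by products of values of \<open>P'\<close> below it, because \<open>W * cnj W = 1\<close>; this gives the second error term. The five
  antidiagonals between remain and give the first.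
\<close>

lemma square_expansion_error:
  fixes P P' :: "nat \<Rightarrow> complex"
  assumes W: "norm W = 1" and \<epsilon>: "\<And>\<beta>. \<beta> \<le> N \<Longrightarrow> norm (P \<beta> - W * cnj (P' (N - \<beta>))) \<le> \<epsilon>"
  shows "norm ((\<Sum>\<beta>\<le>N. P \<beta>) * cnj (\<Sum>\<beta>\<le>N. P \<beta>) -
      (\<Sum>(\<beta>, \<gamma>) | \<beta> + \<gamma> + 3 \<le> N. P \<beta> * cnj (P \<gamma>) + P' \<beta> * cnj (P' \<gamma>)))
    \<le> (\<Sum>(\<beta>, \<gamma>)\<in>{(\<beta>, \<gamma>). \<beta> \<le> N \<and> \<gamma> \<le> N \<and> N < \<beta> + \<gamma> + 3 \<and> \<beta> + \<gamma> < N + 3}. norm (P \<beta>) * norm (P \<gamma>))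
      + (\<Sum>(\<beta>, \<gamma>)\<in>{..N} \<times> {..N}. \<epsilon> * (norm (P \<gamma>) + norm (P' \<beta>)))"
proof -
  (* A lies below the antidiagonal, U is its mirror image, and M is the strip between them. *)
  define A where "A = {(\<beta>, \<gamma>). \<beta> + \<gamma> + 3 \<le> N}"
  define M where "M = {(\<beta>, \<gamma>). \<beta> \<le> N \<and> \<gamma> \<le> N \<and> N < \<beta> + \<gamma> + 3 \<and> \<beta> + \<gamma> < N + 3}"
  define U where "U = {(\<beta>, \<gamma>). \<beta> \<le> N \<and> \<gamma> \<le> N \<and> N + 3 \<le> \<beta> + \<gamma>}"
  have sub: "A \<subseteq> {..N} \<times> {..N}" "M \<subseteq> {..N} \<times> {..N}" "U \<subseteq> {..N} \<times> {..N}"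
    by (auto simp: A_def M_def U_def)
  have fin: "finite A" "finite M" "finite U" using sub by (auto intro: finite_subset)
  have un: "{..N} \<times> {..N} = A \<union> (M \<union> U)" by (auto simp: A_def M_def U_def)
  have dj: "A \<inter> (M \<union> U) = {}" "M \<inter> U = {}" by (auto simp: A_def M_def U_def)
  have \<epsilon>0: "\<epsilon> \<ge> 0" using \<epsilon>[of 0] norm_ge_zero order_trans by blast
  define f where "f p = P (fst p) * cnj (P (snd p))" for p
  define h where "h p = cnj (P' (N - fst p)) * P' (N - snd p)" for p
  have "(\<Sum>\<beta>\<le>N. P \<beta>) * cnj (\<Sum>\<beta>\<le>N. P \<beta>) = (\<Sum>p\<in>{..N} \<times> {..N}. f p)"
    unfolding cnj_sum sum_product by (simp add: sum.cartesian_product f_def case_prod_unfold)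
  also have "\<dots> = (\<Sum>p\<in>A. f p) + ((\<Sum>p\<in>M. f p) + (\<Sum>p\<in>U. f p))"
    unfolding un using fin dj by (simp add: sum.union_disjoint)
  finally have exp: "(\<Sum>\<beta>\<le>N. P \<beta>) * cnj (\<Sum>\<beta>\<le>N. P \<beta>) = (\<Sum>p\<in>A. f p) + ((\<Sum>p\<in>M. f p) + (\<Sum>p\<in>U. f p))" .
  have hA: "(\<Sum>p\<in>A. P' (fst p) * cnj (P' (snd p))) = (\<Sum>p\<in>U. h p)"
    by (rule sum.reindex_bij_witness[of _ "\<lambda>p. (N - snd p, N - fst p)" "\<lambda>p. (N - snd p, N - fst p)"])
       (auto simp: A_def U_def h_def)
  have "(\<Sum>(\<beta>, \<gamma>)\<in>A. P \<beta> * cnj (P \<gamma>) + P' \<beta> * cnj (P' \<gamma>)) = (\<Sum>p\<in>A. f p) + (\<Sum>p\<in>U. h p)"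
    unfolding hA[symmetric] by (simp add: f_def case_prod_unfold sum.distrib)
  then have eq: "(\<Sum>\<beta>\<le>N. P \<beta>) * cnj (\<Sum>\<beta>\<le>N. P \<beta>) - (\<Sum>(\<beta>, \<gamma>)\<in>A. P \<beta> * cnj (P \<gamma>) + P' \<beta> * cnj (P' \<gamma>)) =
    (\<Sum>p\<in>M. f p) + (\<Sum>p\<in>U. f p - h p)"
    unfolding exp by (simp add: sum_subtractf)
  have "norm (\<Sum>p\<in>M. f p) \<le> (\<Sum>p\<in>M. norm (P (fst p)) * norm (P (snd p)))"
    by (rule sum_norm_le) (simp add: f_def norm_mult)
  moreover have "norm (\<Sum>p\<in>U. f p - h p) \<le> (\<Sum>p\<in>U. \<epsilon> * (norm (P (snd p)) + norm (P' (N - fst p))))"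
  proof (rule sum_norm_le)
    fix p assume "p \<in> U"
    then have p: "fst p \<le> N" "snd p \<le> N" by (auto simp: U_def)
    have WW: "W * cnj W = 1" using W by (simp flip: complex_norm_square)
    have "f p - h p = (P (fst p) - W * cnj (P' (N - fst p))) * cnj (P (snd p)) +
        W * cnj (P' (N - fst p)) * cnj (P (snd p) - W * cnj (P' (N - snd p)))
       + (W * cnj W - 1) * (cnj (P' (N - fst p)) * P' (N - snd p))"
      by (simp add: f_def h_def algebra_simps)
    then have "f p - h p = (P (fst p) - W * cnj (P' (N - fst p))) * cnj (P (snd p)) +
        W * cnj (P' (N - fst p)) * cnj (P (snd p) - W * cnj (P' (N - snd p)))" by (simp add: WW)
    then have "norm (f p - h p) \<le> norm (P (fst p) - W * cnj (P' (N - fst p))) * norm (P (snd p)) +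
        norm (P' (N - fst p)) * norm (P (snd p) - W * cnj (P' (N - snd p)))"
      by (metis (no_types, lifting) norm_triangle_ineq norm_mult complex_mod_cnj W mult_1)
    also have "\<dots> \<le> \<epsilon> * norm (P (snd p)) + norm (P' (N - fst p)) * \<epsilon>"
      using \<epsilon> p by (intro add_mono mult_left_mono mult_right_mono) auto
    finally show "norm (f p - h p) \<le> \<epsilon> * (norm (P (snd p)) + norm (P' (N - fst p)))"
      by (simp add: algebra_simps)
  qed
  moreover have "(\<Sum>p\<in>U. \<epsilon> * (norm (P (snd p)) + norm (P' (N - fst p)))) \<le>
      (\<Sum>p\<in>{..N} \<times> {..N}. \<epsilon> * (norm (P (snd p)) + norm (P' (N - fst p))))"
    using sub \<epsilon>0 by (intro sum_mono2) auto
  moreover have "(\<Sum>p\<in>{..N} \<times> {..N}. \<epsilon> * (norm (P (snd p)) + norm (P' (N - fst p)))) =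
     (\<Sum>p\<in>{..N} \<times> {..N}. \<epsilon> * (norm (P (snd p)) + norm (P' (fst p))))"
    by (rule sum.reindex_bij_witness[of _ "\<lambda>p. (N - fst p, snd p)" "\<lambda>p. (N - fst p, snd p)"]) auto
  ultimately have "norm ((\<Sum>p\<in>M. f p) + (\<Sum>p\<in>U. f p - h p)) \<le>
     (\<Sum>p\<in>M. norm (P (fst p)) * norm (P (snd p))) + (\<Sum>p\<in>{..N} \<times> {..N}. \<epsilon> * (norm (P (snd p)) + norm (P' (fst p))))"
    using norm_triangle_ineq[of "\<Sum>p\<in>M. f p" "\<Sum>p\<in>U. f p - h p"] by linarith
  then show ?thesis unfolding A_def[symmetric] M_def[symmetric] eq by (simp add: case_prod_unfold)
qed

lemma sum_squared_le:
  fixes f :: "'b \<Rightarrow> real"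
  shows "(\<Sum>x\<in>A. f x)\<^sup>2 \<le> real (card A) * (\<Sum>x\<in>A. (f x)\<^sup>2)"
  using sum_squared_le_sum_of_squares[of f A] by (simp add: mult.commute)

text \<open>
  The form needed for mean values: everything is expressed by fourth powers. The first error is a sum over \<open>O(N)\<close>
  pairs, so Cauchy's inequality costs only \<open>O(N)\<close>. In the second, the inequality of arithmetic and geometric means
  with the parameter \<open>t\<close> separates \<open>\<epsilon>\<close>, which is much smaller than \<open>P\<close> in the application, from \<open>P\<close> and \<open>P'\<close>.
\<close>

lemma square_expansion_error_squared:
  fixes P P' :: "nat \<Rightarrow> complex" and t :: real
  assumes W: "norm W = 1" and \<epsilon>: "\<And>\<beta>. \<beta> \<le> N \<Longrightarrow> norm (P \<beta> - W * cnj (P' (N - \<beta>))) \<le> \<epsilon>" and t: "t > 0"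
  shows "(norm ((\<Sum>\<beta>\<le>N. P \<beta>) * cnj (\<Sum>\<beta>\<le>N. P \<beta>) -
      (\<Sum>(\<beta>, \<gamma>) | \<beta> + \<gamma> + 3 \<le> N. P \<beta> * cnj (P \<gamma>) + P' \<beta> * cnj (P' \<gamma>))))\<^sup>2
    \<le> 50 * real (N + 1) * (\<Sum>\<beta>\<le>N. norm (P \<beta>) ^ 4) +
      4 * real (N + 1) ^ 3 * (real (N + 1) * t * \<epsilon> ^ 4 + (\<Sum>\<beta>\<le>N. norm (P \<beta>) ^ 4 + norm (P' \<beta>) ^ 4) / t)"
proof -
  define M where "M = {(\<beta>, \<gamma>). \<beta> \<le> N \<and> \<gamma> \<le> N \<and> N < \<beta> + \<gamma> + 3 \<and> \<beta> + \<gamma> < N + 3}"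
  define X where "X = (\<Sum>p\<in>M. norm (P (fst p)) * norm (P (snd p)))"
  define Y where "Y = (\<Sum>p\<in>{..N} \<times> {..N}. \<epsilon> * (norm (P (snd p)) + norm (P' (fst p))))"
  have M_sub: "M \<subseteq> (\<Union>\<beta>\<in>{..N}. {\<beta>} \<times> {\<gamma>. N < \<beta> + \<gamma> + 3 \<and> \<beta> + \<gamma> < N + 3})" by (auto simp: M_def)
  have M_fin: "finite M" by (rule finite_subset[of _ "{..N} \<times> {..N}"]) (auto simp: M_def)
  have five: "finite {\<gamma>. N < \<beta> + \<gamma> + 3 \<and> \<beta> + \<gamma> < N + 3}" "card {\<gamma>. N < \<beta> + \<gamma> + 3 \<and> \<beta> + \<gamma> < N + 3} \<le> 5" for \<beta> :: nat
  proof -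
    have sub: "{\<gamma>. N < \<beta> + \<gamma> + 3 \<and> \<beta> + \<gamma> < N + 3} \<subseteq> {N - 2 - \<beta>..<N + 3 - \<beta>}" by auto
    then show "finite {\<gamma>. N < \<beta> + \<gamma> + 3 \<and> \<beta> + \<gamma> < N + 3}" by (rule finite_subset) auto
    from sub have "card {\<gamma>. N < \<beta> + \<gamma> + 3 \<and> \<beta> + \<gamma> < N + 3} \<le> card {N - 2 - \<beta>..<N + 3 - \<beta>}" by (intro card_mono) auto
    then show "card {\<gamma>. N < \<beta> + \<gamma> + 3 \<and> \<beta> + \<gamma> < N + 3} \<le> 5" by simp
  qed
  have row: "(\<Sum>p\<in>M. g (fst p)) \<le> 5 * (\<Sum>\<beta>\<le>N. g \<beta>)" if g: "\<And>\<beta>. g \<beta> \<ge> 0" for g :: "nat \<Rightarrow> real"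
  proof -
    define S where "S = (SIGMA \<beta>:{..N}. {\<gamma>. N < \<beta> + \<gamma> + 3 \<and> \<beta> + \<gamma> < N + 3})"
    have finS: "finite S" unfolding S_def using five by auto
    have "(\<Sum>p\<in>M. g (fst p)) \<le> (\<Sum>p\<in>S. g (fst p))"
      using finS g by (intro sum_mono2) (auto simp: S_def M_def)
    also have "\<dots> = (\<Sum>\<beta>\<le>N. \<Sum>\<gamma>\<in>{\<gamma>. N < \<beta> + \<gamma> + 3 \<and> \<beta> + \<gamma> < N + 3}. g \<beta>)"
      unfolding S_def using five by (subst sum.Sigma) (auto simp: case_prod_unfold)
    also have "\<dots> \<le> (\<Sum>\<beta>\<le>N. 5 * g \<beta>)"
      using five g by (intro sum_mono) (auto intro: mult_right_mono)
    finally show ?thesis by (simp add: sum_distrib_left)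
  qed
  have swap: "(\<Sum>p\<in>M. g (snd p)) = (\<Sum>p\<in>M. g (fst p))" for g :: "nat \<Rightarrow> real"
    by (rule sum.reindex_bij_witness[of _ prod.swap prod.swap]) (auto simp: M_def)
  have cardM: "real (card M) \<le> 5 * real (N + 1)" using row[of "\<lambda>_. 1"] by simp
  have XM: "X\<^sup>2 \<le> 25 * real (N + 1) * (\<Sum>\<beta>\<le>N. norm (P \<beta>) ^ 4)"
  proof -
    have "X\<^sup>2 \<le> real (card M) * (\<Sum>p\<in>M. (norm (P (fst p)) * norm (P (snd p)))\<^sup>2)"
      unfolding X_def by (rule sum_squared_le)
    also have "(\<Sum>p\<in>M. (norm (P (fst p)) * norm (P (snd p)))\<^sup>2) \<le>
        (\<Sum>p\<in>M. norm (P (fst p)) ^ 4 / 2 + norm (P (snd p)) ^ 4 / 2)"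
    proof (rule sum_mono)
      fix p
      show "(norm (P (fst p)) * norm (P (snd p)))\<^sup>2 \<le> norm (P (fst p)) ^ 4 / 2 + norm (P (snd p)) ^ 4 / 2"
        using sum_squares_bound[of "norm (P (fst p)) ^ 2" "norm (P (snd p)) ^ 2"]
        by (simp add: power_mult_distrib flip: power_mult)
    qed
    also have "\<dots> = (\<Sum>p\<in>M. norm (P (fst p)) ^ 4)"
      by (simp add: sum.distrib swap[of "\<lambda>\<beta>. norm (P \<beta>) ^ 4"] flip: sum_divide_distrib)
    also have "\<dots> \<le> 5 * (\<Sum>\<beta>\<le>N. norm (P \<beta>) ^ 4)" by (rule row) simp
    finally have "X\<^sup>2 \<le> real (card M) * (5 * (\<Sum>\<beta>\<le>N. norm (P \<beta>) ^ 4))" by (simp add: mult_left_mono)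
    also have "\<dots> \<le> (5 * real (N + 1)) * (5 * (\<Sum>\<beta>\<le>N. norm (P \<beta>) ^ 4))"
      using cardM by (intro mult_right_mono) (auto intro: sum_nonneg)
    finally show ?thesis by (simp add: algebra_simps)
  qed
  have YY: "Y\<^sup>2 \<le> 2 * real (N + 1) ^ 3 * (real (N + 1) * t * \<epsilon> ^ 4 + (\<Sum>\<beta>\<le>N. norm (P \<beta>) ^ 4 + norm (P' \<beta>) ^ 4) / t)"
  proof -
    define c where "c = real (N + 1)"
    have cc: "real (card ({..N} \<times> {..N})) = c\<^sup>2"
      by (simp add: c_def card_cartesian_product power2_eq_square algebra_simps)
    have Y: "Y\<^sup>2 \<le> c\<^sup>2 * (\<Sum>p\<in>{..N} \<times> {..N}. (\<epsilon> * (norm (P (snd p)) + norm (P' (fst p))))\<^sup>2)"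
      unfolding Y_def cc[symmetric] by (rule sum_squared_le)
    have "(\<Sum>p\<in>{..N} \<times> {..N}. (\<epsilon> * (norm (P (snd p)) + norm (P' (fst p))))\<^sup>2) \<le>
      (\<Sum>p\<in>{..N} \<times> {..N}. 2 * (t * \<epsilon> ^ 4) + (norm (P (snd p)) ^ 4 + norm (P' (fst p)) ^ 4) / t)"
    proof (rule sum_mono)
      fix p
      define x y where "x = norm (P (snd p))" and "y = norm (P' (fst p))"
      have amgm: "\<epsilon>\<^sup>2 * z\<^sup>2 \<le> t * \<epsilon> ^ 4 / 2 + z ^ 4 / t / 2" for z :: real
      proof -
        have "0 \<le> (t * \<epsilon>\<^sup>2 - z\<^sup>2)\<^sup>2 / (2 * t)" using t by simp
        also have "\<dots> = t * \<epsilon> ^ 4 / 2 + z ^ 4 / t / 2 - \<epsilon>\<^sup>2 * z\<^sup>2"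
          using t by (simp add: power2_eq_square power4_eq_xxxx field_simps)
        finally show ?thesis by simp
      qed
      have "(\<epsilon> * (x + y))\<^sup>2 = \<epsilon>\<^sup>2 * (x + y)\<^sup>2" by (simp add: power_mult_distrib)
      also have "\<dots> \<le> \<epsilon>\<^sup>2 * (2 * x\<^sup>2 + 2 * y\<^sup>2)"
        using sum_squares_bound[of x y] by (intro mult_left_mono) (auto simp: power2_sum)
      also have "\<dots> \<le> 2 * (t * \<epsilon> ^ 4) + (x ^ 4 + y ^ 4) / t"
        using amgm[of x] amgm[of y] by (simp add: algebra_simps add_divide_distrib)
      finally show "(\<epsilon> * (norm (P (snd p)) + norm (P' (fst p))))\<^sup>2 \<le>
          2 * (t * \<epsilon> ^ 4) + (norm (P (snd p)) ^ 4 + norm (P' (fst p)) ^ 4) / t"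
        by (simp add: x_def y_def)
    qed
    also have "\<dots> = c\<^sup>2 * (2 * (t * \<epsilon> ^ 4)) +
        ((\<Sum>p\<in>{..N} \<times> {..N}. norm (P (snd p)) ^ 4) + (\<Sum>p\<in>{..N} \<times> {..N}. norm (P' (fst p)) ^ 4)) / t"
      unfolding cc[symmetric] by (simp add: sum.distrib flip: sum_divide_distrib)
    also have "(\<Sum>p\<in>{..N} \<times> {..N}. norm (P (snd p)) ^ 4) = c * (\<Sum>\<beta>\<le>N. norm (P \<beta>) ^ 4)"
    proof -
      have "(\<Sum>p\<in>{..N} \<times> {..N}. norm (P (snd p)) ^ 4) = (\<Sum>\<beta>\<le>N. \<Sum>\<gamma>\<le>N. norm (P \<gamma>) ^ 4)"
        unfolding sum.cartesian_product by (simp add: case_prod_unfold)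
      then show ?thesis by (simp add: c_def)
    qed
    also have "(\<Sum>p\<in>{..N} \<times> {..N}. norm (P' (fst p)) ^ 4) = c * (\<Sum>\<beta>\<le>N. norm (P' \<beta>) ^ 4)"
    proof -
      have "(\<Sum>p\<in>{..N} \<times> {..N}. norm (P' (fst p)) ^ 4) = (\<Sum>\<beta>\<le>N. \<Sum>\<gamma>\<le>N. norm (P' \<beta>) ^ 4)"
        unfolding sum.cartesian_product by (simp add: case_prod_unfold)
      then show ?thesis by (simp add: c_def sum_distrib_left)
    qed
    finally have inner: "(\<Sum>p\<in>{..N} \<times> {..N}. (\<epsilon> * (norm (P (snd p)) + norm (P' (fst p))))\<^sup>2) \<le>
      c\<^sup>2 * (2 * (t * \<epsilon> ^ 4)) + c * ((\<Sum>\<beta>\<le>N. norm (P \<beta>) ^ 4 + norm (P' \<beta>) ^ 4) / t)"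
      by (simp add: sum.distrib distrib_left add_divide_distrib)
    define S where "S = (\<Sum>\<beta>\<le>N. norm (P \<beta>) ^ 4 + norm (P' \<beta>) ^ 4) / t"
    have S0: "S \<ge> 0" unfolding S_def using t by (intro divide_nonneg_pos sum_nonneg) auto
    have c0: "c \<ge> 0" by (simp add: c_def)
    have "Y\<^sup>2 \<le> c\<^sup>2 * (c\<^sup>2 * (2 * (t * \<epsilon> ^ 4)) + c * S)"
      by (rule order_trans[OF Y mult_left_mono[OF inner[folded S_def]]]) simp
    also have "\<dots> = 2 * c ^ 3 * (c * t * \<epsilon> ^ 4) + c ^ 3 * S"
      by (simp add: power2_eq_square power3_eq_cube algebra_simps)
    also have "\<dots> \<le> 2 * c ^ 3 * (c * t * \<epsilon> ^ 4) + 2 * c ^ 3 * S"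
      using S0 c0 by (intro add_left_mono mult_right_mono) auto
    finally show ?thesis unfolding c_def[symmetric] S_def[symmetric] by (simp add: distrib_left)
  qed
  have "norm ((\<Sum>\<beta>\<le>N. P \<beta>) * cnj (\<Sum>\<beta>\<le>N. P \<beta>) -
      (\<Sum>(\<beta>, \<gamma>) | \<beta> + \<gamma> + 3 \<le> N. P \<beta> * cnj (P \<gamma>) + P' \<beta> * cnj (P' \<gamma>))) \<le> X + Y"
    using square_expansion_error[where P=P and P'=P' and N=N and \<epsilon>=\<epsilon>, OF W \<epsilon>] by (simp add: X_def Y_def M_def case_prod_unfold)
  then have "(norm ((\<Sum>\<beta>\<le>N. P \<beta>) * cnj (\<Sum>\<beta>\<le>N. P \<beta>) -
      (\<Sum>(\<beta>, \<gamma>) | \<beta> + \<gamma> + 3 \<le> N. P \<beta> * cnj (P \<gamma>) + P' \<beta> * cnj (P' \<gamma>))))\<^sup>2 \<le> (X + Y)\<^sup>2"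
    by (intro power_mono) auto
  also have "\<dots> \<le> 2 * X\<^sup>2 + 2 * Y\<^sup>2" using sum_squares_bound[of X Y] by (simp add: power2_sum)
  finally show ?thesis using XM YY by linarith
qed

text \<open>
  Both boundary terms and the sum over the differences of the monotone \<open>w\<close> contribute at most \<open>U * M\<close>.
\<close>

lemma summation_by_parts_bound:
  fixes w :: "nat \<Rightarrow> real" and \<nu> :: "nat \<Rightarrow> complex"
  assumes xy: "x \<le> y" and \<nu>: "\<And>j. x \<le> j \<Longrightarrow> j \<le> y \<Longrightarrow> norm (\<nu> j) \<le> U"
    and w: "\<And>j. x \<le> j \<Longrightarrow> j \<le> y \<Longrightarrow> 0 \<le> w j \<and> w j \<le> M"
    and mono: "(\<forall>j. w j \<le> w (Suc j)) \<or> (\<forall>j. w (Suc j) \<le> w j)"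
  shows "norm (\<Sum>k\<in>{x..<y}. of_real (w k) * (\<nu> (Suc k) - \<nu> k)) \<le> 3 * (U * M)"
proof -
  have U0: "U \<ge> 0" using \<nu>[of x] xy norm_ge_zero order_trans by blast
  have parts: "(\<Sum>k\<in>{x..<y}. of_real (w k) * (\<nu> (Suc k) - \<nu> k)) =
      of_real (w y) * \<nu> y - of_real (w x) * \<nu> x - (\<Sum>k\<in>{x..<y}. of_real (w (Suc k) - w k) * \<nu> (Suc k))"
    using xy by (induction y rule: dec_induct) (auto simp: algebra_simps)
  have var: "(\<Sum>k\<in>{x..<y}. \<bar>w (Suc k) - w k\<bar>) \<le> M"
    using mono
  proof
    assume *: "\<forall>j. w j \<le> w (Suc j)"
    then have "(\<Sum>k\<in>{x..<y}. \<bar>w (Suc k) - w k\<bar>) = (\<Sum>k\<in>{x..<y}. w (Suc k) - w k)" by simp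
    also have "\<dots> = w y - w x" by (rule sum_Suc_diff'[OF xy])
    also have "\<dots> \<le> M" using w[of x] w[of y] xy by simp
    finally show ?thesis .
  next
    assume *: "\<forall>j. w (Suc j) \<le> w j"
    then have "(\<Sum>k\<in>{x..<y}. \<bar>w (Suc k) - w k\<bar>) = - (\<Sum>k\<in>{x..<y}. w (Suc k) - w k)"
      by (simp flip: sum_negf)
    also have "\<dots> = w x - w y" using sum_Suc_diff'[OF xy, of w] by simp
    also have "\<dots> \<le> M" using w[of x] w[of y] xy by simp
    finally show ?thesis .
  qed
  have "norm (\<Sum>k\<in>{x..<y}. of_real (w (Suc k) - w k) * \<nu> (Suc k)) \<le> (\<Sum>k\<in>{x..<y}. \<bar>w (Suc k) - w k\<bar> * U)"
  proof (rule sum_norm_le)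
    fix k assume k: "k \<in> {x..<y}"
    show "norm (of_real (w (Suc k) - w k) * \<nu> (Suc k)) \<le> \<bar>w (Suc k) - w k\<bar> * U"
      unfolding norm_mult norm_of_real using k by (intro mult_left_mono \<nu>) auto
  qed
  also have "\<dots> = (\<Sum>k\<in>{x..<y}. \<bar>w (Suc k) - w k\<bar>) * U" by (rule sum_distrib_right[symmetric])
  also have "\<dots> \<le> M * U" using var U0 by (rule mult_right_mono)
  finally have 1: "norm (\<Sum>k\<in>{x..<y}. of_real (w (Suc k) - w k) * \<nu> (Suc k)) \<le> M * U" .
  have M0: "M \<ge> 0" using w[of x] xy by simp
  have 2: "norm (of_real (w j) * \<nu> j) \<le> M * U" if "j = x \<or> j = y" for j
    unfolding norm_mult norm_of_real using that w[of j] \<nu>[of j] xy M0 U0 by (intro mult_mono) auto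
  have "norm (a - b - c) \<le> norm a + norm b + norm c" for a b c :: complex
    using norm_triangle_ineq4[of "a - b" c] norm_triangle_ineq4[of a b] by linarith
  then show ?thesis unfolding parts using 1 2[of x] 2[of y] by (smt (verit) mult.commute)
qed

section \<open>Folding the fourth moment\<close>

text \<open>
  The first product is the weight of \<open>(a, b)\<close> itself; the second is that of its mirror image under
  \<open>k \<mapsto> n - 1 - k\<close>, moved onto \<open>(a, b)\<close> by the functional equation.
\<close>

definition fold_weight :: "nat \<Rightarrow> nat \<Rightarrow> nat \<Rightarrow> nat \<Rightarrow> real" where
  "fold_weight n m a b = real a ^ m * real b ^ m + real (n - 1 - a) ^ m * real (n - 1 - b) ^ m"

text \<open>
  The entry \<open>g\<close> together with \<open>g + i\<close>, \<open>g + j\<close> and \<open>h + i\<close> determines the quadruple.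
\<close>

lemma card_diagonal_index_le:
  assumes "finite J" "J \<subseteq> {..<n}"
  shows "card (diagonal_index (J \<times> J)) \<le> card J ^ 3 * n"
proof -
  define f :: "nat \<times> nat \<times> nat \<times> nat \<Rightarrow> nat \<times> nat \<times> nat \<times> nat"
    where "f = (\<lambda>(g, h, i, j). (g + i, g + j, h + i, g))"
  have "inj_on f (diagonal_index (J \<times> J))" by (auto simp: inj_on_def f_def)
  moreover have "f ` diagonal_index (J \<times> J) \<subseteq> J \<times> J \<times> J \<times> {..<n}"
    using assms(2) by (fastforce simp: f_def diagonal_index_def)
  ultimately have "card (diagonal_index (J \<times> J)) \<le> card (J \<times> J \<times> J \<times> {..<n})"
    using assms(1) by (intro card_inj_on_le) auto
  then show ?thesis by (simp add: card_cartesian_product power3_eq_cube mult_ac)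
qed

lemma fourth_power_sum_le: "(x + y) ^ 4 \<le> 8 * x ^ 4 + 8 * (y :: real) ^ 4"
proof -
  have "(x + y)\<^sup>2 \<le> 2 * x\<^sup>2 + 2 * y\<^sup>2" using sum_squares_bound[of x y] by (simp add: power2_sum)
  then have "((x + y)\<^sup>2)\<^sup>2 \<le> (2 * x\<^sup>2 + 2 * y\<^sup>2)\<^sup>2" by (intro power_mono) auto
  also have "\<dots> \<le> 2 * (2 * x\<^sup>2)\<^sup>2 + 2 * (2 * y\<^sup>2)\<^sup>2"
    using sum_squares_bound[of "2 * x\<^sup>2" "2 * y\<^sup>2"] by (simp add: power2_sum)
  finally show ?thesis by (simp add: power_mult_distrib flip: power_mult)
qed

context prime_modulus begin

definition nontrivial_chars :: "('a poly \<Rightarrow> complex) set" where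
  "nontrivial_chars = {\<psi> \<in> chars. \<psi> \<noteq> trivial_character Q}"

lemma nontrivial_chars_subset: "nontrivial_chars \<subseteq> chars" by (auto simp: nontrivial_chars_def)

lemma finite_nontrivial_chars [simp]: "finite nontrivial_chars"
  by (rule finite_subset[OF nontrivial_chars_subset]) simp

text \<open>
  The fourth power is the square of a bilinear form over \<open>J \<times> J\<close>, of which only the diagonal survives.
\<close>

lemma fourth_moment_short_sum:
  fixes u :: "nat \<Rightarrow> real"
  assumes J: "finite J" "\<And>k. k \<in> J \<Longrightarrow> 2 * k < degree Q" and u: "\<And>k. k \<in> J \<Longrightarrow> \<bar>u k\<bar> \<le> M" and M: "M \<ge> 0"
  shows "(\<Sum>\<psi>\<in>chars. norm (\<Sum>k\<in>J. of_real (u k) * lcoef \<psi> k) ^ 4)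
    \<le> real \<phi> * (M ^ 4 * (real (card J) ^ 3 * real (degree Q)))"
proof -
  have sub: "J \<subseteq> {..<degree Q}" using J(2) by fastforce
  have "(\<Sum>\<psi>\<in>chars. norm (\<Sum>k\<in>J. of_real (u k) * lcoef \<psi> k) ^ 4) =
    (\<Sum>\<psi>\<in>chars. (norm (bilinear_form (\<lambda>a b. u a * u b) (J \<times> J) \<psi>))\<^sup>2)"
  proof (rule sum.cong[OF refl])
    fix \<psi> :: "'a poly \<Rightarrow> complex"
    define z where "z = (\<Sum>k\<in>J. of_real (u k) * lcoef \<psi> k)"
    have "bilinear_form (\<lambda>a b. u a * u b) (J \<times> J) \<psi> = z * cnj z"
      unfolding z_def cnj_sum sum_product bilinear_form_def by (simp add: sum.cartesian_product mult_ac)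
    then have "(norm (bilinear_form (\<lambda>a b. u a * u b) (J \<times> J) \<psi>))\<^sup>2 = norm z ^ 4"
      by (simp add: norm_mult power2_eq_square power4_eq_xxxx)
    then show "norm (\<Sum>k\<in>J. of_real (u k) * lcoef \<psi> k) ^ 4 = (norm (bilinear_form (\<lambda>a b. u a * u b) (J \<times> J) \<psi>))\<^sup>2"
      by (simp add: z_def)
  qed
  also have "\<dots> = real \<phi> * (\<Sum>(g, h, i, j)\<in>diagonal_index (J \<times> J). u (g + i) * u (g + j) * (u (h + i) * u (h + j)) * coprime_density TYPE('a) i j)"
    by (rule mean_square_short) (use sub J in auto)
  also have "\<dots> \<le> real \<phi> * (\<Sum>p\<in>diagonal_index (J \<times> J). M ^ 4)"
  proof (intro mult_left_mono sum_mono)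
    fix p assume p: "p \<in> diagonal_index (J \<times> J)"
    obtain g h i j where pp: "p = (g, h, i, j)" by (metis prod.exhaust)
    have m: "g + i \<in> J" "g + j \<in> J" "h + i \<in> J" "h + j \<in> J" using p by (auto simp: pp diagonal_index_def)
    have "\<bar>u (g + i) * u (g + j) * (u (h + i) * u (h + j)) * coprime_density TYPE('a) i j\<bar> \<le> M * M * (M * M) * 1"
      unfolding abs_mult using m u M coprime_density_bounds[where 'a='a, of i j] by (intro mult_mono) auto
    then show "(case p of (g, h, i, j) \<Rightarrow> u (g + i) * u (g + j) * (u (h + i) * u (h + j)) * coprime_density TYPE('a) i j) \<le> M ^ 4"
      unfolding pp by (simp add: power4_eq_xxxx mult.assoc)
  qed simp
  also have "\<dots> = real \<phi> * (M ^ 4 * real (card (diagonal_index (J \<times> J))))" by simp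
  also have "\<dots> \<le> real \<phi> * (M ^ 4 * real (card J ^ 3 * degree Q))"
    using card_diagonal_index_le[OF J(1) sub] by (intro mult_left_mono of_nat_mono) auto
  finally show ?thesis by simp
qed

text \<open>
  A fourth moment that dominates the size of all short coefficients at once; its mean is only quadratic in
  \<open>degree Q\<close>.
\<close>

definition short_energy :: "('a poly \<Rightarrow> complex) \<Rightarrow> real" where
  "short_energy \<psi> = (\<Sum>i | 2 * i < degree Q. norm (lcoef \<psi> i) ^ 4)"

lemma finite_short [simp]: "finite {i. 2 * i < degree Q}"
  by (rule finite_subset[of _ "{..<degree Q}"]) auto

lemma short_energy_nonneg: "short_energy \<psi> \<ge> 0" by (auto simp: short_energy_def intro: sum_nonneg)

lemma mean_short_energy: "(\<Sum>\<psi>\<in>chars. short_energy \<psi>) \<le> real \<phi> * real (degree Q) ^ 2"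
proof -
  have "(\<Sum>\<psi>\<in>chars. short_energy \<psi>) = (\<Sum>i | 2 * i < degree Q. \<Sum>\<psi>\<in>chars. norm (lcoef \<psi> i) ^ 4)"
    unfolding short_energy_def by (rule sum.swap)
  also have "\<dots> \<le> (\<Sum>i | 2 * i < degree Q. real \<phi> * real (degree Q))"
  proof (rule sum_mono)
    fix i assume i: "i \<in> {i. 2 * i < degree Q}"
    have "(\<Sum>\<psi>\<in>chars. norm (\<Sum>k\<in>{i}. of_real 1 * lcoef \<psi> k) ^ 4) \<le> real \<phi> * (1 ^ 4 * (real (card {i}) ^ 3 * real (degree Q)))"
      by (rule fourth_moment_short_sum) (use i in auto)
    then show "(\<Sum>\<psi>\<in>chars. norm (lcoef \<psi> i) ^ 4) \<le> real \<phi> * real (degree Q)" by simp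
  qed
  also have "\<dots> = real (card {i. 2 * i < degree Q}) * (real \<phi> * real (degree Q))" by simp
  also have "\<dots> \<le> real (degree Q) * (real \<phi> * real (degree Q))"
  proof (rule mult_right_mono)
    have "card {i. 2 * i < degree Q} \<le> card {..<degree Q}" by (rule card_mono) auto
    then show "real (card {i. 2 * i < degree Q}) \<le> real (degree Q)" by simp
  qed simp
  finally show ?thesis by (simp add: power2_eq_square mult_ac)
qed

text \<open>
  The constant of \<open>approximate_functional_equation\<close> times the factor \<open>3\<close> of partial summation, to the fourth power.
\<close>

definition FE_const :: real where "FE_const = (3 * ((r + 1) / (r - 1))) ^ 4"

lemma FE_const_nonneg: "FE_const \<ge> 0" by (simp add: FE_const_def)

definition block_sum :: "nat \<Rightarrow> nat \<Rightarrow> ('a poly \<Rightarrow> complex) \<Rightarrow> nat \<Rightarrow> complex" where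
  "block_sum m K \<psi> \<beta> = (\<Sum>k\<in>block (degree Q) K \<beta>. of_real (real k ^ m) * lcoef \<psi> k)"

text \<open>
  The reflection \<open>k \<mapsto> degree Q - 1 - k\<close> carries \<open>block_sum\<close> over block \<open>2 * K - \<beta>\<close> to this sum over block \<open>\<beta>\<close>.
\<close>

definition dual_block_sum :: "nat \<Rightarrow> nat \<Rightarrow> ('a poly \<Rightarrow> complex) \<Rightarrow> nat \<Rightarrow> complex" where
  "dual_block_sum m K \<psi> \<beta> = (\<Sum>k\<in>block (degree Q) K \<beta>. of_real (real (degree Q - 1 - k) ^ m) * lcoef \<psi> k)"

lemma block_reflect_sum:
  assumes K: "K > 0" and \<beta>: "\<beta> \<le> 2 * K"
  shows "(\<Sum>k\<in>block n K (2 * K - \<beta>). f k) = (\<Sum>k\<in>block n K \<beta>. f (n - 1 - k))"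
proof -
  have c: "cut_point n K (2 * K - \<beta>) = n - cut_point n K (Suc \<beta>)"
    "cut_point n K (Suc (2 * K - \<beta>)) = n - cut_point n K \<beta>"
    using cut_reflect[of "Suc \<beta>" K n] cut_reflect[of \<beta> K n] \<beta> by (simp_all add: Suc_diff_le)
  have le: "cut_point n K (Suc \<beta>) \<le> n" using cut_mono[OF K, of "Suc \<beta>" "2 * K + 1" n] \<beta> by (simp add: cut_last)
  show ?thesis
    by (rule sum.reindex_bij_witness[of _ "\<lambda>k. n - 1 - k" "\<lambda>k. n - 1 - k"])
       (use le in \<open>auto simp: block_def c\<close>)
qed

text \<open>
  Over a block, the telescoping error of \<open>approximate_functional_equation\<close> is summed by parts against the monotone weight
  \<open>k^m\<close>, so no factor for the length of the block is lost.
\<close>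

lemma block_functional_equation:
  assumes \<psi>: "\<psi> \<in> nontrivial_chars" and K: "K > 0"
  obtains W \<epsilon> where "norm W = 1" "\<epsilon> \<ge> 0" "\<epsilon> ^ 4 = FE_const * real (degree Q) ^ (4 * m) * short_energy \<psi>"
    "\<And>\<beta>. \<beta> \<le> 2 * K \<Longrightarrow> norm (block_sum m K \<psi> \<beta> - W * cnj (dual_block_sum m K \<psi> (2 * K - \<beta>))) \<le> \<epsilon>"
    "\<And>\<beta>. \<beta> \<le> 2 * K \<Longrightarrow> norm (dual_block_sum m K \<psi> \<beta> - W * cnj (block_sum m K \<psi> (2 * K - \<beta>))) \<le> \<epsilon>"
proof -
  define n where "n = degree Q"
  have n: "n > 0" using deg_pos by (simp add: n_def)
  obtain W \<nu> where W: "norm W = 1"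
    "\<And>k. k < degree Q \<Longrightarrow> lcoef \<psi> k - W * cnj (lcoef \<psi> (degree Q - 1 - k)) = \<nu> (Suc k) - \<nu> k"
    "\<And>V j. (\<And>i. 2 * i < degree Q \<Longrightarrow> norm (lcoef \<psi> i) \<le> V) \<Longrightarrow> j \<le> degree Q \<Longrightarrow>
      norm (\<nu> j) \<le> (r + 1) / (r - 1) * V"
    by (rule approximate_functional_equation[of \<psi>]) (use \<psi> in \<open>auto simp: nontrivial_chars_def\<close>)
  define V where "V = root 4 (short_energy \<psi>)"
  have V0: "V \<ge> 0" using short_energy_nonneg by (simp add: V_def real_root_ge_zero)
  have V4: "V ^ 4 = short_energy \<psi>" unfolding V_def using short_energy_nonneg by (intro real_root_pow_pos2) auto
  have V: "norm (lcoef \<psi> i) \<le> V" if "2 * i < degree Q" for i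
  proof -
    have "norm (lcoef \<psi> i) ^ 4 \<le> V ^ 4"
      unfolding V4 short_energy_def using that by (intro member_le_sum) auto
    then show ?thesis using V0 by (simp add: power_mono_iff)
  qed
  define U where "U = (r + 1) / (r - 1) * V"
  have \<nu>: "norm (\<nu> j) \<le> U" if "j \<le> n" for j unfolding U_def using W(3)[OF V] that by (simp add: n_def)
  define \<epsilon> where "\<epsilon> = 3 * (U * real n ^ m)"
  have U0: "U \<ge> 0" using V0 r_gt_1 by (simp add: U_def)
  have main: "norm (\<Sum>k\<in>block n K \<beta>. of_real (w k) * (lcoef \<psi> k - W * cnj (lcoef \<psi> (n - 1 - k)))) \<le> \<epsilon>"
    if \<beta>: "\<beta> \<le> 2 * K" and w: "\<And>k. k \<le> n \<Longrightarrow> 0 \<le> w k \<and> w k \<le> real n ^ m"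
    and mono: "(\<forall>j. w j \<le> w (Suc j)) \<or> (\<forall>j. w (Suc j) \<le> w j)" for \<beta> w
  proof -
    have le: "cut_point n K (Suc \<beta>) \<le> n" using cut_mono[OF K, of "Suc \<beta>" "2 * K + 1" n] \<beta> by (simp add: cut_last)
    have "(\<Sum>k\<in>block n K \<beta>. of_real (w k) * (lcoef \<psi> k - W * cnj (lcoef \<psi> (n - 1 - k)))) =
      (\<Sum>k\<in>{cut_point n K \<beta>..<cut_point n K (Suc \<beta>)}. of_real (w k) * (\<nu> (Suc k) - \<nu> k))"
      unfolding block_def using le W(2) by (intro sum.cong refl) (simp add: n_def)
    also have "norm \<dots> \<le> 3 * (U * real n ^ m)"
      by (rule summation_by_parts_bound) (use cut_step(1)[OF K \<beta>, of n] le \<nu> w mono in auto)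
    finally show ?thesis by (simp add: \<epsilon>_def)
  qed
  have mono1: "real k ^ m \<le> real (Suc k) ^ m" for k by (intro power_mono) auto
  have mono2: "real (n - 1 - Suc k) ^ m \<le> real (n - 1 - k) ^ m" for k by (intro power_mono) auto
  show ?thesis
  proof (rule that[OF W(1)])
    show "\<epsilon> \<ge> 0" using U0 by (simp add: \<epsilon>_def)
    have "\<epsilon> ^ 4 = (3 * ((r + 1) / (r - 1))) ^ 4 * V ^ 4 * (real n ^ m) ^ 4"
      by (simp only: \<epsilon>_def U_def power_mult_distrib mult_ac)
    then show "\<epsilon> ^ 4 = FE_const * real (degree Q) ^ (4 * m) * short_energy \<psi>"
      by (simp add: V4 FE_const_def n_def mult_ac flip: power_mult)
  next
    fix \<beta> assume \<beta>: "\<beta> \<le> 2 * K"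
    have "dual_block_sum m K \<psi> (2 * K - \<beta>) = (\<Sum>k\<in>block n K \<beta>. of_real (real (n - 1 - (n - 1 - k)) ^ m) * lcoef \<psi> (n - 1 - k))"
      unfolding dual_block_sum_def n_def[symmetric] by (rule block_reflect_sum[OF K \<beta>])
    also have "\<dots> = (\<Sum>k\<in>block n K \<beta>. of_real (real k ^ m) * lcoef \<psi> (n - 1 - k))"
      using block_subset[OF K \<beta>, of n] by (intro sum.cong refl) auto
    finally have d: "dual_block_sum m K \<psi> (2 * K - \<beta>) = (\<Sum>k\<in>block n K \<beta>. of_real (real k ^ m) * lcoef \<psi> (n - 1 - k))" .
    have "block_sum m K \<psi> \<beta> - W * cnj (dual_block_sum m K \<psi> (2 * K - \<beta>)) =
      (\<Sum>k\<in>block n K \<beta>. of_real (real k ^ m) * (lcoef \<psi> k - W * cnj (lcoef \<psi> (n - 1 - k))))"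
      unfolding d block_sum_def n_def[symmetric] by (simp add: algebra_simps sum_subtractf sum_distrib_left)
    moreover have "norm \<dots> \<le> \<epsilon>"
      by (rule main[OF \<beta>]) (use mono1 in \<open>auto intro!: power_mono\<close>)
    ultimately show "norm (block_sum m K \<psi> \<beta> - W * cnj (dual_block_sum m K \<psi> (2 * K - \<beta>))) \<le> \<epsilon>" by simp
    have d: "block_sum m K \<psi> (2 * K - \<beta>) = (\<Sum>k\<in>block n K \<beta>. of_real (real (n - 1 - k) ^ m) * lcoef \<psi> (n - 1 - k))"
      unfolding block_sum_def n_def[symmetric] by (rule block_reflect_sum[OF K \<beta>])
    have "dual_block_sum m K \<psi> \<beta> - W * cnj (block_sum m K \<psi> (2 * K - \<beta>)) =
      (\<Sum>k\<in>block n K \<beta>. of_real (real (n - 1 - k) ^ m) * (lcoef \<psi> k - W * cnj (lcoef \<psi> (n - 1 - k))))"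
      unfolding d dual_block_sum_def n_def[symmetric] by (simp add: algebra_simps sum_subtractf sum_distrib_left)
    moreover have "norm \<dots> \<le> \<epsilon>"
      by (rule main[OF \<beta>]) (use mono2 in \<open>auto intro!: power_mono\<close>)
    ultimately show "norm (dual_block_sum m K \<psi> \<beta> - W * cnj (block_sum m K \<psi> (2 * K - \<beta>))) \<le> \<epsilon>" by simp
  qed
qed

definition block_bound :: "nat \<Rightarrow> nat \<Rightarrow> real" where
  "block_bound m K = 8 * (real (degree Q) ^ (4 * m + 1) * real (block_width (degree Q) K + 1) ^ 3)
     + 8 * (FE_const * real (degree Q) ^ (4 * m + 2))"

lemma lower_block_moment:
  assumes K: "K > 0" and \<beta>: "\<beta> \<le> K"
  shows "(\<Sum>\<psi>\<in>nontrivial_chars. norm (block_sum m K \<psi> \<beta>) ^ 4) \<le> real \<phi> * (real (degree Q) ^ (4 * m + 1) * real (block_width (degree Q) K + 1) ^ 3)"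
    "(\<Sum>\<psi>\<in>nontrivial_chars. norm (dual_block_sum m K \<psi> \<beta>) ^ 4) \<le> real \<phi> * (real (degree Q) ^ (4 * m + 1) * real (block_width (degree Q) K + 1) ^ 3)"
proof -
  have gen: "(\<Sum>\<psi>\<in>nontrivial_chars. norm (\<Sum>k\<in>block (degree Q) K \<beta>. of_real (u k) * lcoef \<psi> k) ^ 4)
      \<le> real \<phi> * (real (degree Q) ^ (4 * m + 1) * real (block_width (degree Q) K + 1) ^ 3)"
    if u: "\<And>k. k < degree Q \<Longrightarrow> \<bar>u k\<bar> \<le> real (degree Q) ^ m" for u
  proof -
    have "(\<Sum>\<psi>\<in>nontrivial_chars. norm (\<Sum>k\<in>block (degree Q) K \<beta>. of_real (u k) * lcoef \<psi> k) ^ 4) \<le>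
      (\<Sum>\<psi>\<in>chars. norm (\<Sum>k\<in>block (degree Q) K \<beta>. of_real (u k) * lcoef \<psi> k) ^ 4)"
      by (rule sum_mono2) (auto simp: nontrivial_chars_def)
    also have "\<dots> \<le> real \<phi> * ((real (degree Q) ^ m) ^ 4 * (real (card (block (degree Q) K \<beta>)) ^ 3 * real (degree Q)))"
      by (rule fourth_moment_short_sum) (use u block_lower[OF K \<beta>] block_subset[OF K, of \<beta> "degree Q"] \<beta> in auto)
    also have "\<dots> \<le> real \<phi> * ((real (degree Q) ^ m) ^ 4 * (real (block_width (degree Q) K + 1) ^ 3 * real (degree Q)))"
      using card_block[OF K, of \<beta> "degree Q"] \<beta> by (intro mult_left_mono mult_right_mono power_mono) auto
    finally show ?thesis by (simp add: power_add mult_ac flip: power_mult)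
  qed
  show "(\<Sum>\<psi>\<in>nontrivial_chars. norm (block_sum m K \<psi> \<beta>) ^ 4) \<le> real \<phi> * (real (degree Q) ^ (4 * m + 1) * real (block_width (degree Q) K + 1) ^ 3)"
    unfolding block_sum_def by (rule gen) (auto intro: power_mono)
  show "(\<Sum>\<psi>\<in>nontrivial_chars. norm (dual_block_sum m K \<psi> \<beta>) ^ 4) \<le> real \<phi> * (real (degree Q) ^ (4 * m + 1) * real (block_width (degree Q) K + 1) ^ 3)"
    unfolding dual_block_sum_def by (rule gen) (auto intro: power_mono)
qed

text \<open>
  Blocks in the lower half are short sums. The functional equation carries the upper half to the
  lower one, at the price of the short energy.
\<close>

lemma block_moment:
  assumes K: "K > 0" and \<beta>: "\<beta> \<le> 2 * K"
  shows "(\<Sum>\<psi>\<in>nontrivial_chars. norm (block_sum m K \<psi> \<beta>) ^ 4) \<le> real \<phi> * block_bound m K"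
    "(\<Sum>\<psi>\<in>nontrivial_chars. norm (dual_block_sum m K \<psi> \<beta>) ^ 4) \<le> real \<phi> * block_bound m K"
proof -
  define B where "B = real (degree Q) ^ (4 * m + 1) * real (block_width (degree Q) K + 1) ^ 3"
  have B0: "B \<ge> 0" by (simp add: B_def)
  have "0 \<le> FE_const * real (degree Q) ^ (4 * m + 2)" using FE_const_nonneg by simp
  then have BB: "B \<le> block_bound m K" using B0 unfolding block_bound_def B_def[symmetric] by linarith
  have energy: "(\<Sum>\<psi>\<in>nontrivial_chars. short_energy \<psi>) \<le> real \<phi> * real (degree Q) ^ 2"
  proof -
    have "(\<Sum>\<psi>\<in>nontrivial_chars. short_energy \<psi>) \<le> (\<Sum>\<psi>\<in>chars. short_energy \<psi>)"
      using short_energy_nonneg by (intro sum_mono2) (auto simp: nontrivial_chars_def)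
    then show ?thesis using mean_short_energy by linarith
  qed
  have gen: "(\<Sum>\<psi>\<in>nontrivial_chars. norm (X \<psi>) ^ 4) \<le> real \<phi> * block_bound m K"
    if X: "\<And>\<psi>. \<psi> \<in> nontrivial_chars \<Longrightarrow> norm (X \<psi>) ^ 4 \<le> 8 * norm (Y \<psi>) ^ 4 + 8 * (FE_const * real (degree Q) ^ (4 * m) * short_energy \<psi>)"
    and Y: "(\<Sum>\<psi>\<in>nontrivial_chars. norm (Y \<psi>) ^ 4) \<le> real \<phi> * B" for X Y :: "('a poly \<Rightarrow> complex) \<Rightarrow> complex"
  proof -
    have "(\<Sum>\<psi>\<in>nontrivial_chars. norm (X \<psi>) ^ 4) \<le>
      (\<Sum>\<psi>\<in>nontrivial_chars. 8 * norm (Y \<psi>) ^ 4 + 8 * (FE_const * real (degree Q) ^ (4 * m) * short_energy \<psi>))"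
      by (rule sum_mono) (rule X)
    also have "\<dots> = 8 * (\<Sum>\<psi>\<in>nontrivial_chars. norm (Y \<psi>) ^ 4) + 8 * (FE_const * real (degree Q) ^ (4 * m) * (\<Sum>\<psi>\<in>nontrivial_chars. short_energy \<psi>))"
      by (simp add: sum.distrib sum_distrib_left)
    also have "\<dots> \<le> 8 * (real \<phi> * B) + 8 * (FE_const * real (degree Q) ^ (4 * m) * (real \<phi> * real (degree Q) ^ 2))"
      using Y energy FE_const_nonneg by (intro add_mono mult_left_mono) auto
    also have "\<dots> = real \<phi> * block_bound m K" by (simp add: block_bound_def B_def power_add power2_eq_square algebra_simps)
    finally show ?thesis .
  qed
  have FE: "norm (block_sum m K \<psi> \<beta>) ^ 4 \<le> 8 * norm (dual_block_sum m K \<psi> (2 * K - \<beta>)) ^ 4 + 8 * (FE_const * real (degree Q) ^ (4 * m) * short_energy \<psi>)"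
    "norm (dual_block_sum m K \<psi> \<beta>) ^ 4 \<le> 8 * norm (block_sum m K \<psi> (2 * K - \<beta>)) ^ 4 + 8 * (FE_const * real (degree Q) ^ (4 * m) * short_energy \<psi>)"
    if \<psi>: "\<psi> \<in> nontrivial_chars" for \<psi>
  proof -
    obtain W \<epsilon> where W: "norm W = 1" "\<epsilon> \<ge> 0" "\<epsilon> ^ 4 = FE_const * real (degree Q) ^ (4 * m) * short_energy \<psi>"
      "\<And>\<beta>. \<beta> \<le> 2 * K \<Longrightarrow> norm (block_sum m K \<psi> \<beta> - W * cnj (dual_block_sum m K \<psi> (2 * K - \<beta>))) \<le> \<epsilon>"
      "\<And>\<beta>. \<beta> \<le> 2 * K \<Longrightarrow> norm (dual_block_sum m K \<psi> \<beta> - W * cnj (block_sum m K \<psi> (2 * K - \<beta>))) \<le> \<epsilon>"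
      by (rule block_functional_equation[OF \<psi> K, of m]) (rule that)
    have step: "norm x ^ 4 \<le> 8 * norm y ^ 4 + 8 * \<epsilon> ^ 4" if "norm (x - W * cnj y) \<le> \<epsilon>" for x y
    proof -
      have "norm x \<le> norm (W * cnj y) + norm (x - W * cnj y)" using norm_triangle_ineq[of "W * cnj y" "x - W * cnj y"] by simp
      then have "norm x \<le> norm y + \<epsilon>" using that W(1) by (simp add: norm_mult)
      then have "norm x ^ 4 \<le> (norm y + \<epsilon>) ^ 4" by (intro power_mono) auto
      then show ?thesis using fourth_power_sum_le[of "norm y" \<epsilon>] by linarith
    qed
    show "norm (block_sum m K \<psi> \<beta>) ^ 4 \<le> 8 * norm (dual_block_sum m K \<psi> (2 * K - \<beta>)) ^ 4 + 8 * (FE_const * real (degree Q) ^ (4 * m) * short_energy \<psi>)"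
      "norm (dual_block_sum m K \<psi> \<beta>) ^ 4 \<le> 8 * norm (block_sum m K \<psi> (2 * K - \<beta>)) ^ 4 + 8 * (FE_const * real (degree Q) ^ (4 * m) * short_energy \<psi>)"
      using step[OF W(4)[OF \<beta>]] step[OF W(5)[OF \<beta>]] by (simp_all only: W(3))
  qed
  have "\<beta> \<le> K \<or> 2 * K - \<beta> \<le> K" by linarith
  then show "(\<Sum>\<psi>\<in>nontrivial_chars. norm (block_sum m K \<psi> \<beta>) ^ 4) \<le> real \<phi> * block_bound m K"
  proof
    assume "\<beta> \<le> K"
    from lower_block_moment(1)[OF K this, of m] show ?thesis
      using BB unfolding B_def[symmetric] by (meson mult_left_mono of_nat_0_le_iff order_trans)
  next
    assume "2 * K - \<beta> \<le> K"
    from lower_block_moment(2)[OF K this, of m] show ?thesis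
      unfolding B_def[symmetric] by (intro gen[OF FE(1)])
  qed
  have "\<beta> \<le> K \<or> 2 * K - \<beta> \<le> K" by linarith
  then show "(\<Sum>\<psi>\<in>nontrivial_chars. norm (dual_block_sum m K \<psi> \<beta>) ^ 4) \<le> real \<phi> * block_bound m K"
  proof
    assume "\<beta> \<le> K"
    from lower_block_moment(2)[OF K this, of m] show ?thesis
      using BB unfolding B_def[symmetric] by (meson mult_left_mono of_nat_0_le_iff order_trans)
  next
    assume "2 * K - \<beta> \<le> K"
    from lower_block_moment(1)[OF K this, of m] show ?thesis
      unfolding B_def[symmetric] by (intro gen[OF FE(2)])
  qed
qed

definition central_sum :: "nat \<Rightarrow> ('a poly \<Rightarrow> complex) \<Rightarrow> complex" where
  "central_sum m \<psi> = (\<Sum>k<degree Q. of_real (real k ^ m) * lcoef \<psi> k)"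

text \<open>
  With \<open>w\<close> the block width, \<open>block_bound\<close> has the order \<open>n^(4m+4) (w/n)^3\<close> for large \<open>n = degree Q\<close>, and \<open>w/n\<close> is about
  \<open>1 / (2K)\<close>. So the first term has the order \<open>n^(4m+4) / K\<close>, and the others are of lower order in \<open>n\<close>.
\<close>

definition folding_error :: "nat \<Rightarrow> nat \<Rightarrow> real" where
  "folding_error m K = 50 * real (2 * K + 1) ^ 2 * block_bound m K +
     4 * real (2 * K + 1) ^ 3 * (real (2 * K + 1) * real (degree Q) * (FE_const * real (degree Q) ^ (4 * m + 2))
       + 2 * real (2 * K + 1) * block_bound m K / real (degree Q))"

text \<open>
  Average \<open>square_expansion_error_squared\<close> over the characters, with \<open>t = degree Q\<close>: the fourth power of \<open>\<epsilon>\<close> is smaller than that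
  of the block sums by two powers of \<open>degree Q\<close>, so this choice makes both of its error terms negligible.
\<close>

lemma folding_mean_square:
  assumes K: "K > 0"
  shows "(\<Sum>\<psi>\<in>nontrivial_chars. (norm (central_sum m \<psi> * cnj (central_sum m \<psi>) -
      bilinear_form (fold_weight (degree Q) m) (below_antidiagonal (degree Q) K) \<psi>))\<^sup>2) \<le> real \<phi> * folding_error m K"
proof -
  define N where "N = 2 * K"
  define n where "n = real (degree Q)"
  have n: "n > 0" using deg_pos by (simp add: n_def)
  define P where "P \<psi> \<beta> = block_sum m K \<psi> \<beta>" for \<psi> \<beta>
  define P' where "P' \<psi> \<beta> = dual_block_sum m K \<psi> \<beta>" for \<psi> \<beta>
  have pointwise: "(norm (central_sum m \<psi> * cnj (central_sum m \<psi>) -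
      bilinear_form (fold_weight (degree Q) m) (below_antidiagonal (degree Q) K) \<psi>))\<^sup>2 \<le>
      50 * real (N + 1) * (\<Sum>\<beta>\<le>N. norm (P \<psi> \<beta>) ^ 4) +
      4 * real (N + 1) ^ 3 * (real (N + 1) * n * (FE_const * n ^ (4 * m) * short_energy \<psi>) +
        (\<Sum>\<beta>\<le>N. norm (P \<psi> \<beta>) ^ 4 + norm (P' \<psi> \<beta>) ^ 4) / n)"
    if \<psi>: "\<psi> \<in> nontrivial_chars" for \<psi>
  proof -
    obtain W \<epsilon> where W: "norm W = 1" "\<epsilon> \<ge> 0" "\<epsilon> ^ 4 = FE_const * real (degree Q) ^ (4 * m) * short_energy \<psi>"
      "\<And>\<beta>. \<beta> \<le> 2 * K \<Longrightarrow> norm (block_sum m K \<psi> \<beta> - W * cnj (dual_block_sum m K \<psi> (2 * K - \<beta>))) \<le> \<epsilon>"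
      "\<And>\<beta>. \<beta> \<le> 2 * K \<Longrightarrow> norm (dual_block_sum m K \<psi> \<beta> - W * cnj (block_sum m K \<psi> (2 * K - \<beta>))) \<le> \<epsilon>"
      by (rule block_functional_equation[OF \<psi> K, of m]) (rule that)
    have c: "central_sum m \<psi> = (\<Sum>\<beta>\<le>N. P \<psi> \<beta>)"
      unfolding central_sum_def P_def block_sum_def N_def by (rule sum_blocks[OF K])
    have "bilinear_form (fold_weight (degree Q) m) (below_antidiagonal (degree Q) K) \<psi> =
      (\<Sum>(\<beta>, \<gamma>) | \<beta> + \<gamma> + 3 \<le> N. \<Sum>a\<in>block (degree Q) K \<beta>. \<Sum>b\<in>block (degree Q) K \<gamma>.
        of_real (fold_weight (degree Q) m a b) * lcoef \<psi> a * cnj (lcoef \<psi> b))"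
      unfolding bilinear_form_def N_def by (rule sum_below_antidiagonal[OF K])
    also have "\<dots> = (\<Sum>(\<beta>, \<gamma>) | \<beta> + \<gamma> + 3 \<le> N. P \<psi> \<beta> * cnj (P \<psi> \<gamma>) + P' \<psi> \<beta> * cnj (P' \<psi> \<gamma>))"
    proof (rule sum.cong[OF refl], clarify)
      fix \<beta> \<gamma>
      show "(\<Sum>a\<in>block (degree Q) K \<beta>. \<Sum>b\<in>block (degree Q) K \<gamma>. of_real (fold_weight (degree Q) m a b) * lcoef \<psi> a * cnj (lcoef \<psi> b))
          = P \<psi> \<beta> * cnj (P \<psi> \<gamma>) + P' \<psi> \<beta> * cnj (P' \<psi> \<gamma>)"
        unfolding P_def P'_def block_sum_def dual_block_sum_def cnj_sum sum_product
        by (simp add: fold_weight_def algebra_simps flip: sum.distrib)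
    qed
    finally have b: "bilinear_form (fold_weight (degree Q) m) (below_antidiagonal (degree Q) K) \<psi> =
      (\<Sum>(\<beta>, \<gamma>) | \<beta> + \<gamma> + 3 \<le> N. P \<psi> \<beta> * cnj (P \<psi> \<gamma>) + P' \<psi> \<beta> * cnj (P' \<psi> \<gamma>))" .
    have eps: "norm (P \<psi> \<beta> - W * cnj (P' \<psi> (N - \<beta>))) \<le> \<epsilon>" if "\<beta> \<le> N" for \<beta>
      using W(4)[of \<beta>] that by (simp add: P_def P'_def N_def)
    show ?thesis
      unfolding c b using square_expansion_error_squared[where P="P \<psi>" and P'="P' \<psi>" and N=N and t=n, OF W(1) eps n]
      unfolding W(3) n_def by simp
  qed
  have sumP: "(\<Sum>\<psi>\<in>nontrivial_chars. \<Sum>\<beta>\<le>N. norm (P \<psi> \<beta>) ^ 4) \<le> real (N + 1) * (real \<phi> * block_bound m K)"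
    "(\<Sum>\<psi>\<in>nontrivial_chars. \<Sum>\<beta>\<le>N. norm (P' \<psi> \<beta>) ^ 4) \<le> real (N + 1) * (real \<phi> * block_bound m K)"
  proof -
    have "(\<Sum>\<psi>\<in>nontrivial_chars. \<Sum>\<beta>\<le>N. norm (P \<psi> \<beta>) ^ 4) = (\<Sum>\<beta>\<le>N. \<Sum>\<psi>\<in>nontrivial_chars. norm (P \<psi> \<beta>) ^ 4)"
      by (rule sum.swap)
    also have "\<dots> \<le> (\<Sum>\<beta>\<le>N. real \<phi> * block_bound m K)"
      unfolding P_def N_def by (intro sum_mono block_moment(1)[OF K]) simp
    finally show "(\<Sum>\<psi>\<in>nontrivial_chars. \<Sum>\<beta>\<le>N. norm (P \<psi> \<beta>) ^ 4) \<le> real (N + 1) * (real \<phi> * block_bound m K)" by simp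
    have "(\<Sum>\<psi>\<in>nontrivial_chars. \<Sum>\<beta>\<le>N. norm (P' \<psi> \<beta>) ^ 4) = (\<Sum>\<beta>\<le>N. \<Sum>\<psi>\<in>nontrivial_chars. norm (P' \<psi> \<beta>) ^ 4)"
      by (rule sum.swap)
    also have "\<dots> \<le> (\<Sum>\<beta>\<le>N. real \<phi> * block_bound m K)"
      unfolding P'_def N_def by (intro sum_mono block_moment(2)[OF K]) simp
    finally show "(\<Sum>\<psi>\<in>nontrivial_chars. \<Sum>\<beta>\<le>N. norm (P' \<psi> \<beta>) ^ 4) \<le> real (N + 1) * (real \<phi> * block_bound m K)" by simp
  qed
  have energy: "(\<Sum>\<psi>\<in>nontrivial_chars. short_energy \<psi>) \<le> real \<phi> * n ^ 2"
  proof -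
    have "(\<Sum>\<psi>\<in>nontrivial_chars. short_energy \<psi>) \<le> (\<Sum>\<psi>\<in>chars. short_energy \<psi>)"
      using short_energy_nonneg by (intro sum_mono2) (auto simp: nontrivial_chars_def)
    then show ?thesis using mean_short_energy by (simp add: n_def)
  qed
  have "(\<Sum>\<psi>\<in>nontrivial_chars. (norm (central_sum m \<psi> * cnj (central_sum m \<psi>) -
      bilinear_form (fold_weight (degree Q) m) (below_antidiagonal (degree Q) K) \<psi>))\<^sup>2) \<le>
    (\<Sum>\<psi>\<in>nontrivial_chars. 50 * real (N + 1) * (\<Sum>\<beta>\<le>N. norm (P \<psi> \<beta>) ^ 4) +
      4 * real (N + 1) ^ 3 * (real (N + 1) * n * (FE_const * n ^ (4 * m) * short_energy \<psi>) +
        (\<Sum>\<beta>\<le>N. norm (P \<psi> \<beta>) ^ 4 + norm (P' \<psi> \<beta>) ^ 4) / n))"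
    by (rule sum_mono) (rule pointwise)
  also have "\<dots> = 50 * real (N + 1) * (\<Sum>\<psi>\<in>nontrivial_chars. \<Sum>\<beta>\<le>N. norm (P \<psi> \<beta>) ^ 4) +
      4 * real (N + 1) ^ 3 * (real (N + 1) * n * (FE_const * n ^ (4 * m) * (\<Sum>\<psi>\<in>nontrivial_chars. short_energy \<psi>)) +
        ((\<Sum>\<psi>\<in>nontrivial_chars. \<Sum>\<beta>\<le>N. norm (P \<psi> \<beta>) ^ 4) + (\<Sum>\<psi>\<in>nontrivial_chars. \<Sum>\<beta>\<le>N. norm (P' \<psi> \<beta>) ^ 4)) / n)"
    by (simp add: sum.distrib flip: sum_distrib_left sum_divide_distrib)
  also have "\<dots> \<le> 50 * real (N + 1) * (real (N + 1) * (real \<phi> * block_bound m K)) +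
      4 * real (N + 1) ^ 3 * (real (N + 1) * n * (FE_const * n ^ (4 * m) * (real \<phi> * n ^ 2)) +
        (real (N + 1) * (real \<phi> * block_bound m K) + real (N + 1) * (real \<phi> * block_bound m K)) / n)"
    using sumP energy FE_const_nonneg n
    by (intro add_mono mult_left_mono divide_right_mono) auto
  also have "\<dots> = real \<phi> * folding_error m K"
    using n by (simp add: folding_error_def N_def n_def[symmetric] power_add power2_eq_square field_simps)
  finally show ?thesis .
qed

end

lemma higher_deriv_exp_sum:
  fixes c a :: "'b \<Rightarrow> complex"
  shows "(deriv ^^ m) (\<lambda>s. \<Sum>k\<in>A. c k * exp (a k * s)) = (\<lambda>s. \<Sum>k\<in>A. c k * a k ^ m * exp (a k * s))"
proof (induction m)
  case (Suc m)
  have "deriv (\<lambda>s. \<Sum>k\<in>A. c k * a k ^ m * exp (a k * s)) s = (\<Sum>k\<in>A. c k * a k ^ Suc m * exp (a k * s))" for s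
    by (rule DERIV_imp_deriv) (auto intro!: derivative_eq_intros sum.cong simp: mult_ac)
  then show ?case by (simp add: Suc.IH fun_eq_iff)
qed simp

text \<open>
  The triangle inequality in the \<open>L\<^sup>2\<close> norm over a finite set.
\<close>

lemma sqrt_sum_norm_diff:
  fixes f g :: "'b \<Rightarrow> complex"
  shows "\<bar>sqrt (\<Sum>x\<in>A. (norm (f x))\<^sup>2) - sqrt (\<Sum>x\<in>A. (norm (g x))\<^sup>2)\<bar> \<le> sqrt (\<Sum>x\<in>A. (norm (f x - g x))\<^sup>2)"
proof -
  have *: "L2_set (\<lambda>x. norm (f x)) A \<le> L2_set (\<lambda>x. norm (g x)) A + L2_set (\<lambda>x. norm (f x - g x)) A" for f g :: "'b \<Rightarrow> complex"
  proof -
    have "norm (f x) \<le> norm (g x) + norm (f x - g x)" for x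
      using norm_triangle_ineq[of "g x" "f x - g x"] by simp
    then have "L2_set (\<lambda>x. norm (f x)) A \<le> L2_set (\<lambda>x. norm (g x) + norm (f x - g x)) A"
      by (intro L2_set_mono) auto
    also have "\<dots> \<le> L2_set (\<lambda>x. norm (g x)) A + L2_set (\<lambda>x. norm (f x - g x)) A" by (rule L2_set_triangle_ineq)
    finally show ?thesis .
  qed
  show ?thesis using *[of f g] *[of g f] by (simp add: L2_set_def norm_minus_commute)
qed

lemma sqrt_diff_le: "x \<ge> 0 \<Longrightarrow> y \<ge> 0 \<Longrightarrow> \<bar>sqrt x - sqrt y\<bar> \<le> sqrt \<bar>x - y\<bar>"
proof (rule real_le_rsqrt)
  assume xy: "x \<ge> 0" "y \<ge> 0"
  have "\<bar>sqrt x - sqrt y\<bar>\<^sup>2 = \<bar>sqrt x - sqrt y\<bar> * \<bar>sqrt x - sqrt y\<bar>" by (simp add: power2_eq_square)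
  also have "\<dots> \<le> \<bar>sqrt x - sqrt y\<bar> * \<bar>sqrt x + sqrt y\<bar>"
  proof (rule mult_left_mono)
    have "0 \<le> sqrt x" "0 \<le> sqrt y" using xy by simp_all
    then show "\<bar>sqrt x - sqrt y\<bar> \<le> \<bar>sqrt x + sqrt y\<bar>" by linarith
  qed simp
  also have "\<dots> = \<bar>(sqrt x - sqrt y) * (sqrt x + sqrt y)\<bar>" by (simp only: abs_mult)
  also have "(sqrt x - sqrt y) * (sqrt x + sqrt y) = x - y" using xy by (simp add: algebra_simps)
  finally show "\<bar>sqrt x - sqrt y\<bar>\<^sup>2 \<le> \<bar>x - y\<bar>" .
qed

section \<open>The main term as a lattice sum\<close>

definition triangle :: "nat \<Rightarrow> (nat \<times> nat) set" where
  "triangle n = {(a, b). a + b < n}"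

definition main_sum :: "nat \<Rightarrow> nat \<Rightarrow> real" where
  "main_sum m n = (\<Sum>(g, h, i, j)\<in>diagonal_index (triangle n). fold_weight n m (g + i) (g + j) * fold_weight n m (h + i) (h + j))"

lemma finite_triangle [simp]: "finite (triangle n)"
  by (rule finite_subset[of _ "{..<n} \<times> {..<n}"]) (auto simp: triangle_def)

lemma fold_weight_nonneg: "0 \<le> fold_weight n m a b" by (simp add: fold_weight_def)

lemma fold_weight_le: "a < n \<Longrightarrow> b < n \<Longrightarrow> fold_weight n m a b \<le> 2 * real n ^ (2 * m)"
proof -
  assume ab: "a < n" "b < n"
  have "real a ^ m * real b ^ m \<le> real n ^ m * real n ^ m"
    using ab by (intro mult_mono power_mono) auto
  moreover have "real (n - 1 - a) ^ m * real (n - 1 - b) ^ m \<le> real n ^ m * real n ^ m"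
    using ab by (intro mult_mono power_mono) auto
  moreover have "real n ^ (2 * m) = real n ^ m * real n ^ m" by (simp only: mult_2 power_add)
  ultimately show ?thesis unfolding fold_weight_def by linarith
qed

text \<open>
  The quadruples whose coprime density is not \<open>1 - 1/q\<close>.
\<close>

lemma card_diagonal_edge:
  "card {(g, h, i, j) \<in> diagonal_index (triangle n). i = 0 \<or> j = 0} \<le> 2 * n ^ 3"
proof -
  define X where "X = {(g, h, i, j) \<in> diagonal_index (triangle n). i = 0}"
  define Y where "Y = {(g, h, i, j) \<in> diagonal_index (triangle n). j = 0}"
  have fin: "finite X" "finite Y"
    by (rule finite_subset[of _ "diagonal_index (triangle n)"]; auto simp: X_def Y_def)+
  have "card X \<le> card ({..<n} \<times> {..<n} \<times> {..<n})"
    by (rule card_inj_on_le[where f = "\<lambda>(g, h, i, j). (g, h, j)"])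
       (auto simp: X_def inj_on_def diagonal_index_def triangle_def)
  moreover have "card Y \<le> card ({..<n} \<times> {..<n} \<times> {..<n})"
    by (rule card_inj_on_le[where f = "\<lambda>(g, h, i, j). (g, h, i)"])
       (auto simp: Y_def inj_on_def diagonal_index_def triangle_def)
  moreover have "card {(g, h, i, j) \<in> diagonal_index (triangle n). i = 0 \<or> j = 0} \<le> card (X \<union> Y)"
    using fin by (intro card_mono) (auto simp: X_def Y_def)
  moreover have "card (X \<union> Y) \<le> card X + card Y" by (rule card_Un_le)
  ultimately show ?thesis by (simp add: card_cartesian_product power3_eq_cube)
qed

text \<open>
  For a missing quadruple \<open>2g + i + j\<close> or \<open>2h + i + j\<close> lies within three block widths of \<open>n\<close>, so the
  remaining three entries leave few choices for \<open>g\<close> or \<open>h\<close>.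
\<close>

lemma card_diagonal_strip:
  assumes K: "K > 0"
  shows "card (diagonal_index (triangle n) - diagonal_index (below_antidiagonal n K)) \<le> 2 * (n ^ 3 * (3 * (block_width n K + 1)))"
proof -
  define v where "v = 3 * (block_width n K + 1)"
  define X where "X = {(g, h, i, j) \<in> diagonal_index (triangle n). n \<le> 2 * g + i + j + v}"
  define Y where "Y = {(g, h, i, j) \<in> diagonal_index (triangle n). n \<le> 2 * h + i + j + v}"
  have fin: "finite X" "finite Y"
    by (rule finite_subset[of _ "diagonal_index (triangle n)"]; auto simp: X_def Y_def)+
  have "card X \<le> card ({..<n} \<times> {..<n} \<times> {..<n} \<times> {..<v})"
    by (rule card_inj_on_le[where f = "\<lambda>(g, h, i, j). (h, i, j, 2 * g + i + j + v - n)"])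
       (auto simp: X_def inj_on_def diagonal_index_def triangle_def)
  moreover have "card Y \<le> card ({..<n} \<times> {..<n} \<times> {..<n} \<times> {..<v})"
    by (rule card_inj_on_le[where f = "\<lambda>(g, h, i, j). (g, i, j, 2 * h + i + j + v - n)"])
       (auto simp: Y_def inj_on_def diagonal_index_def triangle_def)
  moreover have "diagonal_index (triangle n) - diagonal_index (below_antidiagonal n K) \<subseteq> X \<union> Y"
  proof
    fix p assume p: "p \<in> diagonal_index (triangle n) - diagonal_index (below_antidiagonal n K)"
    obtain g h i j where pp: "p = (g, h, i, j)" by (metis prod.exhaust)
    have t: "g + i + (g + j) < n" "h + i + (h + j) < n" using p by (auto simp: pp diagonal_index_def triangle_def)
    have "(g + i, g + j) \<notin> below_antidiagonal n K \<or> (h + i, h + j) \<notin> below_antidiagonal n K"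
      using p by (auto simp: pp diagonal_index_def)
    then have "n \<le> g + i + (g + j) + v \<or> n \<le> h + i + (h + j) + v"
      using not_below_antidiagonal[OF K, of "g + i" n "g + j"] not_below_antidiagonal[OF K, of "h + i" n "h + j"] t
      unfolding v_def by linarith
    then show "p \<in> X \<union> Y" using p unfolding X_def Y_def pp by auto
  qed
  then have "card (diagonal_index (triangle n) - diagonal_index (below_antidiagonal n K)) \<le> card (X \<union> Y)"
    using fin by (intro card_mono) auto
  moreover have "card (X \<union> Y) \<le> card X + card Y" by (rule card_Un_le)
  ultimately show ?thesis unfolding v_def[symmetric] by (simp add: card_cartesian_product power3_eq_cube mult.assoc)
qed

lemma diagonal_main_term:
  fixes q :: real
  assumes K: "K > 0" and w: "block_width n K > 0" and q: "q = real CARD('a::finite_field)"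
  shows "\<bar>(\<Sum>(g, h, i, j)\<in>diagonal_index (below_antidiagonal n K).
      fold_weight n m (g + i) (g + j) * fold_weight n m (h + i) (h + j) * coprime_density TYPE('a) i j)
    - (1 - 1 / q) * main_sum m n\<bar> \<le> 4 * real n ^ (4 * m) * (2 * real n ^ 3 + 6 * (real n ^ 3 * real (block_width n K + 1)))"
proof -
  define D1 where "D1 = diagonal_index (below_antidiagonal n K)"
  define D0 where "D0 = diagonal_index (triangle n)"
  define f where "f = (\<lambda>(g, h, i, j). fold_weight n m (g + i) (g + j) * fold_weight n m (h + i) (h + j))"
  define \<kappa> where "\<kappa> = (\<lambda>(g :: nat, h :: nat, i, j). coprime_density TYPE('a) i j)"
  define c where "c = 1 - 1 / q"
  have q2: "q \<ge> 2" using card_field_ge_2[where 'a='a] by (simp add: q)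
  have c: "0 \<le> c" "c \<le> 1" using q2 by (auto simp: c_def field_simps)
  have sub: "D1 \<subseteq> D0"
  proof -
    have "below_antidiagonal n K \<subseteq> triangle n" using below_antidiagonal_gap[OF K] w by (fastforce simp: triangle_def)
    then show ?thesis by (auto simp: D1_def D0_def diagonal_index_def)
  qed
  have fin0: "finite D0" by (simp add: D0_def)
  have fin1: "finite D1" using sub fin0 by (rule finite_subset)
  have f: "0 \<le> f p" "f p \<le> 4 * real n ^ (4 * m)" if "p \<in> D0" for p
  proof -
    obtain g h i j where pp: "p = (g, h, i, j)" by (metis prod.exhaust)
    show "0 \<le> f p" by (simp add: f_def pp fold_weight_nonneg)
    have t: "g + i + (g + j) < n" "h + i + (h + j) < n"
      using that by (auto simp: pp D0_def diagonal_index_def triangle_def)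
    have "f p = fold_weight n m (g + i) (g + j) * fold_weight n m (h + i) (h + j)" by (simp add: f_def pp)
    also have "\<dots> \<le> (2 * real n ^ (2 * m)) * (2 * real n ^ (2 * m))"
      using t by (intro mult_mono fold_weight_le fold_weight_nonneg) auto
    also have "\<dots> = 4 * real n ^ (4 * m)" by (simp flip: power_add)
    finally show "f p \<le> 4 * real n ^ (4 * m)" .
  qed
  have S1: "(\<Sum>(g, h, i, j)\<in>D1. fold_weight n m (g + i) (g + j) * fold_weight n m (h + i) (h + j) * coprime_density TYPE('a) i j) = (\<Sum>p\<in>D1. f p * \<kappa> p)"
    by (simp add: f_def \<kappa>_def case_prod_unfold)
  have S0: "main_sum m n = (\<Sum>p\<in>D0. f p)" by (simp add: main_sum_def D0_def f_def case_prod_unfold)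
  have "(\<Sum>p\<in>D1. f p * \<kappa> p) - c * (\<Sum>p\<in>D0. f p) = (\<Sum>p\<in>D1. f p * (\<kappa> p - c)) - c * (\<Sum>p\<in>D0 - D1. f p)"
    using sum.subset_diff[OF sub fin0, of f] by (simp add: algebra_simps sum_subtractf sum_distrib_left)
  also have "\<bar>\<dots>\<bar> \<le> \<bar>\<Sum>p\<in>D1. f p * (\<kappa> p - c)\<bar> + \<bar>c * (\<Sum>p\<in>D0 - D1. f p)\<bar>" by (rule abs_triangle_ineq4)
  also have "\<bar>\<Sum>p\<in>D1. f p * (\<kappa> p - c)\<bar> \<le> 4 * real n ^ (4 * m) * (2 * real n ^ 3)"
  proof -
    define E where "E = {(g, h, i, j) \<in> D0. i = 0 \<or> j = 0}"
    have finE: "finite E" by (rule finite_subset[OF _ fin0]) (auto simp: E_def)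
    have "\<bar>\<Sum>p\<in>D1. f p * (\<kappa> p - c)\<bar> \<le> (\<Sum>p\<in>D1. \<bar>f p * (\<kappa> p - c)\<bar>)" by (rule sum_abs)
    also have "\<dots> \<le> (\<Sum>p\<in>D1. if p \<in> E then 4 * real n ^ (4 * m) else 0)"
    proof (rule sum_mono)
      fix p assume p: "p \<in> D1"
      obtain g h i j where pp: "p = (g, h, i, j)" by (metis prod.exhaust)
      show "\<bar>f p * (\<kappa> p - c)\<bar> \<le> (if p \<in> E then 4 * real n ^ (4 * m) else 0)"
      proof (cases "p \<in> E")
        case True
        have "\<bar>\<kappa> p - c\<bar> \<le> 1" using c coprime_density_bounds[where 'a='a, of i j] by (simp add: \<kappa>_def pp abs_le_iff)
        then have "\<bar>f p * (\<kappa> p - c)\<bar> \<le> 4 * real n ^ (4 * m) * 1"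
          unfolding abs_mult using f[of p] p sub by (intro mult_mono) auto
        then show ?thesis using True by simp
      next
        case False
        then have "i > 0" "j > 0" using p sub by (auto simp: E_def pp)
        then have "\<kappa> p = c" by (simp add: \<kappa>_def pp c_def q coprime_density_pos)
        then show ?thesis by simp
      qed
    qed
    also have "\<dots> = real (card (D1 \<inter> E)) * (4 * real n ^ (4 * m))"
      using fin1 by (simp add: sum.If_cases)
    also have "\<dots> \<le> real (2 * n ^ 3) * (4 * real n ^ (4 * m))"
    proof (rule mult_right_mono)
      have "card (D1 \<inter> E) \<le> card E" using finE by (intro card_mono) auto
      also have "\<dots> \<le> 2 * n ^ 3" unfolding E_def D0_def by (rule card_diagonal_edge)
      finally show "real (card (D1 \<inter> E)) \<le> real (2 * n ^ 3)" by (rule of_nat_mono)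
    qed simp
    finally show ?thesis by (simp add: mult_ac)
  qed
  also have "\<bar>c * (\<Sum>p\<in>D0 - D1. f p)\<bar> \<le> 4 * real n ^ (4 * m) * (6 * (real n ^ 3 * real (block_width n K + 1)))"
  proof -
    have "0 \<le> (\<Sum>p\<in>D0 - D1. f p)" using f by (intro sum_nonneg) auto
    then have "\<bar>c * (\<Sum>p\<in>D0 - D1. f p)\<bar> \<le> 1 * (\<Sum>p\<in>D0 - D1. f p)"
      unfolding abs_mult using c by (intro mult_mono) auto
    also have "\<dots> \<le> (\<Sum>p\<in>D0 - D1. 4 * real n ^ (4 * m))" unfolding mult_1 using f by (intro sum_mono) auto
    also have "\<dots> = real (card (D0 - D1)) * (4 * real n ^ (4 * m))" by simp
    also have "\<dots> \<le> real (2 * (n ^ 3 * (3 * (block_width n K + 1)))) * (4 * real n ^ (4 * m))"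
      using card_diagonal_strip[OF K, of n] unfolding D0_def D1_def by (intro mult_right_mono of_nat_mono) auto
    finally show ?thesis by (simp add: algebra_simps)
  qed
  finally show ?thesis unfolding D1_def[symmetric] S1 S0 c_def by (simp add: algebra_simps)
qed

section \<open>Derivatives of L at the central point\<close>

context prime_modulus begin

text \<open>
  The polynomial in \<open>q powr -s\<close> to which the Dirichlet series collapses.
\<close>

definition Lpoly :: "('a poly \<Rightarrow> complex) \<Rightarrow> complex \<Rightarrow> complex" where
  "Lpoly \<psi> s = (\<Sum>k<degree Q. charsum \<psi> k * exp (- (of_nat k * of_real (ln (real CARD('a)))) * s))"

lemma q_ge_2: "real CARD('a) \<ge> 2" using card_field_ge_2[where 'a='a] by simp

lemma poly_abs_powr:
  fixes A :: "'a poly"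
  assumes "A \<in> monics k"
  shows "complex_of_real (poly_abs A) powr (- s) = exp (- (of_nat k * of_real (ln (real CARD('a)))) * s)"
proof -
  have "degree A = k" using assms by (simp add: monics_def)
  then have "poly_abs A = real CARD('a) ^ k" by (simp add: poly_abs_def)
  moreover have pos: "real CARD('a) ^ k > 0" by simp
  moreover have "Ln (complex_of_real (real CARD('a) ^ k)) = of_real (ln (real CARD('a) ^ k))" by (rule Ln_of_real[OF pos])
  moreover have "complex_of_real (real CARD('a) ^ k) \<noteq> 0" using pos by (metis less_irrefl of_real_eq_0_iff)
  ultimately have "complex_of_real (poly_abs A) powr (- s) = exp (- s * of_real (ln (real CARD('a) ^ k)))"
    by (simp only: powr_def if_False)
  then show ?thesis by (simp add: ln_realpow mult_ac)
qed

lemma dirichlet_series_eq_Lpoly: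
  assumes \<psi>: "\<psi> \<in> nontrivial_chars" and s: "Re s > 1"
  shows "(\<Sum>\<^sub>\<infinity>A\<in>{A. monic A}. \<psi> A * complex_of_real (poly_abs A) powr (- s)) = Lpoly \<psi> s"
proof -
  have \<psi>': "\<psi> \<in> chars" "\<psi> \<noteq> trivial_character Q" using \<psi> by (auto simp: nontrivial_chars_def)
  define f where "f A = \<psi> A * complex_of_real (poly_abs A) powr (- s)" for A :: "'a poly"
  define x where "x = real CARD('a) powr (1 - Re s)"
  have x: "0 < x" "x < 1" using s q_ge_2 by (auto simp: x_def powr_less_one)
  have norm_f: "norm (f A) \<le> exp (- (real k * ln (real CARD('a)) * Re s))" if "A \<in> monics k" for A k
  proof -
    have "norm (\<psi> A) \<le> 1" using norm_char[OF \<psi>'(1), of A] char_zero_iff[OF \<psi>'(1), of A] by (cases "Q dvd A") auto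
    moreover have "norm (exp (- (of_nat k * of_real (ln (real CARD('a)))) * s)) = exp (- (real k * ln (real CARD('a)) * Re s))"
      by (simp add: norm_exp_eq_Re)
    ultimately show ?thesis unfolding f_def poly_abs_powr[OF that] norm_mult
      by (metis exp_ge_zero mult_left_le_one_le norm_ge_zero)
  qed
  have level: "(\<Sum>A\<in>monics k. norm (f A)) \<le> x ^ k" for k
  proof -
    have "(\<Sum>A\<in>monics k. norm (f A)) \<le> (\<Sum>A\<in>(monics k :: 'a poly set). exp (- (real k * ln (real CARD('a)) * Re s)))"
      by (rule sum_mono) (rule norm_f)
    also have "\<dots> = real CARD('a) ^ k * exp (- (real k * ln (real CARD('a)) * Re s))" by (simp add: card_monics)
    also have "real CARD('a) ^ k = exp (real k * ln (real CARD('a)))"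
      using q_ge_2 by (simp add: exp_of_nat_mult)
    also have "exp (real k * ln (real CARD('a))) * exp (- (real k * ln (real CARD('a)) * Re s)) = exp (real k * ((1 - Re s) * ln (real CARD('a))))"
      by (simp add: algebra_simps flip: exp_add)
    also have "\<dots> = x ^ k" using q_ge_2 by (simp add: x_def powr_def exp_of_nat_mult)
    finally show ?thesis .
  qed
  have bij: "bij_betw snd (SIGMA k:UNIV. monics k) {A :: 'a poly. monic A}"
    by (rule bij_betw_byWitness[where f' = "\<lambda>A. (degree A, A)"]) (auto simp: monics_def)
  have "(\<lambda>A. norm (f A)) summable_on {A. monic A}"
  proof (rule nonneg_bdd_above_summable_on)
    show "bdd_above (sum (\<lambda>A. norm (f A)) ` {F. F \<subseteq> {A. monic A} \<and> finite F})"
    proof (rule bdd_aboveI)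
      fix y assume "y \<in> sum (\<lambda>A. norm (f A)) ` {F. F \<subseteq> {A. monic A} \<and> finite F}"
      then obtain F where F: "F \<subseteq> {A. monic A}" "finite F" "y = (\<Sum>A\<in>F. norm (f A))" by auto
      define N where "N = (\<Sum>A\<in>F. degree A)"
      have deg: "degree A \<le> N" if "A \<in> F" for A unfolding N_def using F(2) that by (intro member_le_sum) auto
      have "F \<subseteq> (\<Union>k\<in>{..N}. monics k)" using F(1) deg by (auto simp: monics_def)
      then have "y \<le> (\<Sum>A\<in>(\<Union>k\<in>{..N}. monics k). norm (f A))" unfolding F(3) by (intro sum_mono2) auto
      also have "\<dots> = (\<Sum>k\<le>N. \<Sum>A\<in>monics k. norm (f A))"
        by (rule sum.UNION_disjoint) (simp_all, auto simp: monics_def)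
      also have "\<dots> \<le> (\<Sum>k\<le>N. x ^ k)" by (rule sum_mono) (rule level)
      also have "\<dots> \<le> (\<Sum>k. x ^ k)" using x by (intro sum_le_suminf) (auto intro: summable_geometric)
      finally show "y \<le> (\<Sum>k. x ^ k)" .
    qed
  qed simp
  then have "f summable_on {A. monic A}" by (rule abs_summable_summable)
  then have "(\<lambda>p. f (snd p)) summable_on (SIGMA k:UNIV. monics k)"
    using summable_on_reindex_bij_betw[OF bij, of f] by simp
  then have sigma: "(\<lambda>(k, A). f A) summable_on (SIGMA k:UNIV. monics k)" by (simp add: case_prod_unfold)
  have "(\<Sum>\<^sub>\<infinity>A\<in>{A. monic A}. f A) = (\<Sum>\<^sub>\<infinity>p\<in>(SIGMA k:UNIV. monics k). f (snd p))"
    by (rule infsum_reindex_bij_betw[OF bij, symmetric])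
  also have "\<dots> = (\<Sum>\<^sub>\<infinity>k\<in>UNIV. \<Sum>\<^sub>\<infinity>A\<in>monics k. f A)"
    using infsum_Sigma'_banach[OF sigma] by (simp add: case_prod_unfold)
  also have "\<dots> = (\<Sum>\<^sub>\<infinity>k\<in>UNIV. charsum \<psi> k * exp (- (of_nat k * of_real (ln (real CARD('a)))) * s))"
    by (intro infsum_cong) (simp add: f_def poly_abs_powr charsum_def sum_distrib_right)
  also have "\<dots> = (\<Sum>\<^sub>\<infinity>k\<in>{..<degree Q}. charsum \<psi> k * exp (- (of_nat k * of_real (ln (real CARD('a)))) * s))"
    by (rule infsum_cong_neutral) (auto simp: charsum_ge_degree[OF \<psi>'])
  also have "\<dots> = Lpoly \<psi> s" by (simp add: Lpoly_def)
  finally show ?thesis by (simp add: f_def)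
qed

lemma Lpoly_holomorphic: "Lpoly \<psi> holomorphic_on S"
  unfolding Lpoly_def[abs_def] by (intro holomorphic_intros)

text \<open>
  \<open>Lpoly\<close> is entire and agrees with the series for \<open>Re s > 1\<close>; by the identity theorem it is the only such function.
\<close>

lemma dirichlet_L_eq:
  assumes \<psi>: "\<psi> \<in> nontrivial_chars"
  shows "dirichlet_L \<psi> = Lpoly \<psi>"
  unfolding dirichlet_L_def
proof (rule the_equality)
  show "Lpoly \<psi> holomorphic_on UNIV \<and>
    (\<forall>s. Re s > 1 \<longrightarrow> Lpoly \<psi> s = (\<Sum>\<^sub>\<infinity>A\<in>{A. monic A}. \<psi> A * complex_of_real (poly_abs A) powr (- s)))"
    using Lpoly_holomorphic dirichlet_series_eq_Lpoly[OF \<psi>] by simp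
next
  fix f assume f: "f holomorphic_on UNIV \<and>
    (\<forall>s. Re s > 1 \<longrightarrow> f s = (\<Sum>\<^sub>\<infinity>A\<in>{A. monic A}. \<psi> A * complex_of_real (poly_abs A) powr (- s)))"
  show "f = Lpoly \<psi>"
  proof (rule ext)
    fix z
    have "complex_of_real 2 \<in> {s. Re s > 1}" by simp
    then have ne: "{s. Re s > 1} \<noteq> {}" by blast
    have eq: "f s = Lpoly \<psi> s" if "s \<in> {s. Re s > 1}" for s
      using that f dirichlet_series_eq_Lpoly[OF \<psi>] by simp
    show "f z = Lpoly \<psi> z"
      by (rule analytic_continuation_open[OF open_halfspace_Re_gt open_UNIV ne connected_UNIV subset_UNIV
            conjunct1[OF f] Lpoly_holomorphic eq UNIV_I])
  qed
qed

lemma norm_deriv_dirichlet_L: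
  assumes \<psi>: "\<psi> \<in> nontrivial_chars"
  shows "norm ((deriv ^^ m) (dirichlet_L \<psi>) (1 / 2)) = ln (real CARD('a)) ^ m * norm (central_sum m \<psi>)"
proof -
  define L where "L = ln (real CARD('a))"
  have L0: "L \<ge> 0" using q_ge_2 by (simp add: L_def)
  have rL: "r = exp (L / 2)"
  proof -
    have "exp (L / 2) ^ 2 = real CARD('a)" using q_ge_2 by (simp add: L_def flip: exp_double)
    then show ?thesis unfolding r_def by (intro real_sqrt_unique) auto
  qed
  have "dirichlet_L \<psi> = (\<lambda>s. \<Sum>k<degree Q. charsum \<psi> k * exp ((- (of_nat k * of_real L)) * s))"
    by (simp add: dirichlet_L_eq[OF \<psi>] Lpoly_def[abs_def] L_def)
  then have "(deriv ^^ m) (dirichlet_L \<psi>) (1 / 2) =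
      (\<Sum>k<degree Q. charsum \<psi> k * (- (of_nat k * of_real L)) ^ m * exp ((- (of_nat k * of_real L)) * (1 / 2)))"
    by (simp only: higher_deriv_exp_sum)
  also have "\<dots> = (\<Sum>k<degree Q. (- of_real L) ^ m * (of_real (real k ^ m) * lcoef \<psi> k))"
  proof (rule sum.cong[OF refl])
    fix k
    have "exp ((- (of_nat k * of_real L)) * (1 / 2)) = complex_of_real (exp (- (real k * (L / 2))))"
      by (simp add: exp_of_real[symmetric])
    also have "exp (- (real k * (L / 2))) = 1 / r ^ k"
      using exp_of_nat_mult[of k "L / 2"] by (simp add: rL exp_minus inverse_eq_divide)
    finally have e: "exp ((- (of_nat k * of_real L)) * (1 / 2)) = (1 / of_real (r ^ k) :: complex)" by simp
    have "(- (of_nat k * of_real L)) ^ m = (- of_real L) ^ m * (of_real (real k ^ m) :: complex)"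
      by (simp add: mult.commute flip: power_mult_distrib)
    then show "charsum \<psi> k * (- (of_nat k * of_real L)) ^ m * exp ((- (of_nat k * of_real L)) * (1 / 2)) =
      (- of_real L) ^ m * (of_real (real k ^ m) * lcoef \<psi> k)"
      unfolding e lcoef_eq by simp
  qed
  also have "\<dots> = (- of_real L) ^ m * central_sum m \<psi>"
    unfolding central_sum_def by (rule sum_distrib_left[symmetric])
  finally show ?thesis using L0 by (simp add: norm_mult norm_power L_def)
qed

definition mean_fourth :: "nat \<Rightarrow> real" where
  "mean_fourth m = (\<Sum>\<psi>\<in>nontrivial_chars. norm (central_sum m \<psi>) ^ 4) / real \<phi>"

lemma normalised_fourth_moment_eq:
  "normalised_fourth_moment m Q = 1 / (1 - 1 / real CARD('a)) * (mean_fourth m / real (degree Q) ^ (4 * m + 4))"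
proof -
  have L: "ln (real CARD('a)) \<noteq> 0" using q_ge_2 by simp
  have "{\<psi>. dirichlet_character Q \<psi> \<and> \<psi> \<noteq> trivial_character Q} = nontrivial_chars"
    by (auto simp: nontrivial_chars_def)
  then have "normalised_fourth_moment m Q = 1 / ((1 - 1 / real CARD('a)) * ln (real CARD('a)) ^ (4 * m))
     * (1 / real \<phi>) * (1 / real (degree Q) ^ (4 * m + 4))
     * (\<Sum>\<psi>\<in>nontrivial_chars. norm ((deriv ^^ m) (dirichlet_L \<psi>) (1 / 2)) ^ 4)"
    by (simp add: normalised_fourth_moment_def poly_phi_eq)
  also have "(\<Sum>\<psi>\<in>nontrivial_chars. norm ((deriv ^^ m) (dirichlet_L \<psi>) (1 / 2)) ^ 4) =
      ln (real CARD('a)) ^ (4 * m) * (\<Sum>\<psi>\<in>nontrivial_chars. norm (central_sum m \<psi>) ^ 4)"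
    unfolding sum_distrib_left
    by (intro sum.cong refl) (simp add: norm_deriv_dirichlet_L power_mult_distrib mult.commute flip: power_mult)
  finally show ?thesis using L by (simp add: mean_fourth_def)
qed

text \<open>
  Orthogonality needs all characters, while the moment leaves out the trivial one. Its coefficients \<open>r^k\<close> are large, but
  \<open>a + b\<close> stays below \<open>degree Q\<close> by the block width.
\<close>

lemma trivial_bilinear_form:
  assumes K: "K > 0"
  shows "(norm (bilinear_form (fold_weight (degree Q) m) (below_antidiagonal (degree Q) K) (trivial_character Q)))\<^sup>2
    \<le> real \<phi> * (8 * real (degree Q) ^ (4 * m + 4) / real CARD('a) ^ block_width (degree Q) K)"
proof -
  define n where "n = degree Q"
  define w where "w = block_width n K"
  define I where "I = below_antidiagonal n K"
  have IQ: "I \<subseteq> {..<n} \<times> {..<n}" unfolding I_def by (rule below_antidiagonal_subset[OF K])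
  have lc: "lcoef (trivial_character Q) k = of_real (r ^ k)" if "k < n" for k
  proof -
    have "charsum (trivial_character Q) k = (\<Sum>A\<in>(monics k :: 'a poly set). 1)"
      unfolding charsum_def using that not_dvd_monics
      by (intro sum.cong refl) (auto simp: trivial_character_def coprime_prime_iff[OF prime] n_def)
    also have "\<dots> = of_nat (CARD('a) ^ k)" by (simp add: card_monics)
    finally show ?thesis unfolding of_nat_card_power by (simp add: lcoef_eq)
  qed
  have w_le: "w \<le> n"
    unfolding w_def block_width_def using div_le_dividend le_trans by blast
  define B where "B = 2 * real n ^ (2 * m) * r ^ (n - w)"
  have "norm (bilinear_form (fold_weight n m) I (trivial_character Q)) \<le> (\<Sum>p\<in>I. B)"
    unfolding bilinear_form_def
  proof (rule sum_norm_le)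
    fix p assume p: "p \<in> I"
    obtain a b where pp: "p = (a, b)" by (metis prod.exhaust)
    have ab: "a < n" "b < n" using p IQ pp by auto
    have gap: "a + b + w \<le> n" using below_antidiagonal_gap[OF K, of a b n] p pp by (simp add: I_def w_def)
    have "norm (complex_of_real (fold_weight n m a b) * lcoef (trivial_character Q) a * cnj (lcoef (trivial_character Q) b))
      = fold_weight n m a b * r ^ (a + b)"
      using ab r_gt_1 fold_weight_nonneg[of n m a b] by (simp add: lc norm_mult norm_power power_add)
    also have "\<dots> \<le> 2 * real n ^ (2 * m) * r ^ (n - w)"
      using ab gap r_gt_1 fold_weight_le[of a n b m] by (intro mult_mono power_increasing) auto
    finally show "norm (case p of (a, b) \<Rightarrow> complex_of_real (fold_weight n m a b) * lcoef (trivial_character Q) a * cnj (lcoef (trivial_character Q) b)) \<le> B"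
      by (simp add: pp B_def)
  qed
  also have "\<dots> = real (card I) * B" by simp
  also have "\<dots> \<le> real (n * n) * B"
  proof (intro mult_right_mono of_nat_mono)
    have "card I \<le> card ({..<n} \<times> {..<n})" using IQ by (intro card_mono) auto
    then show "card I \<le> n * n" by (simp add: card_cartesian_product)
    show "0 \<le> B" using r_gt_1 by (simp add: B_def)
  qed
  finally have "(norm (bilinear_form (fold_weight n m) I (trivial_character Q)))\<^sup>2 \<le> (real (n * n) * B)\<^sup>2"
    by (intro power_mono) auto
  also have "\<dots> = 4 * real n ^ (4 * m + 4) * (r ^ (n - w))\<^sup>2"
    by (simp add: B_def power_mult_distrib power_add power4_eq_xxxx power2_eq_square mult_ac flip: power_mult)
       (simp add: power_add[symmetric] power_mult_distrib[symmetric] mult_ac)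
  also have "(r ^ (n - w))\<^sup>2 = real CARD('a) ^ n / real CARD('a) ^ w"
  proof -
    have "(r ^ (n - w))\<^sup>2 = real CARD('a) ^ (n - w)"
      by (simp add: power2_eq_square r_mult_r flip: power_mult_distrib)
    then show ?thesis using w_le by (simp add: power_diff)
  qed
  also have "4 * real n ^ (4 * m + 4) * (real CARD('a) ^ n / real CARD('a) ^ w) \<le> 4 * real n ^ (4 * m + 4) * (2 * real \<phi> / real CARD('a) ^ w)"
  proof (intro mult_left_mono divide_right_mono)
    have "CARD('a) ^ n \<le> 2 * \<phi>" using card_power_ge_2 by (simp add: \<phi>_def n_def)
    then have "real (CARD('a) ^ n) \<le> real (2 * \<phi>)" by (rule of_nat_mono)
    then show "real CARD('a) ^ n \<le> 2 * real \<phi>" by simp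
  qed auto
  finally show ?thesis unfolding n_def w_def I_def by (simp add: mult_ac)
qed

text \<open>
  The first term comes from quadruples with \<open>i = 0\<close> or \<open>j = 0\<close>, the second from the strip between the staircase and the
  triangle, the third from the off-diagonal solutions and the trivial character.
\<close>

definition moment_error :: "nat \<Rightarrow> nat \<Rightarrow> real" where
  "moment_error K T = 8 / real (degree Q) + 24 * real (block_width (degree Q) K + 1) / real (degree Q)
     + (4 * (real T)\<^sup>2 + 8) / real CARD('a) ^ block_width (degree Q) K"

text \<open>
  Two comparisons of mean squares: folding replaces \<open>\<bar>central_sum\<bar>^2\<close> by the bilinear form over the staircase, and
  the mean square of the latter is computed by \<open>mean_square_split\<close>. Square roots make the first one a triangle
  inequality, without cross terms.
\<close>

lemma mean_fourth_main_term:
  assumes K: "K > 0" and w: "block_width (degree Q) K > 0"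
    and T: "\<And>N :: 'a poly. N \<noteq> 0 \<Longrightarrow> degree N \<le> 2 * degree Q \<Longrightarrow> card (monic_divisors N) \<le> T"
  shows "\<bar>sqrt (mean_fourth m / real (degree Q) ^ (4 * m + 4)) -
      sqrt ((1 - 1 / real CARD('a)) * main_sum m (degree Q) / real (degree Q) ^ (4 * m + 4))\<bar>
    \<le> sqrt (folding_error m K / real (degree Q) ^ (4 * m + 4)) + sqrt (moment_error K T)"
proof -
  define n where "n = degree Q"
  define I where "I = below_antidiagonal n K"
  define X where "X = real n ^ (4 * m + 4)"
  define W where "W = block_width n K"
  have n: "n > 0" using deg_pos by (simp add: n_def)
  have X: "X > 0" using n by (simp add: X_def)
  have \<phi>0: "real \<phi> > 0" using phi_pos by simp
  have IQ: "I \<subseteq> {..<degree Q} \<times> {..<degree Q}" unfolding I_def n_def by (rule below_antidiagonal_subset[OF K])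
  define B where "B = (\<Sum>\<psi>\<in>nontrivial_chars. (norm (bilinear_form (fold_weight n m) I \<psi>))\<^sup>2)"
  have B0: "B \<ge> 0" by (auto simp: B_def intro: sum_nonneg)
  define M4 where "M4 = (\<Sum>\<psi>\<in>nontrivial_chars. norm (central_sum m \<psi>) ^ 4)"
  have "\<bar>sqrt M4 - sqrt B\<bar> \<le> sqrt (real \<phi> * folding_error m K)"
  proof -
    have "M4 = (\<Sum>\<psi>\<in>nontrivial_chars. (norm (central_sum m \<psi> * cnj (central_sum m \<psi>)))\<^sup>2)"
      by (simp add: M4_def norm_mult power2_eq_square power4_eq_xxxx mult.assoc)
    then have "\<bar>sqrt M4 - sqrt B\<bar> \<le> sqrt (\<Sum>\<psi>\<in>nontrivial_chars. (norm (central_sum m \<psi> * cnj (central_sum m \<psi>) -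
        bilinear_form (fold_weight n m) I \<psi>))\<^sup>2)"
      unfolding B_def by (simp only: sqrt_sum_norm_diff)
    also have "\<dots> \<le> sqrt (real \<phi> * folding_error m K)"
      using folding_mean_square[OF K, of m] by (simp add: I_def n_def)
    finally show ?thesis .
  qed
  then have "\<bar>sqrt M4 - sqrt B\<bar> / sqrt (real \<phi> * X) \<le> sqrt (real \<phi> * folding_error m K) / sqrt (real \<phi> * X)"
    using \<phi>0 X by (intro divide_right_mono) auto
  moreover have "\<bar>sqrt M4 - sqrt B\<bar> / sqrt (real \<phi> * X) = \<bar>sqrt (M4 / (real \<phi> * X)) - sqrt (B / (real \<phi> * X))\<bar>"
    using \<phi>0 X by (simp add: real_sqrt_divide diff_divide_distrib[symmetric] abs_divide)
  moreover have "sqrt (real \<phi> * folding_error m K) / sqrt (real \<phi> * X) = sqrt (folding_error m K / X)"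
    using \<phi>0 by (simp add: real_sqrt_divide[symmetric])
  ultimately have 1: "\<bar>sqrt (M4 / (real \<phi> * X)) - sqrt (B / (real \<phi> * X))\<bar> \<le> sqrt (folding_error m K / X)" by simp
  define D where "D = (\<Sum>(g, h, i, j)\<in>diagonal_index I. fold_weight n m (g + i) (g + j) * fold_weight n m (h + i) (h + j) * coprime_density TYPE('a) i j)"
  define E where "E = {(x, y). x \<in> pairs_over I \<and> y \<in> pairs_over I \<and> [fst x * snd y = snd x * fst y] (mod Q)
      \<and> fst x * snd y \<noteq> snd x * (fst y :: 'a poly)}"
  define O' where "O' = (\<Sum>(x, y)\<in>E. pair_weight (fold_weight n m) x * pair_weight (fold_weight n m) y)"
  define t where "t = (norm (bilinear_form (fold_weight n m) I (trivial_character Q)))\<^sup>2"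
  have Bt: "B + t = real \<phi> * (D + O')"
  proof -
    have "chars = insert (trivial_character Q) nontrivial_chars" using trivial_in_chars by (auto simp: nontrivial_chars_def)
    moreover have "trivial_character Q \<notin> nontrivial_chars" by (simp add: nontrivial_chars_def)
    ultimately have "(\<Sum>\<psi>\<in>chars. (norm (bilinear_form (fold_weight n m) I \<psi>))\<^sup>2) = t + B"
      by (simp only: sum.insert finite_nontrivial_chars t_def B_def not_False_eq_True)
    then show ?thesis using mean_square_split[OF IQ, of "fold_weight n m"] by (simp add: D_def E_def O'_def)
  qed
  have t: "t \<le> real \<phi> * (8 * X / real CARD('a) ^ W)"
    using trivial_bilinear_form[OF K, of m] by (simp add: t_def I_def n_def W_def X_def)
  have t0: "t \<ge> 0" by (simp add: t_def)
  have Ob: "\<bar>O'\<bar> \<le> 4 * X * (real T)\<^sup>2 / real CARD('a) ^ W"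
  proof -
    have "\<bar>O'\<bar> \<le> (2 * real n ^ (2 * m))\<^sup>2 * real (degree Q) ^ 4 * (real T)\<^sup>2 / real CARD('a) ^ W"
      unfolding O'_def E_def
    proof (rule off_diagonal_bound)
      show "a + b + W \<le> degree Q" if "(a, b) \<in> I" for a b
        using below_antidiagonal_gap[OF K, of a b n] that by (simp add: I_def n_def W_def)
      show "\<bar>fold_weight n m a b\<bar> \<le> 2 * real n ^ (2 * m)" if "(a, b) \<in> I" for a b
        using that IQ fold_weight_le[of a n b m] fold_weight_nonneg[of n m a b] by (auto simp: n_def)
    qed (use IQ T in auto)
    also have "(2 * real n ^ (2 * m))\<^sup>2 * real (degree Q) ^ 4 = 4 * X"
      by (simp add: X_def n_def power_mult_distrib power_add flip: power_mult)
    finally show ?thesis .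
  qed
  have Db: "\<bar>D - (1 - 1 / real CARD('a)) * main_sum m n\<bar> \<le> X * (8 / real n + 24 * real (W + 1) / real n)"
  proof -
    have "\<bar>D - (1 - 1 / real CARD('a)) * main_sum m n\<bar> \<le> 4 * real n ^ (4 * m) * (2 * real n ^ 3 + 6 * (real n ^ 3 * real (W + 1)))"
      unfolding D_def I_def W_def by (rule diagonal_main_term[OF K _ refl]) (use w in \<open>simp add: n_def\<close>)
    also have "\<dots> = X * (8 / real n + 24 * real (W + 1) / real n)"
    proof -
      have "X = real n ^ (4 * m) * real n ^ 3 * real n" by (simp add: X_def power_add power3_eq_cube power4_eq_xxxx)
      then show ?thesis using n by (simp add: field_simps)
    qed
    finally show ?thesis .
  qed
  have "\<bar>B / (real \<phi> * X) - (1 - 1 / real CARD('a)) * main_sum m n / X\<bar> \<le> moment_error K T"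
  proof -
    have "B / (real \<phi> * X) - (1 - 1 / real CARD('a)) * main_sum m n / X =
        (D - (1 - 1 / real CARD('a)) * main_sum m n) / X + O' / X - t / (real \<phi> * X)"
    proof -
      have "B = real \<phi> * (D + O') - t" using Bt by simp
      then have "B / (real \<phi> * X) = (D + O') / X - t / (real \<phi> * X)"
        using \<phi>0 by (simp add: diff_divide_distrib)
      then show ?thesis by (simp add: diff_divide_distrib add_divide_distrib)
    qed
    also have "\<bar>\<dots>\<bar> \<le> \<bar>(D - (1 - 1 / real CARD('a)) * main_sum m n) / X\<bar> + \<bar>O' / X\<bar> + \<bar>t / (real \<phi> * X)\<bar>"
    proof -
      have "\<bar>x + y - z\<bar> \<le> \<bar>x\<bar> + \<bar>y\<bar> + \<bar>z\<bar>" for x y z :: real by linarith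
      then show ?thesis .
    qed
    also have "\<bar>(D - (1 - 1 / real CARD('a)) * main_sum m n) / X\<bar> \<le> 8 / real n + 24 * real (W + 1) / real n"
      using Db X by (simp add: abs_divide divide_le_eq mult.commute)
    also have "\<bar>O' / X\<bar> \<le> 4 * (real T)\<^sup>2 / real CARD('a) ^ W"
    proof -
      have "\<bar>O' / X\<bar> = \<bar>O'\<bar> / X" using X by (simp add: abs_divide)
      also have "\<dots> \<le> (4 * X * (real T)\<^sup>2 / real CARD('a) ^ W) / X" using Ob X by (intro divide_right_mono) auto
      finally show ?thesis using X by simp
    qed
    also have "\<bar>t / (real \<phi> * X)\<bar> \<le> 8 / real CARD('a) ^ W"
    proof -
      have "\<bar>t / (real \<phi> * X)\<bar> = t / (real \<phi> * X)" using t0 \<phi>0 X by simp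
      also have "\<dots> \<le> (real \<phi> * (8 * X / real CARD('a) ^ W)) / (real \<phi> * X)" using t \<phi>0 X by (intro divide_right_mono) auto
      finally show ?thesis using X \<phi>0 by simp
    qed
    finally show ?thesis by (simp add: moment_error_def n_def W_def add_divide_distrib)
  qed
  moreover have "0 \<le> (1 - 1 / real CARD('a)) * main_sum m n / X"
  proof -
    have "0 \<le> main_sum m n" unfolding main_sum_def by (auto intro!: sum_nonneg mult_nonneg_nonneg fold_weight_nonneg)
    moreover have "0 \<le> 1 - 1 / real CARD('a)" using q_ge_2 by (simp add: field_simps)
    ultimately show ?thesis using X by simp
  qed
  moreover have "0 \<le> B / (real \<phi> * X)" using B0 \<phi>0 X by simp
  ultimately have 2: "\<bar>sqrt (B / (real \<phi> * X)) - sqrt ((1 - 1 / real CARD('a)) * main_sum m n / X)\<bar> \<le> sqrt (moment_error K T)"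
    using sqrt_diff_le real_sqrt_le_mono order_trans by meson
  have tri: "\<bar>x - z\<bar> \<le> e + e'" if "\<bar>x - y\<bar> \<le> e" "\<bar>y - z\<bar> \<le> e'" for x y z e e' :: real using that by linarith
  have "mean_fourth m / X = M4 / (real \<phi> * X)" by (simp add: mean_fourth_def M4_def)
  then show ?thesis using tri[OF 1 2] unfolding n_def[symmetric] X_def[symmetric] by simp
qed

end

section \<open>Primes of large degree\<close>

text \<open>
  Euclid's argument with the product of all nonzero polynomials of degree at most \<open>d\<close>. It ensures that limits along
  \<open>primes_at_infinity\<close> are unique.
\<close>

lemma ex_prime_of_large_degree: "\<exists>P :: 'a::finite_field poly. monic_prime P \<and> degree P > d"
proof -
  define S where "S = polys_below (Suc d) - {0 :: 'a poly}"
  have finS: "finite S" by (simp add: S_def)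
  define N where "N = 1 + monom 1 1 * \<Prod>S"
  have S0: "\<Prod>S \<noteq> 0" using finS by (simp add: S_def)
  have "degree (monom 1 1 * \<Prod>S) = 1 + degree (\<Prod>S)"
    using S0 by (subst degree_mult_eq) (auto simp: degree_monom_eq monom_eq_0_iff)
  then have "degree N > 0" unfolding N_def by (subst degree_add_eq_right) auto
  then obtain P where P: "monic_prime P" "P dvd N" using ex_prime_divisor by blast
  have "P \<notin> S"
  proof
    assume "P \<in> S"
    then have "P dvd \<Prod>S" using finS by (rule dvd_prodI[rotated])
    then have "P dvd N - monom 1 1 * \<Prod>S" using P(2) by (intro dvd_diff dvd_mult)
    then have "P dvd 1" by (simp add: N_def)
    then show False using P(1) by (simp add: monic_prime_def irreducible_def)
  qed
  then have "degree P > d" using monic_prime_nonzero[OF P(1)] by (auto simp: S_def polys_below_iff)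
  then show ?thesis using P(1) by blast
qed

lemma primes_at_infinity_nontrivial: "(primes_at_infinity :: 'a::finite_field poly filter) \<noteq> bot"
proof -
  have "\<not> eventually (\<lambda>_. False) (primes_at_infinity :: 'a poly filter)"
  proof
    assume "eventually (\<lambda>_. False) (primes_at_infinity :: 'a poly filter)"
    then have "eventually (\<lambda>P :: 'a poly. P \<in> {Q. monic_prime Q} \<longrightarrow> False) (filtercomap degree at_top)"
      unfolding primes_at_infinity_def eventually_inf_principal .
    then obtain R where R: "eventually R at_top" "\<forall>P :: 'a poly. R (degree P) \<longrightarrow> (P \<in> {Q. monic_prime Q} \<longrightarrow> False)"
      unfolding eventually_filtercomap by (elim exE conjE)
    from R(1) obtain d where d: "\<forall>n\<ge>d. R n" unfolding eventually_at_top_linorder by (elim exE)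
    obtain P :: "'a poly" where P: "monic_prime P" "degree P > d" using ex_prime_of_large_degree[of d, where 'a='a] by (elim exE conjE)
    have "R (degree P)" using d P(2) by simp
    then show False using R(2) P(1) by simp
  qed
  then show ?thesis by (simp add: trivial_limit_def)
qed

lemma filterlim_degree_primes: "filterlim degree at_top (primes_at_infinity :: 'a::finite_field poly filter)"
  unfolding primes_at_infinity_def by (rule filterlim_mono[OF filterlim_filtercomap order_refl inf_le1])

lemma eventually_prime: "eventually monic_prime (primes_at_infinity :: 'a::finite_field poly filter)"
  unfolding primes_at_infinity_def eventually_inf_principal by simp

section \<open>Lebesgue measure on quadruples\<close>

type_synonym quadruple = "real \<times> real \<times> real \<times> real"

lemma emeasure_lborel_Times:
  fixes A :: "'a::euclidean_space set" and B :: "'b::euclidean_space set"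
  assumes "A \<in> sets borel" "B \<in> sets borel"
  shows "emeasure lborel (A \<times> B) = emeasure lborel A * emeasure lborel B"
  using assms by (simp add: lborel.emeasure_pair_measure_Times flip: lborel_prod)

lemma nn_integral_lborel_Times:
  fixes f :: "'a::euclidean_space \<Rightarrow> ennreal" and g :: "'b::euclidean_space \<Rightarrow> ennreal"
  assumes [measurable]: "f \<in> borel_measurable borel" "g \<in> borel_measurable borel"
  shows "(\<integral>\<^sup>+x. f (fst x) * g (snd x) \<partial>lborel) = (\<integral>\<^sup>+x. f x \<partial>lborel) * (\<integral>\<^sup>+y. g y \<partial>lborel)"
proof -
  have "(\<integral>\<^sup>+x. f (fst x) * g (snd x) \<partial>(lborel :: ('a \<times> 'b) measure)) = (\<integral>\<^sup>+x. f (fst x) * g (snd x) \<partial>(lborel \<Otimes>\<^sub>M lborel))"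
    by (simp add: lborel_prod)
  also have "\<dots> = (\<integral>\<^sup>+x. \<integral>\<^sup>+y. f x * g y \<partial>lborel \<partial>lborel)"
    by (subst lborel.nn_integral_fst[symmetric]) simp_all
  also have "\<dots> = (\<integral>\<^sup>+x. f x * (\<integral>\<^sup>+y. g y \<partial>lborel) \<partial>lborel)" by (simp add: nn_integral_cmult)
  also have "\<dots> = (\<integral>\<^sup>+x. f x \<partial>lborel) * (\<integral>\<^sup>+y. g y \<partial>lborel)" by (simp add: nn_integral_multc)
  finally show ?thesis .
qed

definition unit_box :: "quadruple set" where
  "unit_box = {0..1} \<times> {0..1} \<times> {0..1} \<times> {0..1}"

lemma emeasure_unit_box: "emeasure lborel unit_box = 1"
  unfolding unit_box_def by (simp add: emeasure_lborel_Times borel_Times)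

lemma sets_unit_box [measurable]: "unit_box \<in> sets borel"
  unfolding unit_box_def by (intro borel_Times) auto

lemma integrable_unit_box: "integrable lborel (\<lambda>x. c * indicator unit_box x :: real)"
  by (intro integrable_mult_right integrable_real_indicator) (auto simp: emeasure_unit_box)

lemma integration_domain_eq: "integration_domain =
    {x :: quadruple. 0 \<le> fst x} \<inter> {x. 0 \<le> fst (snd x)} \<inter> {x. 0 \<le> fst (snd (snd x))} \<inter> {x. 0 \<le> snd (snd (snd x))}
    \<inter> {x. 2 * fst x + fst (snd (snd x)) + snd (snd (snd x)) < 1}
    \<inter> {x. 2 * fst (snd x) + fst (snd (snd x)) + snd (snd (snd x)) < 1}"
  by (auto simp: integration_domain_def)

lemma sets_integration_domain [measurable]: "integration_domain \<in> sets borel"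
  unfolding integration_domain_eq
  by (intro sets.Int borel_open borel_closed open_Collect_less closed_Collect_le continuous_intros)

lemma domain_subset_box: "integration_domain \<subseteq> unit_box"
  by (auto simp: integration_domain_def unit_box_def)

definition moment_integrand :: "nat \<Rightarrow> quadruple \<Rightarrow> real" where
  "moment_integrand m = (\<lambda>(a1, a2, a3, a4).
     ((a1 + a3) ^ m * (a1 + a4) ^ m + (1 - a1 - a3) ^ m * (1 - a1 - a4) ^ m)
   * ((a2 + a3) ^ m * (a2 + a4) ^ m + (1 - a2 - a3) ^ m * (1 - a2 - a4) ^ m))"

definition moment_integral :: "nat \<Rightarrow> real" where
  "moment_integral m = (\<integral>x. indicator integration_domain x * moment_integrand m x \<partial>lborel)"

lemma measurable_moment_integrand [measurable]: "moment_integrand m \<in> borel_measurable borel"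
  unfolding moment_integrand_def case_prod_unfold
  by (intro borel_measurable_continuous_onI continuous_intros)

section \<open>The main sum as a Riemann sum\<close>

text \<open>
  Half-open boxes of side \<open>1/n\<close>, so that each point of the orthant lies in exactly one of them.
\<close>

definition cell :: "nat \<Rightarrow> nat \<times> nat \<times> nat \<times> nat \<Rightarrow> quadruple set" where
  "cell n = (\<lambda>(g, h, i, j). {real g / n..<(real g + 1) / n} \<times> {real h / n..<(real h + 1) / n} \<times>
     {real i / n..<(real i + 1) / n} \<times> {real j / n..<(real j + 1) / n})"

definition cell_value :: "nat \<Rightarrow> nat \<Rightarrow> nat \<times> nat \<times> nat \<times> nat \<Rightarrow> real" where
  "cell_value m n = (\<lambda>(g, h, i, j). fold_weight n m (g + i) (g + j) * fold_weight n m (h + i) (h + j) / real n ^ (4 * m))"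

definition step_function :: "nat \<Rightarrow> nat \<Rightarrow> quadruple \<Rightarrow> real" where
  "step_function m n x = (\<Sum>p\<in>diagonal_index (triangle n). cell_value m n p * indicator (cell n p) x)"

definition cell_of :: "nat \<Rightarrow> quadruple \<Rightarrow> nat \<times> nat \<times> nat \<times> nat" where
  "cell_of n = (\<lambda>(a, b, c, d). (nat \<lfloor>real n * a\<rfloor>, nat \<lfloor>real n * b\<rfloor>, nat \<lfloor>real n * c\<rfloor>, nat \<lfloor>real n * d\<rfloor>))"

lemma sets_cell [measurable]: "cell n p \<in> sets borel"
  by (cases p) (auto simp: cell_def intro!: borel_Times)

lemma emeasure_cell: "n > 0 \<Longrightarrow> emeasure lborel (cell n p) = ennreal (1 / real n ^ 4)"
proof -
  assume n: "n > 0"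
  obtain g h i j where p: "p = (g, h, i, j)" by (metis prod.exhaust)
  have e: "emeasure lborel {real k / n..<(real k + 1) / n} = ennreal (1 / real n)" for k
  proof -
    have "(real k + 1) / n - real k / n = 1 / real n" by (simp add: add_divide_distrib)
    moreover have "real k / n \<le> (real k + 1) / n" using n by (intro divide_right_mono) auto
    ultimately show ?thesis by simp
  qed
  have "emeasure lborel (cell n p) = ennreal (1 / real n) * (ennreal (1 / real n) * (ennreal (1 / real n) * ennreal (1 / real n)))"
    unfolding p cell_def prod.case by (simp add: emeasure_lborel_Times borel_Times e)
  also have "\<dots> = ennreal (1 / real n * (1 / real n * (1 / real n * (1 / real n))))"
    by (simp only: ennreal_mult'' zero_le_divide_1_iff of_nat_0_le_iff mult_nonneg_nonneg)
  also have "1 / real n * (1 / real n * (1 / real n * (1 / real n))) = 1 / real n ^ 4" by (simp add: power4_eq_xxxx)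
  finally show ?thesis .
qed

lemma integral_step_function: "n > 0 \<Longrightarrow> (\<integral>x. step_function m n x \<partial>lborel) = main_sum m n / real n ^ (4 * m + 4)"
proof -
  assume n: "n > 0"
  have fin: "emeasure lborel (cell n p) < \<infinity>" for p by (simp add: emeasure_cell[OF n])
  have "(\<integral>x. step_function m n x \<partial>lborel) = (\<Sum>p\<in>diagonal_index (triangle n). \<integral>x. cell_value m n p * indicator (cell n p) x \<partial>lborel)"
    unfolding step_function_def
    by (rule Bochner_Integration.integral_sum) (intro integrable_mult_right integrable_real_indicator fin, simp)
  also have "\<dots> = (\<Sum>p\<in>diagonal_index (triangle n). cell_value m n p * (1 / real n ^ 4))"
    by (intro sum.cong refl) (simp add: measure_def emeasure_cell[OF n])
  also have "\<dots> = main_sum m n / real n ^ (4 * m + 4)"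
    by (simp add: main_sum_def cell_value_def case_prod_unfold power_add sum_divide_distrib)
  finally show ?thesis .
qed

lemma mem_cell_iff:
  assumes n: "n > 0"
  shows "x \<in> cell n p \<longleftrightarrow> (0 \<le> fst x \<and> 0 \<le> fst (snd x) \<and> 0 \<le> fst (snd (snd x)) \<and> 0 \<le> snd (snd (snd x))) \<and> p = cell_of n x"
proof -
  have 1: "(real k / n \<le> t \<and> t < (real k + 1) / n) \<longleftrightarrow> 0 \<le> t \<and> k = nat \<lfloor>real n * t\<rfloor>" for k t
  proof
    assume *: "real k / n \<le> t \<and> t < (real k + 1) / n"
    have "0 \<le> real k / n" by simp
    then have t: "0 \<le> t" using * by linarith
    have "real k \<le> real n * t" "real n * t < real k + 1" using * n by (simp_all add: field_simps)
    then have "\<lfloor>real n * t\<rfloor> = int k" by (intro floor_unique) auto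
    then show "0 \<le> t \<and> k = nat \<lfloor>real n * t\<rfloor>" using t by simp
  next
    assume *: "0 \<le> t \<and> k = nat \<lfloor>real n * t\<rfloor>"
    then have "0 \<le> \<lfloor>real n * t\<rfloor>" by simp
    then have "real k = real_of_int \<lfloor>real n * t\<rfloor>" using * by simp
    then have "real k \<le> real n * t" "real n * t < real k + 1" by linarith+
    then show "real k / n \<le> t \<and> t < (real k + 1) / n" using n by (simp add: field_simps)
  qed
  obtain g h i j where p: "p = (g, h, i, j)" by (metis prod.exhaust)
  obtain a b c d where x: "x = (a, b, c, d)" by (metis prod.exhaust)
  show ?thesis unfolding p x cell_def cell_of_def
    by (simp add: 1) blast
qed

lemma step_function_eq:
  assumes n: "n > 0"
  shows "step_function m n x = (if 0 \<le> fst x \<and> 0 \<le> fst (snd x) \<and> 0 \<le> fst (snd (snd x)) \<and> 0 \<le> snd (snd (snd x))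
    \<and> cell_of n x \<in> diagonal_index (triangle n) then cell_value m n (cell_of n x) else 0)"
proof -
  define P where "P = (0 \<le> fst x \<and> 0 \<le> fst (snd x) \<and> 0 \<le> fst (snd (snd x)) \<and> 0 \<le> snd (snd (snd x)))"
  have "step_function m n x = (\<Sum>p\<in>diagonal_index (triangle n). if p = cell_of n x then (if P then cell_value m n p else 0) else 0)"
    unfolding step_function_def by (intro sum.cong refl) (simp add: indicator_def mem_cell_iff[OF n] P_def)
  also have "\<dots> = (if cell_of n x \<in> diagonal_index (triangle n) then (if P then cell_value m n (cell_of n x) else 0) else 0)"
    by (simp add: sum.delta)
  finally show ?thesis by (simp add: P_def)
qed

lemma cell_value_bounds:
  assumes p: "p \<in> diagonal_index (triangle n)"
  shows "0 \<le> cell_value m n p" "cell_value m n p \<le> 4"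
proof -
  obtain g h i j where pp: "p = (g, h, i, j)" by (metis prod.exhaust)
  have t: "g + i + (g + j) < n" "h + i + (h + j) < n" using p by (auto simp: pp diagonal_index_def triangle_def)
  show "0 \<le> cell_value m n p" by (simp add: cell_value_def pp fold_weight_nonneg)
  have "fold_weight n m (g + i) (g + j) * fold_weight n m (h + i) (h + j) \<le> (2 * real n ^ (2 * m)) * (2 * real n ^ (2 * m))"
    using t by (intro mult_mono fold_weight_le fold_weight_nonneg) auto
  also have "\<dots> = 4 * real n ^ (4 * m)" by (simp flip: power_add)
  finally show "cell_value m n p \<le> 4"
    using t(1) by (simp add: cell_value_def pp divide_le_eq)
qed

lemma step_function_bound: "\<bar>step_function m n x\<bar> \<le> 4 * indicator unit_box x"
proof (cases "n = 0")
  case True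
  then have "diagonal_index (triangle n) = {}" by (auto simp: diagonal_index_def triangle_def)
  then show ?thesis by (simp add: step_function_def)
next
  case False
  then have n: "n > 0" by simp
  show ?thesis
  proof (cases "0 \<le> fst x \<and> 0 \<le> fst (snd x) \<and> 0 \<le> fst (snd (snd x)) \<and> 0 \<le> snd (snd (snd x))
    \<and> cell_of n x \<in> diagonal_index (triangle n)")
    case True
    obtain a b c d where x: "x = (a, b, c, d)" by (metis prod.exhaust)
    have le1: "t \<le> 1" if "0 \<le> t" "nat \<lfloor>real n * t\<rfloor> < n" for t
    proof -
      have "\<lfloor>real n * t\<rfloor> < int n" using that(2) by linarith
      then have "real n * t < real n" by (simp add: floor_less_iff)
      then show ?thesis using n by simp
    qed
    have "nat \<lfloor>real n * a\<rfloor> < n" "nat \<lfloor>real n * b\<rfloor> < n" "nat \<lfloor>real n * c\<rfloor> < n" "nat \<lfloor>real n * d\<rfloor> < n"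
      using True unfolding x cell_of_def diagonal_index_def triangle_def by auto
    then have "x \<in> unit_box" using True le1 unfolding x by (simp add: unit_box_def)
    then show ?thesis using True cell_value_bounds[of "cell_of n x" n m] by (simp add: step_function_eq[OF n])
  next
    case False
    then have "step_function m n x = 0" unfolding step_function_eq[OF n] by (rule if_not_P)
    then show ?thesis by simp
  qed
qed

lemma floor_ratio_limit: "(\<lambda>n. real (nat \<lfloor>real n * t\<rfloor>) / real n) \<longlonglongrightarrow> t" if t: "t \<ge> 0"
proof (rule tendsto_sandwich)
  show "\<forall>\<^sub>F n in sequentially. t - 1 / real n \<le> real (nat \<lfloor>real n * t\<rfloor>) / real n"
  proof (rule eventually_sequentiallyI[of 1])
    fix n :: nat assume n: "1 \<le> n"
    have "real n * t - 1 \<le> real (nat \<lfloor>real n * t\<rfloor>)" by linarith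
    then have "(real n * t - 1) / real n \<le> real (nat \<lfloor>real n * t\<rfloor>) / real n" by (rule divide_right_mono) simp
    then show "t - 1 / real n \<le> real (nat \<lfloor>real n * t\<rfloor>) / real n" using n by (simp add: diff_divide_distrib)
  qed
  show "\<forall>\<^sub>F n in sequentially. real (nat \<lfloor>real n * t\<rfloor>) / real n \<le> t"
  proof (rule eventually_sequentiallyI[of 1])
    fix n :: nat assume n: "1 \<le> n"
    have "real n * t \<ge> 0" using t by simp
    then have "real (nat \<lfloor>real n * t\<rfloor>) \<le> real n * t" by linarith
    then show "real (nat \<lfloor>real n * t\<rfloor>) / real n \<le> t" using n by (simp add: field_simps)
  qed
  show "(\<lambda>n. t - 1 / real n) \<longlonglongrightarrow> t" by real_asymp
qed simp

lemma fold_weight_limit: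
  assumes a: "(\<lambda>n. real (u n) / real n) \<longlonglongrightarrow> a" and b: "(\<lambda>n. real (v n) / real n) \<longlonglongrightarrow> b"
    and lt: "\<And>n. n > 0 \<Longrightarrow> u n < n \<and> v n < n"
  shows "(\<lambda>n. fold_weight n m (u n) (v n) / real n ^ (2 * m)) \<longlonglongrightarrow> a ^ m * b ^ m + (1 - a) ^ m * (1 - b) ^ m"
proof -
  have inv: "(\<lambda>n. 1 / real n) \<longlonglongrightarrow> 0" by real_asymp
  have "(\<lambda>n. (real (u n) / real n) ^ m * (real (v n) / real n) ^ m +
     (1 - 1 / real n - real (u n) / real n) ^ m * (1 - 1 / real n - real (v n) / real n) ^ m) \<longlonglongrightarrow>
     a ^ m * b ^ m + (1 - 0 - a) ^ m * (1 - 0 - b) ^ m"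
    by (intro tendsto_intros a b inv)
  moreover have "\<forall>\<^sub>F n in sequentially. (real (u n) / real n) ^ m * (real (v n) / real n) ^ m +
     (1 - 1 / real n - real (u n) / real n) ^ m * (1 - 1 / real n - real (v n) / real n) ^ m =
     fold_weight n m (u n) (v n) / real n ^ (2 * m)"
  proof (rule eventually_sequentiallyI[of 1])
    fix n :: nat assume n: "1 \<le> n"
    then have l: "u n < n" "v n < n" using lt[of n] by auto
    have e: "1 - 1 / real n - real k / real n = real (n - 1 - k) / real n" if "k < n" for k
      using that n by (simp add: of_nat_diff field_simps)
    show "(real (u n) / real n) ^ m * (real (v n) / real n) ^ m +
       (1 - 1 / real n - real (u n) / real n) ^ m * (1 - 1 / real n - real (v n) / real n) ^ m =
       fold_weight n m (u n) (v n) / real n ^ (2 * m)"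
      unfolding e[OF l(1)] e[OF l(2)] fold_weight_def mult_2 power_add power_divide
      by (simp only: times_divide_times_eq add_divide_distrib)
  qed
  ultimately have "(\<lambda>n. fold_weight n m (u n) (v n) / real n ^ (2 * m)) \<longlonglongrightarrow> a ^ m * b ^ m + (1 - 0 - a) ^ m * (1 - 0 - b) ^ m"
    by (rule Lim_transform_eventually)
  then show ?thesis by simp
qed

text \<open>
  Off the two boundary hyperplanes the point is either inside the domain, where the cell values converge by
  continuity, or outside its closure, where the step functions eventually vanish.
\<close>

lemma step_function_tendsto:
  fixes x :: quadruple
  assumes x: "x = (a, b, c, d)" and gen: "2 * a + c + d \<noteq> 1" "2 * b + c + d \<noteq> 1"
  shows "(\<lambda>n. step_function m n x) \<longlonglongrightarrow> indicator integration_domain x * moment_integrand m x"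
proof (cases "0 \<le> a \<and> 0 \<le> b \<and> 0 \<le> c \<and> 0 \<le> d")
  case False
  have "step_function m n x = 0" if "n > 0" for n
    using False unfolding step_function_eq[OF that] x by auto
  then have "\<forall>\<^sub>F n in sequentially. step_function m n x = 0"
    by (intro eventually_sequentiallyI[of 1]) auto
  moreover have "x \<notin> integration_domain" using False by (auto simp: integration_domain_def x)
  ultimately show ?thesis by (simp add: tendsto_eventually)
next
  case nn: True
  define u where "u t n = nat \<lfloor>real n * t\<rfloor>" for t :: real and n
  have ub: "real (u t n) \<le> real n * t" "real n * t - 1 < real (u t n)" if "0 \<le> t" for t n
  proof -
    have "real n * t \<ge> 0" using that by simp
    then show "real (u t n) \<le> real n * t" "real n * t - 1 < real (u t n)" unfolding u_def by linarith+
  qed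
  have cof: "cell_of n x = (u a n, u b n, u c n, u d n)" for n by (simp add: cell_of_def x u_def)
  have ul: "(\<lambda>n. real (u t n) / real n) \<longlonglongrightarrow> t" if "t \<ge> 0" for t
    unfolding u_def by (rule floor_ratio_limit[OF that])
  have outside: ?thesis if "2 * e + c + d > 1" "e = a \<or> e = b" for e
  proof -
    define s where "s = 2 * e + c + d"
    have e: "0 \<le> e" using nn that by auto
    have "\<forall>\<^sub>F n in sequentially. real n * (s - 1) > 4" using that(1) unfolding s_def by real_asymp
    then have "\<forall>\<^sub>F n in sequentially. step_function m n x = 0"
    proof eventually_elim
      case (elim n)
      have n: "n > 0" using elim by (cases n) auto
      have "real n * s = 2 * (real n * e) + real n * c + real n * d" by (simp add: s_def algebra_simps)
      moreover have "real n * s > real n + 4" using elim by (simp add: algebra_simps)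
      ultimately have "real n < 2 * real (u e n) + real (u c n) + real (u d n)"
        using ub(2)[OF e, of n] ub(2)[of c n] ub(2)[of d n] nn by linarith
      then have "n < 2 * u e n + u c n + u d n" by linarith
      then have "cell_of n x \<notin> diagonal_index (triangle n)"
        using that(2) by (auto simp: cof diagonal_index_def triangle_def)
      then show ?case by (simp add: step_function_eq[OF n])
    qed
    moreover have "x \<notin> integration_domain" using that by (auto simp: integration_domain_def x)
    ultimately show ?thesis by (simp add: tendsto_eventually)
  qed
  show ?thesis
  proof (cases "2 * a + c + d < 1 \<and> 2 * b + c + d < 1")
    case False
    then show ?thesis using gen outside[of a] outside[of b] by fastforce
  next
    case True
    then have dom: "x \<in> integration_domain" using nn by (simp add: integration_domain_def x)
    have lt: "2 * u e n + u c n + u d n < n" if "n > 0" "e = a \<or> e = b" for e n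
    proof -
      have e: "0 \<le> e" "2 * e + c + d < 1" using nn True that by auto
      have "2 * real (u e n) + real (u c n) + real (u d n) \<le> real n * (2 * e + c + d)"
        using ub(1)[OF e(1), of n] ub(1)[of c n] ub(1)[of d n] nn by (simp add: algebra_simps)
      also have "\<dots> < real n * 1" using e(2) that(1) by (intro mult_strict_left_mono) auto
      finally show ?thesis by linarith
    qed
    have lim: "(\<lambda>n. fold_weight n m (u e n + u c n) (u e n + u d n) / real n ^ (2 * m)) \<longlonglongrightarrow>
        (e + c) ^ m * (e + d) ^ m + (1 - (e + c)) ^ m * (1 - (e + d)) ^ m" if e: "e = a \<or> e = b" for e
    proof (rule fold_weight_limit)
      have "e \<ge> 0" using e nn by auto
      then show "(\<lambda>n. real (u e n + u c n) / real n) \<longlonglongrightarrow> e + c" "(\<lambda>n. real (u e n + u d n) / real n) \<longlonglongrightarrow> e + d"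
        using nn by (simp_all add: add_divide_distrib tendsto_add ul)
      show "u e n + u c n < n \<and> u e n + u d n < n" if "n > 0" for n using lt[OF that e] by auto
    qed
    have "(\<lambda>n. (fold_weight n m (u a n + u c n) (u a n + u d n) / real n ^ (2 * m)) *
        (fold_weight n m (u b n + u c n) (u b n + u d n) / real n ^ (2 * m))) \<longlonglongrightarrow>
       ((a + c) ^ m * (a + d) ^ m + (1 - (a + c)) ^ m * (1 - (a + d)) ^ m) *
       ((b + c) ^ m * (b + d) ^ m + (1 - (b + c)) ^ m * (1 - (b + d)) ^ m)"
      by (intro tendsto_mult lim) auto
    moreover have "\<forall>\<^sub>F n in sequentially. (fold_weight n m (u a n + u c n) (u a n + u d n) / real n ^ (2 * m)) *
        (fold_weight n m (u b n + u c n) (u b n + u d n) / real n ^ (2 * m)) = step_function m n x"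
    proof (rule eventually_sequentiallyI[of 1])
      fix n :: nat assume "1 \<le> n"
      then have n: "n > 0" by simp
      have "cell_of n x \<in> diagonal_index (triangle n)"
        using lt[OF n, of a] lt[OF n, of b] by (simp add: cof diagonal_index_def triangle_def)
      then have "step_function m n x = cell_value m n (cell_of n x)" using nn by (simp add: step_function_eq[OF n] x)
      also have "\<dots> = fold_weight n m (u a n + u c n) (u a n + u d n) * fold_weight n m (u b n + u c n) (u b n + u d n) / (real n ^ (2 * m) * real n ^ (2 * m))"
        by (simp add: cell_value_def cof flip: power_add)
      finally show "(fold_weight n m (u a n + u c n) (u a n + u d n) / real n ^ (2 * m)) *
        (fold_weight n m (u b n + u c n) (u b n + u d n) / real n ^ (2 * m)) = step_function m n x" by simp
    qed
    ultimately have "(\<lambda>n. step_function m n x) \<longlonglongrightarrow>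
       ((a + c) ^ m * (a + d) ^ m + (1 - (a + c)) ^ m * (1 - (a + d)) ^ m) *
       ((b + c) ^ m * (b + d) ^ m + (1 - (b + c)) ^ m * (1 - (b + d)) ^ m)"
      by (rule Lim_transform_eventually)
    then show ?thesis using dom by (simp add: moment_integrand_def x diff_diff_eq)
  qed
qed

lemma AE_generic:
  "AE x in lborel. 2 * fst (x :: quadruple) + fst (snd (snd x)) + snd (snd (snd x)) \<noteq> 1 \<and>
    2 * fst (snd x) + fst (snd (snd x)) + snd (snd (snd x)) \<noteq> 1"
proof -
  have *: "AE x in lborel. v \<bullet> x \<noteq> 1" if "v \<noteq> 0" for v :: quadruple
  proof -
    have "negligible {x. v \<bullet> x = 1}" using that by (intro negligible_hyperplane) simp
    then have "{x. v \<bullet> x = 1} \<in> null_sets lebesgue" by (simp add: negligible_iff_null_sets)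
    then have "AE x in lebesgue. x \<notin> {x. v \<bullet> x = 1}" by (rule AE_not_in)
    then show ?thesis by (simp add: AE_completion_iff)
  qed
  have "AE x in lborel. (2, 0, 1, 1) \<bullet> (x :: quadruple) \<noteq> 1" "AE x in lborel. (0, 2, 1, 1) \<bullet> (x :: quadruple) \<noteq> 1"
    by (rule *; simp add: zero_prod_def)+
  then show ?thesis by eventually_elim (simp add: inner_prod_def)
qed

text \<open>
  The scaled main sum is the integral of \<open>step_function m n\<close>. Dominated convergence applies because these functions are
  bounded by \<open>4\<close> on the unit box and converge almost everywhere.
\<close>

lemma main_sum_tendsto: "(\<lambda>n. main_sum m n / real n ^ (4 * m + 4)) \<longlonglongrightarrow> moment_integral m"
proof -
  have "(\<lambda>n. \<integral>x. step_function m n x \<partial>lborel) \<longlonglongrightarrow> moment_integral m"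
    unfolding moment_integral_def
  proof (rule integral_dominated_convergence[where w = "\<lambda>x. 4 * indicator unit_box x"])
    show "(\<lambda>x. indicator integration_domain x * moment_integrand m x) \<in> borel_measurable lborel" by measurable
    show "step_function m n \<in> borel_measurable lborel" for n
      unfolding step_function_def[abs_def] by measurable
    show "integrable lborel (\<lambda>x. 4 * indicator unit_box x :: real)" by (rule integrable_unit_box)
    show "AE x in lborel. (\<lambda>n. step_function m n x) \<longlonglongrightarrow> indicator integration_domain x * moment_integrand m x"
      using AE_generic
    proof eventually_elim
      case (elim x)
      then show ?case
        by (intro step_function_tendsto[of x "fst x" "fst (snd x)" "fst (snd (snd x))" "snd (snd (snd x))"]) auto
    qed
    show "AE x in lborel. norm (step_function m n x) \<le> 4 * indicator unit_box x" for n
      using step_function_bound by simp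
  qed
  moreover have "\<forall>\<^sub>F n in sequentially. (\<integral>x. step_function m n x \<partial>lborel) = main_sum m n / real n ^ (4 * m + 4)"
    by (intro eventually_sequentiallyI[of 1] integral_step_function) simp
  ultimately show ?thesis by (rule Lim_transform_eventually)
qed

section \<open>The integral for large exponents\<close>

text \<open>
  The limit of the integrand after scaling the variables by \<open>m\<close>: the product of \<open>exp (- a - c)\<close>, \<open>exp (- a - d)\<close>,
  \<open>exp (- b - c)\<close> and \<open>exp (- b - d)\<close> on the nonnegative orthant.
\<close>

definition orthant_exp :: "quadruple \<Rightarrow> real" where
  "orthant_exp = (\<lambda>(a, b, c, d). (indicator {0..} a * exp (- (2 * a))) * ((indicator {0..} b * exp (- (2 * b))) *
     ((indicator {0..} c * exp (- (2 * c))) * (indicator {0..} d * exp (- (2 * d))))))"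

lemma nn_integral_half_line: "(\<integral>\<^sup>+a. ennreal (indicator {0..} a * exp (- (2 * a))) \<partial>lborel) = ennreal (1 / 2)"
proof (rule nn_integral_has_integral_lborel)
  have "((\<lambda>x::real. exp (- 2 * x)) has_integral exp (- 2 * 0) / 2) {0..}"
    by (rule has_integral_exp_minus_to_infinity) simp
  then have "((\<lambda>x::real. exp (- (2 * x))) has_integral 1 / 2) {0..}" by simp
  then have "((\<lambda>x::real. if x \<in> {0..} then exp (- (2 * x)) else 0) has_integral 1 / 2) UNIV"
    by (simp only: has_integral_restrict_UNIV)
  moreover have "(\<lambda>x::real. if x \<in> {0..} then exp (- (2 * x)) else 0) = (\<lambda>a. indicator {0..} a * exp (- (2 * a)))"
    by (auto simp: indicator_def fun_eq_iff)
  ultimately show "((\<lambda>a::real. indicator {0..} a * exp (- (2 * a))) has_integral 1 / 2) UNIV" by simp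
qed auto

lemma borel_measurable_compose_continuous:
  "continuous_on UNIV p \<Longrightarrow> f \<in> borel_measurable borel \<Longrightarrow> (\<lambda>x. f (p x)) \<in> borel_measurable borel"
  by (drule borel_measurable_continuous_onI) (rule measurable_compose)

lemma orthant_exp_integral:
  shows "integrable lborel orthant_exp" "(\<integral>x. orthant_exp x \<partial>lborel) = 1 / 16"
proof -
  define h :: "real \<Rightarrow> real" where "h a = indicator {0..} a * exp (- (2 * a))" for a
  have h0: "h a \<ge> 0" for a by (simp add: h_def)
  have hm [measurable]: "h \<in> borel_measurable borel" unfolding h_def[abs_def] by measurable
  note hc = borel_measurable_compose_continuous[OF _ hm]
  have oe: "orthant_exp x = h (fst x) * (h (fst (snd x)) * (h (fst (snd (snd x))) * h (snd (snd (snd x)))))" for x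
    by (simp add: orthant_exp_def h_def case_prod_unfold)
  have [measurable]: "orthant_exp \<in> borel_measurable borel"
  proof -
    have "(\<lambda>x :: quadruple. h (fst x) * (h (fst (snd x)) * (h (fst (snd (snd x))) * h (snd (snd (snd x)))))) \<in> borel_measurable borel"
      by (intro borel_measurable_times hc continuous_intros)
    then show ?thesis by (simp add: oe[abs_def])
  qed
  have nn: "(\<integral>\<^sup>+a. ennreal (h a) \<partial>lborel) = ennreal (1 / 2)" unfolding h_def by (rule nn_integral_half_line)
  define k2 :: "real \<times> real \<Rightarrow> ennreal" where "k2 y = ennreal (h (fst y)) * ennreal (h (snd y))" for y
  have m2 [measurable]: "k2 \<in> borel_measurable borel"
    unfolding k2_def[abs_def] by (intro borel_measurable_times_ennreal measurable_compose[OF _ measurable_ennreal] hc continuous_intros)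
  define k3 :: "real \<times> real \<times> real \<Rightarrow> ennreal" where "k3 y = ennreal (h (fst y)) * k2 (snd y)" for y
  have m3 [measurable]: "k3 \<in> borel_measurable borel"
    unfolding k3_def[abs_def]
    by (intro borel_measurable_times_ennreal borel_measurable_compose_continuous[OF _ m2] measurable_compose[OF _ measurable_ennreal] hc continuous_intros)
  have "(\<integral>\<^sup>+x. ennreal (orthant_exp x) \<partial>lborel) = (\<integral>\<^sup>+x. ennreal (h (fst x)) * k3 (snd x) \<partial>lborel)"
    by (simp add: oe k2_def k3_def ennreal_mult'' h0)
  also have "\<dots> = ennreal (1 / 2) * (\<integral>\<^sup>+y. k3 y \<partial>lborel)"
    by (subst nn_integral_lborel_Times) (simp_all add: nn)
  also have "(\<integral>\<^sup>+y. k3 y \<partial>lborel) = ennreal (1 / 2) * (\<integral>\<^sup>+y. k2 y \<partial>lborel)"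
    unfolding k3_def by (subst nn_integral_lborel_Times) (simp_all add: nn)
  also have "(\<integral>\<^sup>+y. k2 y \<partial>lborel) = ennreal (1 / 2) * ennreal (1 / 2)"
    unfolding k2_def by (subst nn_integral_lborel_Times) (simp_all add: nn)
  also have "ennreal (1 / 2) * (ennreal (1 / 2) * (ennreal (1 / 2) * ennreal (1 / 2))) = ennreal (1 / 2 * (1 / 2 * (1 / 2 * (1 / 2))))"
    by (simp only: ennreal_mult'' zero_le_divide_iff zero_le_one zero_le_numeral mult_nonneg_nonneg disjI1 conjI simp_thms)
  finally have total: "(\<integral>\<^sup>+x. ennreal (orthant_exp x) \<partial>lborel) = ennreal (1 / 16)" by simp
  have pos: "AE x in lborel. 0 \<le> orthant_exp x" by (simp add: oe h0)
  show "integrable lborel orthant_exp"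
    by (rule integrableI_nonneg) (use total pos in auto)
  show "(\<integral>x. orthant_exp x \<partial>lborel) = 1 / 16"
    by (subst integral_eq_nn_integral) (use total pos in auto)
qed

lemma integral_lborel_scale:
  fixes f :: "'a::euclidean_space \<Rightarrow> real"
  assumes [measurable]: "f \<in> borel_measurable borel" and c: "c > 0"
  shows "(\<integral>x. f x \<partial>lborel) = c ^ DIM('a) * (\<integral>x. f (c *\<^sub>R x) \<partial>lborel)"
proof -
  have "(\<integral>x. f x \<partial>lborel) = (\<integral>x. f x \<partial>(density (distr lborel borel (\<lambda>x::'a. 0 + c *\<^sub>R x)) (\<lambda>_. ennreal (\<bar>c\<bar> ^ DIM('a)))))"
    using lborel_affine[of c "0 :: 'a"] c by simp
  also have "\<dots> = (\<integral>x. \<bar>c\<bar> ^ DIM('a) *\<^sub>R f x \<partial>(distr lborel borel (\<lambda>x::'a. 0 + c *\<^sub>R x)))"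
    by (rule integral_density) auto
  also have "\<dots> = (\<integral>x. \<bar>c\<bar> ^ DIM('a) *\<^sub>R f (0 + c *\<^sub>R x) \<partial>lborel)"
    by (rule integral_distr) auto
  finally show ?thesis using c by simp
qed

definition dominant_part :: "nat \<Rightarrow> quadruple \<Rightarrow> real" where
  "dominant_part m = (\<lambda>(a, b, c, d). (1 - a - c) ^ m * (1 - a - d) ^ m * ((1 - b - c) ^ m * (1 - b - d) ^ m))"

lemma measurable_dominant_part [measurable]: "dominant_part m \<in> borel_measurable borel"
  unfolding dominant_part_def case_prod_unfold
  by (intro borel_measurable_continuous_onI continuous_intros)

text \<open>
  On the domain \<open>(e + c) + (e + d) < 1\<close> for both \<open>e = a\<close> and \<open>e = b\<close>, hence \<open>(e + c) * (e + d) \<le> 1/4\<close>: every product other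
  than the dominant one is exponentially small.
\<close>

lemma moment_integrand_near_dominant:
  assumes x: "x \<in> integration_domain"
  shows "\<bar>moment_integrand m x - dominant_part m x\<bar> \<le> 3 * (1 / 4) ^ m" "0 \<le> dominant_part m x" "dominant_part m x \<le> 1"
proof -
  obtain a b c d where xx: "x = (a, b, c, d)" by (metis prod.exhaust)
  have nn: "0 \<le> a" "0 \<le> b" "0 \<le> c" "0 \<le> d" "2 * a + c + d < 1" "2 * b + c + d < 1"
    using x by (auto simp: xx integration_domain_def)
  define u where "u e = (e + c) ^ m * (e + d) ^ m" for e
  define v where "v e = (1 - e - c) ^ m * (1 - e - d) ^ m" for e
  have uv: "0 \<le> u e" "u e \<le> (1 / 4) ^ m" "0 \<le> v e" "v e \<le> 1" if "e = a \<or> e = b" for e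
  proof -
    have e: "0 \<le> e" "2 * e + c + d < 1" using that nn by auto
    show "0 \<le> u e" using e nn by (simp add: u_def)
    have "4 * ((e + c) * (e + d)) \<le> ((e + c) + (e + d))\<^sup>2"
      using zero_le_power2[of "c - d"] by (simp add: power2_eq_square algebra_simps)
    also have "\<dots> \<le> 1\<^sup>2" using e nn by (intro power_mono) auto
    finally have "(e + c) * (e + d) \<le> 1 / 4" by simp
    then have "((e + c) * (e + d)) ^ m \<le> (1 / 4) ^ m" using e nn by (intro power_mono) auto
    then show "u e \<le> (1 / 4) ^ m" by (simp add: u_def power_mult_distrib)
    show "0 \<le> v e" using e nn by (simp add: v_def)
    have "v e \<le> 1 * 1" unfolding v_def using e nn by (intro mult_mono power_le_one) auto
    then show "v e \<le> 1" by simp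
  qed
  have q1: "(1 / 4 :: real) ^ m \<le> 1" by (intro power_le_one) auto
  have D: "dominant_part m x = v a * v b" by (simp add: dominant_part_def xx v_def)
  have M: "moment_integrand m x = (u a + v a) * (u b + v b)" by (simp add: moment_integrand_def xx u_def v_def)
  show "0 \<le> dominant_part m x" unfolding D using uv by simp
  have "v a * v b \<le> 1 * 1" using uv by (intro mult_mono) auto
  then show "dominant_part m x \<le> 1" unfolding D by simp
  have "u a * u b \<le> (1 / 4) ^ m * 1" using uv[of a] uv[of b] q1 by (intro mult_mono) auto
  moreover have "u a * v b \<le> (1 / 4) ^ m * 1" using uv[of a] uv[of b] by (intro mult_mono) auto
  moreover have "v a * u b \<le> 1 * (1 / 4) ^ m" using uv[of a] uv[of b] by (intro mult_mono) auto
  moreover have "moment_integrand m x - dominant_part m x = u a * u b + u a * v b + v a * u b"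
    unfolding M D by (simp add: algebra_simps)
  moreover have "0 \<le> u a * u b" "0 \<le> u a * v b" "0 \<le> v a * u b" using uv[of a] uv[of b] by simp_all
  ultimately show "\<bar>moment_integrand m x - dominant_part m x\<bar> \<le> 3 * (1 / 4) ^ m" by linarith
qed

lemma integrable_domain_bounded:
  fixes f :: "quadruple \<Rightarrow> real"
  assumes [measurable]: "f \<in> borel_measurable borel" and B: "\<And>x. x \<in> integration_domain \<Longrightarrow> \<bar>f x\<bar> \<le> B" "B \<ge> 0"
  shows "integrable lborel (\<lambda>x. indicator integration_domain x * f x)"
proof (rule Bochner_Integration.integrable_bound[OF integrable_unit_box[of B]])
  show "(\<lambda>x. indicator integration_domain x * f x) \<in> borel_measurable lborel" by measurable
  show "AE x in lborel. norm (indicator integration_domain x * f x) \<le> norm (B * indicator unit_box x :: real)"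
    using B domain_subset_box by (auto simp: indicator_def abs_mult)
qed

lemma dominant_integral_bound:
  "\<bar>moment_integral m - (\<integral>x. indicator integration_domain x * dominant_part m x \<partial>lborel)\<bar> \<le> 3 * (1 / 4) ^ m"
proof -
  have q1: "(1 / 4 :: real) ^ m \<le> 1" by (intro power_le_one) auto
  have bM: "\<bar>moment_integrand m x\<bar> \<le> 4" "\<bar>dominant_part m x\<bar> \<le> 1" if "x \<in> integration_domain" for x
    using moment_integrand_near_dominant[OF that, of m] q1 by linarith+
  have int: "integrable lborel (\<lambda>x. indicator integration_domain x * moment_integrand m x)"
    "integrable lborel (\<lambda>x. indicator integration_domain x * dominant_part m x)"
    using bM by (intro integrable_domain_bounded[of _ 4] integrable_domain_bounded[of _ 1]; simp)+
  have "moment_integral m - (\<integral>x. indicator integration_domain x * dominant_part m x \<partial>lborel) =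
    (\<integral>x. indicator integration_domain x * moment_integrand m x - indicator integration_domain x * dominant_part m x \<partial>lborel)"
    unfolding moment_integral_def by (rule Bochner_Integration.integral_diff[OF int, symmetric])
  also have "\<bar>\<dots>\<bar> \<le> (\<integral>x. 3 * (1 / 4) ^ m * indicator unit_box x \<partial>lborel)"
    unfolding real_norm_def[symmetric]
  proof (rule Bochner_Integration.integral_norm_bound_integral)
    show "integrable lborel (\<lambda>x. indicator integration_domain x * moment_integrand m x - indicator integration_domain x * dominant_part m x)"
      by (rule Bochner_Integration.integrable_diff[OF int])
    show "integrable lborel (\<lambda>x. 3 * (1 / 4) ^ m * indicator unit_box x :: real)" by (rule integrable_unit_box)
    show "norm (indicator integration_domain x * moment_integrand m x - indicator integration_domain x * dominant_part m x)
       \<le> 3 * (1 / 4) ^ m * indicator unit_box x" for x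
      using moment_integrand_near_dominant(1)[of x m] domain_subset_box by (auto simp: indicator_def)
  qed
  also have "\<dots> = 3 * (1 / 4) ^ m" by (simp add: measure_def emeasure_unit_box)
  finally show ?thesis .
qed

text \<open>
  Dominated convergence again: \<open>(1 - s/m)^m\<close> tends to \<open>exp (- s)\<close> and never exceeds it for \<open>0 \<le> s \<le> m\<close>.
\<close>

lemma dominant_scaled_tendsto:
  "(\<lambda>m. \<integral>x. indicator integration_domain (inverse (real (Suc m)) *\<^sub>R x) * dominant_part (Suc m) (inverse (real (Suc m)) *\<^sub>R x) \<partial>lborel)
    \<longlonglongrightarrow> 1 / 16"
proof -
  define F where "F m x = indicator integration_domain (inverse (real (Suc m)) *\<^sub>R x) * dominant_part (Suc m) (inverse (real (Suc m)) *\<^sub>R x)" for m and x :: quadruple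
  have "(\<lambda>m. \<integral>x. F m x \<partial>lborel) \<longlonglongrightarrow> (\<integral>x. orthant_exp x \<partial>lborel)"
  proof (rule integral_dominated_convergence[where w = orthant_exp])
    show "orthant_exp \<in> borel_measurable lborel" using orthant_exp_integral(1) by (rule borel_measurable_integrable)
    show "integrable lborel orthant_exp" by (rule orthant_exp_integral(1))
    have [measurable]: "(\<lambda>x :: quadruple. c *\<^sub>R x) \<in> borel_measurable borel" for c
      by (intro borel_measurable_continuous_onI continuous_intros)
    show "F m \<in> borel_measurable lborel" for m
    proof -
      have "(\<lambda>y. indicator integration_domain y * dominant_part (Suc m) y) \<in> borel_measurable borel" by measurable
      then have "(\<lambda>x. (\<lambda>y. indicator integration_domain y * dominant_part (Suc m) y) (inverse (real (Suc m)) *\<^sub>R x)) \<in> borel_measurable borel"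
        by (rule measurable_compose[rotated]) measurable
      then show ?thesis by (simp add: F_def[abs_def])
    qed
    have Fval: "F m (a, b, c, d) = (if 0 \<le> a \<and> 0 \<le> b \<and> 0 \<le> c \<and> 0 \<le> d \<and> 2 * a + c + d < real (Suc m) \<and> 2 * b + c + d < real (Suc m)
      then (1 + (- (a + c)) / real (Suc m)) ^ Suc m * (1 + (- (a + d)) / real (Suc m)) ^ Suc m *
        ((1 + (- (b + c)) / real (Suc m)) ^ Suc m * (1 + (- (b + d)) / real (Suc m)) ^ Suc m) else 0)" for m a b c d
    proof -
      define M where "M = real (Suc m)"
      have M: "M > 0" by (simp add: M_def)
      have dom: "inverse M *\<^sub>R (a, b, c, d) \<in> integration_domain \<longleftrightarrow>
          (0 \<le> a \<and> 0 \<le> b \<and> 0 \<le> c \<and> 0 \<le> d \<and> 2 * a + c + d < M \<and> 2 * b + c + d < M)"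
        using M by (simp add: integration_domain_def zero_le_mult_iff field_simps)
      have e: "1 - inverse M * s - inverse M * t = 1 + (- (s + t)) / M" for s t
        by (simp add: divide_inverse algebra_simps)
      show ?thesis unfolding F_def M_def[symmetric] indicator_def dom
        by (simp add: dominant_part_def e del: power_Suc)
    qed
    have oval: "orthant_exp (a, b, c, d) = (if 0 \<le> a \<and> 0 \<le> b \<and> 0 \<le> c \<and> 0 \<le> d
      then exp (- (a + c)) * exp (- (a + d)) * (exp (- (b + c)) * exp (- (b + d))) else 0)" for a b c d
    proof -
      have "exp (- (2 * a)) * (exp (- (2 * b)) * (exp (- (2 * c)) * exp (- (2 * d)))) =
          exp (- (a + c)) * exp (- (a + d)) * (exp (- (b + c)) * exp (- (b + d)))"
        unfolding exp_add[symmetric] by (simp add: algebra_simps)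
      then show ?thesis by (simp add: orthant_exp_def indicator_def)
    qed
    show "AE x in lborel. (\<lambda>m. F m x) \<longlonglongrightarrow> orthant_exp x"
    proof (rule AE_I2)
      fix x :: quadruple
      obtain a b c d where x: "x = (a, b, c, d)" by (metis prod.exhaust)
      show "(\<lambda>m. F m x) \<longlonglongrightarrow> orthant_exp x"
      proof (cases "0 \<le> a \<and> 0 \<le> b \<and> 0 \<le> c \<and> 0 \<le> d")
        case False
        then have "F m x = 0" for m unfolding x Fval by auto
        moreover have "orthant_exp x = 0" using False unfolding x oval by auto
        ultimately show ?thesis by simp
      next
        case True
        have lim: "(\<lambda>m. (1 + s / real (Suc m)) ^ Suc m) \<longlonglongrightarrow> exp s" for s :: real
          using tendsto_exp_limit_sequentially[of s] by (rule LIMSEQ_Suc)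
        have "(\<lambda>m. (1 + (- (a + c)) / real (Suc m)) ^ Suc m * (1 + (- (a + d)) / real (Suc m)) ^ Suc m *
          ((1 + (- (b + c)) / real (Suc m)) ^ Suc m * (1 + (- (b + d)) / real (Suc m)) ^ Suc m)) \<longlonglongrightarrow> orthant_exp x"
          unfolding x oval using True by (simp only: simp_thms if_True) (intro tendsto_mult lim)
        moreover have "\<forall>\<^sub>F m in sequentially. (1 + (- (a + c)) / real (Suc m)) ^ Suc m * (1 + (- (a + d)) / real (Suc m)) ^ Suc m *
          ((1 + (- (b + c)) / real (Suc m)) ^ Suc m * (1 + (- (b + d)) / real (Suc m)) ^ Suc m) = F m x"
        proof -
          have "\<forall>\<^sub>F m in sequentially. 2 * a + c + d < real (Suc m)" "\<forall>\<^sub>F m in sequentially. 2 * b + c + d < real (Suc m)"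
            by real_asymp+
          then show ?thesis by eventually_elim (use True in \<open>simp add: x Fval del: power_Suc of_nat_Suc\<close>)
        qed
        ultimately show ?thesis by (rule Lim_transform_eventually)
      qed
    qed
    show "AE x in lborel. norm (F m x) \<le> orthant_exp x" for m
    proof (rule AE_I2)
      fix x :: quadruple
      obtain a b c d where x: "x = (a, b, c, d)" by (metis prod.exhaust)
      show "norm (F m x) \<le> orthant_exp x"
      proof (cases "0 \<le> a \<and> 0 \<le> b \<and> 0 \<le> c \<and> 0 \<le> d \<and> 2 * a + c + d < real (Suc m) \<and> 2 * b + c + d < real (Suc m)")
        case False
        then have "F m x = 0" unfolding x Fval by (rule if_not_P)
        moreover have "0 \<le> orthant_exp x" unfolding x oval by simp
        ultimately show ?thesis by simp
      next
        case True
        have fac: "0 \<le> (1 + (- s) / real (Suc m)) ^ Suc m \<and> (1 + (- s) / real (Suc m)) ^ Suc m \<le> exp (- s)"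
          if s: "s \<le> real (Suc m)" for s
        proof -
          have 0: "0 \<le> 1 + (- s) / real (Suc m)" using s by (simp add: field_simps del: of_nat_Suc)
          have "1 + (- s) / real (Suc m) \<le> exp ((- s) / real (Suc m))" by (rule exp_ge_add_one_self)
          then have "(1 + (- s) / real (Suc m)) ^ Suc m \<le> exp ((- s) / real (Suc m)) ^ Suc m" using 0 by (intro power_mono)
          also have "\<dots> = exp (real (Suc m) * ((- s) / real (Suc m)))" by (rule exp_of_nat_mult[symmetric])
          also have "real (Suc m) * ((- s) / real (Suc m)) = - s" by (simp del: of_nat_Suc)
          finally show ?thesis using zero_le_power[OF 0, of "Suc m"] by blast
        qed
        define A where "A s = (1 + (- s) / real (Suc m)) ^ Suc m" for s
        have A: "0 \<le> A s" "A s \<le> exp (- s)" if "s \<le> real (Suc m)" for s using fac[OF that] by (auto simp: A_def)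
        have s: "a + c \<le> real (Suc m)" "a + d \<le> real (Suc m)" "b + c \<le> real (Suc m)" "b + d \<le> real (Suc m)"
          using True by linarith+
        have "F m x = A (a + c) * A (a + d) * (A (b + c) * A (b + d))"
          unfolding x Fval A_def using True by (simp del: power_Suc of_nat_Suc)
        moreover have "0 \<le> A (a + c) * A (a + d) * (A (b + c) * A (b + d))" using A(1) s by simp
        moreover have "A (a + c) * A (a + d) * (A (b + c) * A (b + d)) \<le> exp (- (a + c)) * exp (- (a + d)) * (exp (- (b + c)) * exp (- (b + d)))"
          by (intro mult_mono A s mult_nonneg_nonneg exp_ge_zero)
        ultimately show ?thesis unfolding x oval using True by simp
      qed
    qed
  qed
  then show ?thesis by (simp only: orthant_exp_integral(2) F_def)
qed

text \<open>
  Scaling four variables by \<open>m\<close> produces the factor \<open>m^4\<close>; the discarded part of the integrand is \<open>O(4^(-m))\<close>.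
\<close>

lemma moment_integral_asymp: "moment_integral \<sim>[at_top] (\<lambda>m. 1 / (16 * real m ^ 4))"
proof -
  define J where "J m = (\<integral>x. indicator integration_domain x * dominant_part m x \<partial>lborel)" for m
  have Jscale: "real (Suc m) ^ 4 * J (Suc m) =
    (\<integral>x. indicator integration_domain (inverse (real (Suc m)) *\<^sub>R x) * dominant_part (Suc m) (inverse (real (Suc m)) *\<^sub>R x) \<partial>lborel)" for m
  proof -
    have "(\<lambda>y. indicator integration_domain y * dominant_part (Suc m) y) \<in> borel_measurable borel" by measurable
    then have "J (Suc m) = inverse (real (Suc m)) ^ DIM(quadruple) *
      (\<integral>x. indicator integration_domain (inverse (real (Suc m)) *\<^sub>R x) * dominant_part (Suc m) (inverse (real (Suc m)) *\<^sub>R x) \<partial>lborel)"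
      unfolding J_def by (rule integral_lborel_scale) simp
    moreover have "DIM(quadruple) = 4" by simp
    moreover have "real (Suc m) ^ 4 * inverse (real (Suc m)) ^ 4 = 1"
      by (simp flip: power_mult_distrib del: of_nat_Suc)
    ultimately show ?thesis by (simp only: mult.assoc[symmetric] mult_1)
  qed
  have "(\<lambda>m. real (Suc m) ^ 4 * J (Suc m)) \<longlonglongrightarrow> 1 / 16"
    unfolding Jscale by (rule dominant_scaled_tendsto)
  then have J: "(\<lambda>m. real m ^ 4 * J m) \<longlonglongrightarrow> 1 / 16" by (rule LIMSEQ_imp_Suc)
  have "(\<lambda>m. real m ^ 4 * (moment_integral m - J m)) \<longlonglongrightarrow> 0"
  proof (rule Lim_null_comparison)
    show "\<forall>\<^sub>F m in sequentially. norm (real m ^ 4 * (moment_integral m - J m)) \<le> real m ^ 4 * (3 * (1 / 4) ^ m)"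
      using dominant_integral_bound by (intro always_eventually allI) (simp add: abs_mult J_def mult_left_mono)
    show "(\<lambda>m. real m ^ 4 * (3 * (1 / 4) ^ m)) \<longlonglongrightarrow> 0" by real_asymp
  qed
  from tendsto_add[OF J this] have "(\<lambda>m. real m ^ 4 * moment_integral m) \<longlonglongrightarrow> 1 / 16"
    by (simp add: algebra_simps)
  from tendsto_mult[OF tendsto_const[of 16] this] have lim: "(\<lambda>m. 16 * (real m ^ 4 * moment_integral m)) \<longlonglongrightarrow> 1" by simp
  show ?thesis
  proof (rule asymp_equivI')
    show "(\<lambda>m. moment_integral m / (1 / (16 * real m ^ 4))) \<longlonglongrightarrow> 1"
      using lim unfolding divide_divide_eq_right div_by_1 by (simp only: mult.commute mult.left_commute)
  qed
qed

section \<open>The limit of the fourth moment\<close>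

lemma block_width_limit:
  assumes K: "K > 0"
  shows "(\<lambda>n. real (block_width n K + 1) / real n) \<longlonglongrightarrow> 1 / (2 * real K)"
proof -
  have "block_width n K = nat \<lfloor>real n * (1 / (2 * real K))\<rfloor>" for n
  proof -
    have "\<lfloor>real n * (1 / (2 * real K))\<rfloor> = int (n div (2 * K))"
      using floor_divide_of_nat_eq[of n "2 * K", where ?'a = real] by (simp add: mult.commute)
    then show ?thesis by (simp add: block_width_def div_mult2_eq)
  qed
  then have "(\<lambda>n. real (block_width n K) / real n) \<longlonglongrightarrow> 1 / (2 * real K)"
    using floor_ratio_limit[of "1 / (2 * real K)"] by simp
  moreover have "(\<lambda>n. 1 / real n) \<longlonglongrightarrow> 0" by real_asymp
  ultimately have "(\<lambda>n. real (block_width n K) / real n + 1 / real n) \<longlonglongrightarrow> 1 / (2 * real K) + 0"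
    by (rule tendsto_add)
  then show ?thesis by (simp add: add_divide_distrib add.commute)
qed

lemma folding_error_limit:
  assumes K: "K > 0"
  shows "(\<lambda>n. 50 * real (2 * K + 1) ^ 2 * (8 * (real (block_width n K + 1) / real n) ^ 3 + 8 * F / real n ^ 2) +
     4 * real (2 * K + 1) ^ 3 * (real (2 * K + 1) * F / real n
       + 2 * real (2 * K + 1) * (8 * (real (block_width n K + 1) / real n) ^ 3 + 8 * F / real n ^ 2) / real n))
   \<longlonglongrightarrow> 50 * real (2 * K + 1) ^ 2 * (1 / real K ^ 3)"
proof -
  have inv: "(\<lambda>n. c / real n) \<longlonglongrightarrow> 0" "(\<lambda>n. c / real n ^ 2) \<longlonglongrightarrow> 0" for c by real_asymp+
  have bb: "(\<lambda>n. 8 * (real (block_width n K + 1) / real n) ^ 3 + 8 * F / real n ^ 2) \<longlonglongrightarrow> 8 * (1 / (2 * real K)) ^ 3 + 0"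
    by (intro tendsto_intros block_width_limit[OF K] inv)
  have "(\<lambda>n. (2 * real (2 * K + 1) / real n) * (8 * (real (block_width n K + 1) / real n) ^ 3 + 8 * F / real n ^ 2))
     \<longlonglongrightarrow> 0 * (8 * (1 / (2 * real K)) ^ 3 + 0)"
    by (intro tendsto_mult bb inv)
  then have "(\<lambda>n. 2 * real (2 * K + 1) * (8 * (real (block_width n K + 1) / real n) ^ 3 + 8 * F / real n ^ 2) / real n) \<longlonglongrightarrow> 0"
    by simp
  then have "(\<lambda>n. 50 * real (2 * K + 1) ^ 2 * (8 * (real (block_width n K + 1) / real n) ^ 3 + 8 * F / real n ^ 2) +
     4 * real (2 * K + 1) ^ 3 * (real (2 * K + 1) * F / real n
       + 2 * real (2 * K + 1) * (8 * (real (block_width n K + 1) / real n) ^ 3 + 8 * F / real n ^ 2) / real n))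
    \<longlonglongrightarrow> 50 * real (2 * K + 1) ^ 2 * (8 * (1 / (2 * real K)) ^ 3 + 0) + 4 * real (2 * K + 1) ^ 3 * (0 + 0)"
    by (intro tendsto_add tendsto_mult tendsto_const bb inv)
  moreover have "8 * (1 / (2 * real K)) ^ 3 = 1 / real K ^ 3" by (simp add: power_divide power_mult_distrib)
  ultimately show ?thesis by simp
qed

text \<open>
  Separates \<open>folding_error\<close> into functions of \<open>degree Q\<close> and the field alone, whose limit is \<open>folding_error_limit\<close>.
\<close>

lemma (in prime_modulus) folding_error_ratio:
  "folding_error m K / real (degree Q) ^ (4 * m + 4) =
    50 * real (2 * K + 1) ^ 2 * (8 * (real (block_width (degree Q) K + 1) / real (degree Q)) ^ 3 + 8 * FE_const / real (degree Q) ^ 2) +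
     4 * real (2 * K + 1) ^ 3 * (real (2 * K + 1) * FE_const / real (degree Q)
       + 2 * real (2 * K + 1) * (8 * (real (block_width (degree Q) K + 1) / real (degree Q)) ^ 3 + 8 * FE_const / real (degree Q) ^ 2) / real (degree Q))"
proof -
  define n X w F C where nX: "n = real (degree Q)" "X = n ^ (4 * m)" and wF: "w = real (block_width (degree Q) K + 1)" "F = FE_const" "C = real (2 * K + 1)"
  have n: "n \<noteq> 0" using deg_pos by (simp add: nX)
  then have X: "X \<noteq> 0" by (simp add: nX)
  have pw: "n ^ (4 * m + 1) = X * n" "n ^ (4 * m + 2) = X * n ^ 2" "n ^ (4 * m + 4) = X * n ^ 4"
    by (simp_all only: nX(2) power_add power_one_right)
  define B where "B = 8 * (X * n * w ^ 3) + 8 * (F * (X * n ^ 2))"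
  have B: "B / (X * n ^ 4) = 8 * (w / n) ^ 3 + 8 * F / n ^ 2"
    using n X by (simp add: B_def power_divide add_divide_distrib power4_eq_xxxx power3_eq_cube power2_eq_square)
  have main: "C * n * (F * (X * n ^ 2)) / (X * n ^ 4) = C * F / n"
    using n X by (simp add: power4_eq_xxxx power2_eq_square)
  have split: "(a * B + b * (c + d * B / n)) / Y = a * (B / Y) + b * (c / Y + d * (B / Y) / n)" for a b c d Y
    by (simp add: add_divide_distrib distrib_left)
  have "folding_error m K / n ^ (4 * m + 4) =
      (50 * C ^ 2 * B + 4 * C ^ 3 * (C * n * (F * (X * n ^ 2)) + 2 * C * B / n)) / (X * n ^ 4)"
    unfolding folding_error_def block_bound_def nX(1)[symmetric] pw wF[symmetric] B_def ..
  then show ?thesis unfolding split B main unfolding nX(1) wF .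
qed

text \<open>
  The block width is about \<open>n / (2K)\<close>. With the divisor bound taken at \<open>T = 16 K\<close>, the square of the divisor count has
  exponential rate \<open>1 / (4K)\<close>, half of what the denominator provides.
\<close>

lemma off_diagonal_limit:
  assumes K: "K > 0" and q: "q \<ge> 2"
  shows "(\<lambda>n. (4 * (real ((2 * n + 1) ^ s * 2 ^ (2 * n div (16 * K))))\<^sup>2 + 8) / q ^ block_width n K) \<longlonglongrightarrow> 0"
proof (rule Lim_null_comparison)
  define c where "c = 1 / (4 * real K)"
  have c: "c > 0" using K by (simp add: c_def)
  have 2: "(2 :: real) powr (2 * c * real n - 1) \<le> q ^ block_width n K" for n
  proof -
    define w where "w = n div (2 * K)"
    have w: "block_width n K = w" by (simp add: block_width_def w_def div_mult2_eq)
    have "n < 2 * K * (w + 1)" using dividend_less_times_div[of "2 * K" n] K by (simp add: w_def)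
    then have "real n < real (2 * K * (w + 1))" by (simp only: of_nat_less_iff)
    then have "real n < 2 * real K * (real (block_width n K) + 1)" by (simp add: w distrib_left)
    then have "2 * c * real n - 1 \<le> real (block_width n K)" using K by (simp add: c_def field_simps)
    then have "(2 :: real) powr (2 * c * real n - 1) \<le> 2 powr real (block_width n K)" by simp
    also have "\<dots> = 2 ^ block_width n K" by (simp add: powr_realpow)
    also have "\<dots> \<le> q ^ block_width n K" using q by (intro power_mono) auto
    finally show ?thesis .
  qed
  have 1: "(real ((2 * n + 1) ^ s * 2 ^ (2 * n div (16 * K))))\<^sup>2 \<le> (2 * real n + 1) ^ (2 * s) * 2 powr (c * real n)" for n
  proof -
    define w where "w = 2 * n div (16 * K)"
    have "16 * K * w \<le> 2 * n" unfolding w_def by (rule times_div_less_eq_dividend)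
    then have "real (16 * K * w) \<le> real (2 * n)" by (simp only: of_nat_le_iff)
    then have "real (2 * w) \<le> c * real n" using K by (simp add: c_def field_simps)
    note this[unfolded w_def]
    then have "(2 :: real) powr real (2 * (2 * n div (16 * K))) \<le> 2 powr (c * real n)" by simp
    then have "(2 :: real) ^ (2 * (2 * n div (16 * K))) \<le> 2 powr (c * real n)" by (simp only: powr_realpow zero_less_numeral)
    then have "(2 * real n + 1) ^ (2 * s) * 2 ^ (2 * (2 * n div (16 * K))) \<le> (2 * real n + 1) ^ (2 * s) * 2 powr (c * real n)"
      by (intro mult_left_mono) auto
    moreover have "(real ((2 * n + 1) ^ s * 2 ^ (2 * n div (16 * K))))\<^sup>2 = (2 * real n + 1) ^ (2 * s) * 2 ^ (2 * (2 * n div (16 * K)))"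
      by (simp add: power_mult_distrib power_mult[symmetric] ac_simps)
    ultimately show ?thesis by simp
  qed
  show "\<forall>\<^sub>F n in sequentially. norm ((4 * (real ((2 * n + 1) ^ s * 2 ^ (2 * n div (16 * K))))\<^sup>2 + 8) / q ^ block_width n K)
      \<le> (4 * ((2 * real n + 1) powr real (2 * s) * 2 powr (c * real n)) + 8) / 2 powr (2 * c * real n - 1)"
  proof (intro always_eventually allI)
    fix n
    have "(2 * real n + 1) ^ (2 * s) = (2 * real n + 1) powr real (2 * s)" by (rule powr_realpow[symmetric]) simp
    then have "(4 * (real ((2 * n + 1) ^ s * 2 ^ (2 * n div (16 * K))))\<^sup>2 + 8) / q ^ block_width n K
       \<le> (4 * ((2 * real n + 1) powr real (2 * s) * 2 powr (c * real n)) + 8) / 2 powr (2 * c * real n - 1)"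
      using 1[of n] 2[of n] by (intro frac_le) auto
    then show "norm ((4 * (real ((2 * n + 1) ^ s * 2 ^ (2 * n div (16 * K))))\<^sup>2 + 8) / q ^ block_width n K)
      \<le> (4 * ((2 * real n + 1) powr real (2 * s) * 2 powr (c * real n)) + 8) / 2 powr (2 * c * real n - 1)"
      using q by simp
  qed
  define \<sigma> where "\<sigma> = real (2 * s)"
  show "(\<lambda>n. (4 * ((2 * real n + 1) powr real (2 * s) * 2 powr (c * real n)) + 8) / 2 powr (2 * c * real n - 1)) \<longlonglongrightarrow> 0"
    unfolding \<sigma>_def[symmetric] using c by real_asymp
qed

text \<open>
  First fix \<open>K\<close> so large that the limits of the two error terms are small, then let the degree grow.
\<close>

lemma fourth_moment_close:
  assumes \<epsilon>: "\<epsilon> > 0"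
  shows "\<forall>\<^sub>F Q :: 'a::finite_field poly in primes_at_infinity.
    \<bar>sqrt ((1 - 1 / real CARD('a)) * normalised_fourth_moment m Q) -
     sqrt ((1 - 1 / real CARD('a)) * (main_sum m (degree Q) / real (degree Q) ^ (4 * m + 4)))\<bar> < \<epsilon>"
proof -
  have "(\<lambda>K. sqrt (50 * real (2 * K + 1) ^ 2 * (1 / real K ^ 3)) + sqrt (12 / real K)) \<longlonglongrightarrow> 0"
    by real_asymp
  then have "\<forall>\<^sub>F K in sequentially. sqrt (50 * real (2 * K + 1) ^ 2 * (1 / real K ^ 3)) + sqrt (12 / real K) < \<epsilon>"
    using \<epsilon> by (rule order_tendstoD(2))
  moreover have "\<forall>\<^sub>F K in sequentially. K > (0 :: nat)" by (rule eventually_gt_at_top)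
  ultimately have "\<forall>\<^sub>F K in sequentially. K > 0 \<and> sqrt (50 * real (2 * K + 1) ^ 2 * (1 / real K ^ 3)) + sqrt (12 / real K) < \<epsilon>"
    by eventually_elim simp
  then obtain K :: nat where K: "K > 0" and Ke: "sqrt (50 * real (2 * K + 1) ^ 2 * (1 / real K ^ 3)) + sqrt (12 / real K) < \<epsilon>"
    using eventually_happens'[OF sequentially_bot] by blast
  define q where "q = real CARD('a)"
  have "2 \<le> CARD('a)" using card_mono[of UNIV "{0, 1 :: 'a}"] by simp
  then have q: "q \<ge> 2" by (simp add: q_def)
  define F where "F = prime_modulus.FE_const (sqrt q)"
  have "16 * K > 0" using K by simp
  then obtain s where s: "\<And>(N :: 'a poly) D. N \<noteq> 0 \<Longrightarrow> degree N \<le> D \<Longrightarrow> card (monic_divisors N) \<le> (D + 1) ^ s * 2 ^ (D div (16 * K))"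
    using divisor_bound by blast
  define T where "T n = (2 * n + 1) ^ s * 2 ^ (2 * n div (16 * K))" for n
  define fe where "fe n = 50 * real (2 * K + 1) ^ 2 * (8 * (real (block_width n K + 1) / real n) ^ 3 + 8 * F / real n ^ 2) +
     4 * real (2 * K + 1) ^ 3 * (real (2 * K + 1) * F / real n
       + 2 * real (2 * K + 1) * (8 * (real (block_width n K + 1) / real n) ^ 3 + 8 * F / real n ^ 2) / real n)" for n
  define me where "me n = 8 / real n + 24 * (real (block_width n K + 1) / real n) + (4 * (real (T n))\<^sup>2 + 8) / q ^ block_width n K" for n
  have "fe \<longlonglongrightarrow> 50 * real (2 * K + 1) ^ 2 * (1 / real K ^ 3)"
    unfolding fe_def[abs_def] by (rule folding_error_limit[OF K])
  moreover have "me \<longlonglongrightarrow> 0 + 24 * (1 / (2 * real K)) + 0"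
    unfolding me_def[abs_def] T_def
    by (intro tendsto_add tendsto_mult tendsto_const block_width_limit[OF K] off_diagonal_limit[OF K q]) real_asymp
  ultimately have "(\<lambda>n. sqrt (fe n) + sqrt (me n)) \<longlonglongrightarrow>
      sqrt (50 * real (2 * K + 1) ^ 2 * (1 / real K ^ 3)) + sqrt (0 + 24 * (1 / (2 * real K)) + 0)"
    by (intro tendsto_add tendsto_real_sqrt)
  then have "\<forall>\<^sub>F n in sequentially. sqrt (fe n) + sqrt (me n) < \<epsilon>"
    using Ke by (intro order_tendstoD(2)) simp_all
  moreover have "\<forall>\<^sub>F n in sequentially. 2 * K \<le> n" by (rule eventually_ge_at_top)
  ultimately have "\<forall>\<^sub>F n in sequentially. sqrt (fe n) + sqrt (me n) < \<epsilon> \<and> 2 * K \<le> n" by eventually_elim simp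
  from eventually_compose_filterlim[OF this filterlim_degree_primes]
  have "\<forall>\<^sub>F Q :: 'a poly in primes_at_infinity. sqrt (fe (degree Q)) + sqrt (me (degree Q)) < \<epsilon> \<and> 2 * K \<le> degree Q" .
  then show ?thesis using eventually_prime
  proof eventually_elim
    case (elim Q)
    interpret prime_modulus Q "sqrt q" by unfold_locales (use elim in \<open>auto simp: q_def\<close>)
    have P: "1 - 1 / real CARD('a) \<noteq> 0" using q by (simp add: q_def)
    have "0 < degree Q div (2 * K)" using elim K by (simp add: div_greater_zero_iff)
    then have w: "block_width (degree Q) K > 0" by (simp add: block_width_def div_mult2_eq)
    have "(1 - 1 / real CARD('a)) * normalised_fourth_moment m Q = mean_fourth m / real (degree Q) ^ (4 * m + 4)"
      using P by (simp add: normalised_fourth_moment_eq)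
    moreover have "folding_error m K / real (degree Q) ^ (4 * m + 4) = fe (degree Q)"
      unfolding folding_error_ratio fe_def F_def ..
    moreover have "moment_error K (T (degree Q)) = me (degree Q)" by (simp add: moment_error_def me_def q_def)
    moreover have "card (monic_divisors N) \<le> T (degree Q)" if "N \<noteq> 0" "degree N \<le> 2 * degree Q" for N :: "'a poly"
      unfolding T_def using s[OF that] .
    note mean_fourth_main_term[OF K w this, where m = m]
    ultimately show ?case using elim by simp
  qed
qed

lemma moment_integral_nonneg: "moment_integral m \<ge> 0"
proof -
  have "main_sum m n \<ge> 0" for n
    unfolding main_sum_def by (intro sum_nonneg) (auto intro!: mult_nonneg_nonneg fold_weight_nonneg)
  then show ?thesis by (intro LIMSEQ_le_const[OF main_sum_tendsto]) auto
qed

text \<open>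
  Square roots were compared in \<open>fourth_moment_close\<close>; squaring them returns to the moment itself, and the factor
  \<open>1 - 1/q\<close> cancels.
\<close>

theorem normalised_fourth_moment_tendsto:
  "(normalised_fourth_moment m \<longlongrightarrow> moment_integral m) (primes_at_infinity :: 'a::finite_field poly filter)"
proof -
  define p where "p = 1 - 1 / real CARD('a)"
  have "2 \<le> CARD('a)" using card_mono[of UNIV "{0, 1 :: 'a}"] by simp
  then have p: "p > 0" by (simp add: p_def)
  define M where "M = (normalised_fourth_moment m :: 'a poly \<Rightarrow> real)"
  define G where "G n = sqrt (p * (main_sum m n / real n ^ (4 * m + 4)))" for n
  have "G \<longlonglongrightarrow> sqrt (p * moment_integral m)"
    unfolding G_def[abs_def] by (intro tendsto_intros main_sum_tendsto)
  then have "((\<lambda>Q :: 'a poly. G (degree Q)) \<longlongrightarrow> sqrt (p * moment_integral m)) primes_at_infinity"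
    by (rule filterlim_compose[OF _ filterlim_degree_primes])
  moreover have "((\<lambda>Q :: 'a poly. sqrt (p * M Q) - G (degree Q)) \<longlongrightarrow> 0) primes_at_infinity"
    by (rule tendstoI) (use fourth_moment_close[of _ m] in \<open>simp add: dist_real_def p_def G_def M_def\<close>)
  ultimately have "((\<lambda>Q :: 'a poly. G (degree Q) + (sqrt (p * M Q) - G (degree Q))) \<longlongrightarrow> sqrt (p * moment_integral m) + 0) primes_at_infinity"
    by (rule tendsto_add)
  then have L: "((\<lambda>Q :: 'a poly. sqrt (p * M Q)) \<longlongrightarrow> sqrt (p * moment_integral m)) primes_at_infinity" by simp
  have "((\<lambda>Q :: 'a poly. (sqrt (p * M Q))\<^sup>2 / p) \<longlongrightarrow> (sqrt (p * moment_integral m))\<^sup>2 / p) primes_at_infinity"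
    using p by (intro tendsto_divide tendsto_power tendsto_const L) auto
  moreover have "M Q \<ge> 0" for Q :: "'a poly"
    unfolding M_def normalised_fourth_moment_def
    using p \<open>2 \<le> CARD('a)\<close> by (intro mult_nonneg_nonneg sum_nonneg) (auto simp: p_def)
  ultimately show ?thesis using p moment_integral_nonneg[of m] by (simp add: M_def)
qed

theorem theorem2p7:
  shows "(\<forall>m.
      (normalised_fourth_moment m \<longlongrightarrow> D_lim TYPE('a::finite_field) m)
        (primes_at_infinity :: 'a poly filter) \<and>
      D_lim TYPE('a) m =
        (LINT (a1, a2, a3, a4) : integration_domain | lborel.
           ((a1 + a3) ^ m * (a1 + a4) ^ m + (1 - a1 - a3) ^ m * (1 - a1 - a4) ^ m)
         * ((a2 + a3) ^ m * (a2 + a4) ^ m + (1 - a2 - a3) ^ m * (1 - a2 - a4) ^ m)))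
    \<and> D_lim TYPE('a) \<sim>[at_top] (\<lambda>m. 1 / (16 * real m ^ 4))"
proof -
  have D: "D_lim TYPE('a) m = moment_integral m" for m
    unfolding D_lim_def by (rule tendsto_Lim[OF primes_at_infinity_nontrivial normalised_fourth_moment_tendsto])
  then have "D_lim TYPE('a) = moment_integral" by (rule ext)
  then show ?thesis
    using normalised_fourth_moment_tendsto[where ?'a = 'a] moment_integral_asymp
    by (simp add: moment_integral_def moment_integrand_def set_lebesgue_integral_def case_prod_unfold)
qed

end
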